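(* Let $\gamma_t(x)$ be a $C^\infty$ function defined on a neighborhood of $(0,0)$ in $\mathbb{R}^N\times\mathbb{R}^n$ with values in $\mathbb{R}^n$ and $\gamma_0(x)\equiv x$. Then: (i) every element $(Z,d)$ of $\mathcal{L}(\mathcal P\cup\mathcal N)$ has $Z$ equal to a linear combination with constant coefficients of vector fields of elements of $\mathcal{L}(\widehat{\mathcal P}\cup\widehat{\mathcal N})$ with the same degree $d$, and every element of $\mathcal L(\mathcal P)$ is likewise a constant-coefficient linear combination of elements of $\mathcal L(\widehat{\mathcal P})$ with the same degree; (ii) every element of $\mathcal{L}(\widehat{\mathcal P}\cup\widehat{\mathcal N})$ is a constant-coefficient linear combination of elements of $\mathcal{L}(\mathcal P\cup\mathcal N)$ with the same degree, and every element of $\mathcal L(\widehat{\mathcal P})$ is a constant-coefficient linear combination of elements of $\mathcal L(\mathcal P)$ with the same degree.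
   Context: Fix $e=\{e_1,\dots,e_N\}\subseteq[0,\infty)^\nu$ (each $e_i$ has a nonzero component; for each $\mu$ some $e_i^\mu\ne0$). $W(t,x)=\frac{d}{d\epsilon}|_{\epsilon=1}\gamma_{\epsilon t}\circ\gamma_t^{-1}(x)$ (scalar $\epsilon$), with Taylor series in $t$: $W(t)\sim\sum_{|\alpha|>0}t^\alpha X_\alpha$. The $\widehat X_\alpha$ are the unique smooth vector fields with $\gamma_t(x)=e^{\sum_{0<|\alpha|<M}t^\alpha\widehat X_\alpha}x+O(|t|^M)$ for every $M$. $\deg(\alpha)=\sum_i\alpha_ie_i$; $\alpha$ is pure if $\deg\alpha$ has exactly one nonzero component, nonpure otherwise. $\mathcal P=\{(X_\alpha,\deg\alpha):\alpha$ pure$\}$, $\mathcal N=\{(X_\alpha,\deg\alpha):\alpha$ nonpure$\}$, $\widehat{\mathcal P},\widehat{\mathcal N}$ likewise with $\widehat X_\alpha$. $\mathcal L(\mathcal S)$ is the smallest set containing $\mathcal S$ and containing $([Z_1,Z_2],d_1+d_2)$ whenever it contains $(Z_1,d_1),(Z_2,d_2)$. *)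

theory Defs
  imports "HOL-Analysis.Analysis"
begin

fun Ck_on :: "nat \<Rightarrow> 'a::euclidean_space set \<Rightarrow> ('a \<Rightarrow> 'b::real_normed_vector) \<Rightarrow> bool" where
  "Ck_on 0 U f = continuous_on U f"
| "Ck_on (Suc k) U f =
     (f differentiable_on U \<and>
      (\<forall>v\<in>Basis. Ck_on k U (\<lambda>x. frechet_derivative f (at x) v)))"

definition smooth_on :: "'a::euclidean_space set \<Rightarrow> ('a \<Rightarrow> 'b::real_normed_vector) \<Rightarrow> bool" where
  "smooth_on U f \<longleftrightarrow> (\<forall>k. Ck_on k U f)"

type_synonym 'n vf = "real^'n \<Rightarrow> real^'n"

definition lie_bracket :: "'n::finite vf \<Rightarrow> 'n vf \<Rightarrow> 'n vf" where
  "lie_bracket Z1 Z2 = (\<lambda>x. frechet_derivative Z2 (at x) (Z1 x) - frechet_derivative Z1 (at x) (Z2 x))"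

inductive_set Lie_closure :: "('n::finite vf \<times> 'd::plus) set \<Rightarrow> ('n vf \<times> 'd) set"
  for S where
  base: "p \<in> S \<Longrightarrow> p \<in> Lie_closure S"
| bracket: "(Z1, d1) \<in> Lie_closure S \<Longrightarrow> (Z2, d2) \<in> Lie_closure S \<Longrightarrow>
            (lie_bracket Z1 Z2, d1 + d2) \<in> Lie_closure S"

definition lin_comb_same_deg :: "('n::finite vf \<times> 'd) set \<Rightarrow> 'n vf \<Rightarrow> 'd \<Rightarrow> bool" where
  "lin_comb_same_deg A Z d \<longleftrightarrow>
     (\<exists>(k::nat) (c::nat \<Rightarrow> real) (Y::nat \<Rightarrow> 'n vf).
        (\<forall>j<k. (Y j, d) \<in> A) \<and> (\<forall>\<^sub>F x in nhds 0. Z x = (\<Sum>j<k. c j *\<^sub>R Y j x)))"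

definition mi_abs :: "('N::finite \<Rightarrow> nat) \<Rightarrow> nat" where
  "mi_abs \<alpha> = (\<Sum>i\<in>UNIV. \<alpha> i)"

definition tmono :: "real^'N::finite \<Rightarrow> ('N \<Rightarrow> nat) \<Rightarrow> real" where
  "tmono t \<alpha> = (\<Prod>i\<in>UNIV. (t $ i) ^ \<alpha> i)"

definition mdeg :: "('N::finite \<Rightarrow> real^'v::finite) \<Rightarrow> ('N \<Rightarrow> nat) \<Rightarrow> real^'v" where
  "mdeg e \<alpha> = (\<Sum>i\<in>UNIV. real (\<alpha> i) *\<^sub>R e i)"

definition pure :: "('N::finite \<Rightarrow> real^'v::finite) \<Rightarrow> ('N \<Rightarrow> nat) \<Rightarrow> bool" where
  "pure e \<alpha> \<longleftrightarrow> card {\<mu>. mdeg e \<alpha> $ \<mu> \<noteq> 0} = 1"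

definition trunc_series :: "(('N::finite \<Rightarrow> nat) \<Rightarrow> 'n::finite vf) \<Rightarrow> nat \<Rightarrow> real^'N \<Rightarrow> 'n vf" where
  "trunc_series Z M t = (\<lambda>x. \<Sum>\<alpha>\<in>{\<alpha>. 0 < mi_abs \<alpha> \<and> mi_abs \<alpha> < M}. tmono t \<alpha> *\<^sub>R Z \<alpha> x)"

definition flow1 :: "'n::finite vf \<Rightarrow> real^'n \<Rightarrow> real^'n \<Rightarrow> bool" where
  "flow1 V x z \<longleftrightarrow>
     (\<exists>y::real \<Rightarrow> real^'n. y 0 = x \<and> y 1 = z \<and>
        (\<forall>s\<in>{0..1}. (y has_vector_derivative V (y s)) (at s within {0..1})))"

definition pureSet :: "('N::finite \<Rightarrow> real^'v::finite) \<Rightarrow> (('N \<Rightarrow> nat) \<Rightarrow> 'n::finite vf)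
    \<Rightarrow> ('n vf \<times> (real^'v)) set" where
  "pureSet e Z = {(Z \<alpha>, mdeg e \<alpha>) | \<alpha>. 0 < mi_abs \<alpha> \<and> pure e \<alpha>}"

definition nonpureSet :: "('N::finite \<Rightarrow> real^'v::finite) \<Rightarrow> (('N \<Rightarrow> nat) \<Rightarrow> 'n::finite vf)
    \<Rightarrow> ('n vf \<times> (real^'v)) set" where
  "nonpureSet e Z = {(Z \<alpha>, mdeg e \<alpha>) | \<alpha>. 0 < mi_abs \<alpha> \<and> \<not> pure e \<alpha>}"

end

theory Submission
  imports Defs "HOL-Library.Function_Algebras"
begin

text \<open>
  Fix a direction \<open>v\<close> and put \<open>\<phi> (s, y) = \<gamma> (s v) y\<close>. On \<open>(s, x)\<close>-space let \<open>E = s \<partial>\<^sub>s\<close> and let \<open>V\<close> be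
  the vertical field \<open>\<Sum> s\<^bsup>|\<alpha>|\<^esup> v\<^sup>\<alpha> Xh\<^sub>\<alpha>\<close>. Modulo \<open>O(s\<^sup>M)\<close>, composition with \<open>\<phi>\<close> is the operator \<open>e\<^sup>V\<close>: this
  is Taylor's theorem along the flow of \<open>V\<close>, pointwise in \<open>y\<close>, and it is uniform because both sides
  are smooth. Differentiating in \<open>s\<close> and solving \<open>x = \<phi> (s, y)\<close> for \<open>y\<close> shows that \<open>W (s v)\<close> is
  \<open>e\<^bsup>-V\<^esup> E e\<^sup>V\<close> applied to the identity, that is, the vertical part of \<open>\<Sum>\<^sub>k (- ad V)\<^sup>k E / k!\<close>, up to
  \<open>O(s\<^sup>M)\<close>. Comparing coefficients of the monomials in \<open>s v\<close> gives
  \<open>X\<^sub>\<alpha> = |\<alpha>| Xh\<^sub>\<alpha> +\<close> a combination of iterated brackets of fields \<open>Xh\<^sub>\<beta>\<close> whose indices sum to \<open>\<alpha>\<close>.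
  These relations are triangular in \<open>|\<alpha>|\<close>, hence can be inverted, and they preserve degrees; since
  the \<open>e\<^sub>i\<close> are nonnegative and nonzero, a decomposition of a pure index has only pure parts.
\<close>

subsection \<open>Calculus of continuously differentiable functions\<close>

text \<open>The asymptotic hypotheses on \<open>W\<close> and on the flows are pointwise in
  \<open>x\<close>: constant and time range may vary with \<open>x\<close>, and \<open>W\<close> is
  not assumed smooth. The bounds that get differentiated, or moved from \<open>y\<close> to
  \<open>x = \<phi> (s, y)\<close>, must be uniform. For the smooth difference between composition
  with \<phi> and the truncated exponential, a pointwise bound O(s^M) already makes all time
  derivatives of order below \<open>M\<close> vanish at time 0; this gives a uniform bound that
  survives differentiation along \<open>E\<close>. The estimate for \<open>W\<close> first appears
  at the points (s, \<phi> (s, y)); Brouwer's theorem shows that they fill a neighbourhood for small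
  s \<ge> 0, so no smooth inverse of \<phi> enters. The field \<open>E\<close> occurs because
  scaling t = s v by \<epsilon> scales s, and [E, s^m Z] = m s^m Z produces the factor |\<alpha>|.
  Every identity between exponentials is a finite one: what truncation leaves over contains at least
  \<open>M\<close> factors \<open>V\<close>, each carrying a factor s. Lie closures are compared
  with the multi-index itself as degree; degrees built from \<open>e\<close> are additive images of
  it.\<close>

lemma differentiable_on_open_has_derivative:
  assumes "open U" "f differentiable_on U" "x \<in> U"
  shows "(f has_derivative frechet_derivative f (at x)) (at x)"
  using assms differentiable_on_eq_differentiable_at frechet_derivative_works by blast

lemma Ck_on_subset: "Ck_on k U f \<Longrightarrow> V \<subseteq> U \<Longrightarrow> Ck_on k V f"
proof (induction k arbitrary: f)
  case 0 then show ?case using continuous_on_subset by auto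
next
  case (Suc k) then show ?case using differentiable_on_subset by auto
qed

lemma Ck_on_cong:
  assumes "open U" "\<And>x. x \<in> U \<Longrightarrow> f x = g x" "Ck_on k U f"
  shows "Ck_on k U g"
  using assms(2,3)
proof (induction k arbitrary: f g)
  case 0 then show ?case using continuous_on_cong[of U U f g] by simp
next
  case (Suc k)
  have d: "(g has_derivative frechet_derivative f (at x)) (at x)" if "x \<in> U" for x
    using has_derivative_transform_within_open[OF differentiable_on_open_has_derivative assms(1) that]
      assms(1) Suc.prems that by (metis Ck_on.simps(2))
  have e: "frechet_derivative f (at x) = frechet_derivative g (at x)" if "x \<in> U" for x
    using d[OF that] frechet_derivative_at by blast
  have "g differentiable_on U"
    using d differentiable_at_imp_differentiable_on unfolding differentiable_def by blast
  moreover have "Ck_on k U (\<lambda>x. frechet_derivative g (at x) v)" if "v \<in> Basis" for v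
    by (rule Suc.IH[of "\<lambda>x. frechet_derivative f (at x) v"]) (use e Suc.prems that in auto)
  ultimately show ?case by simp
qed

text \<open>Allows any explicit derivative in place of the chosen \<open>frechet_derivative\<close>;
  the closure properties below are inductions through this rule.\<close>

lemma Ck_on_Suc_has_derivativeI:
  assumes "open U" "\<And>x. x \<in> U \<Longrightarrow> (f has_derivative f' x) (at x)"
    and "\<And>v. v \<in> Basis \<Longrightarrow> Ck_on k U (\<lambda>x. f' x v)"
  shows "Ck_on (Suc k) U f"
proof -
  have e: "frechet_derivative f (at x) = f' x" if "x \<in> U" for x
    using assms(2)[OF that] frechet_derivative_at by metis
  have "f differentiable_on U"
    using assms(2) differentiable_at_imp_differentiable_on unfolding differentiable_def by blast
  moreover have "Ck_on k U (\<lambda>x. frechet_derivative f (at x) v)" if "v \<in> Basis" for v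
    by (rule Ck_on_cong[OF assms(1) _ assms(3)[OF that]]) (simp add: e)
  ultimately show ?thesis by simp
qed

lemma Ck_on_Suc_imp_Ck_on: "Ck_on (Suc k) U f \<Longrightarrow> Ck_on k U f"
proof (induction k arbitrary: f)
  case 0 then show ?case using differentiable_imp_continuous_on by auto
next
  case (Suc k) then show ?case by (metis Ck_on.simps(2))
qed

lemma Ck_on_const: "open U \<Longrightarrow> Ck_on k U (\<lambda>x. c)"
proof (induction k arbitrary: c)
  case (Suc k)
  show ?case by (rule Ck_on_Suc_has_derivativeI[where f' = "\<lambda>x v. 0"]) (use Suc in auto)
qed auto

lemma Ck_on_add:
  assumes "open U" "Ck_on k U f" "Ck_on k U g"
  shows "Ck_on k U (\<lambda>x. f x + g x)"
  using assms(2,3)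
proof (induction k arbitrary: f g)
  case 0 then show ?case by (auto intro: continuous_intros)
next
  case (Suc k)
  show ?case
    by (rule Ck_on_Suc_has_derivativeI[OF assms(1), where
         f' = "\<lambda>x v. frechet_derivative f (at x) v + frechet_derivative g (at x) v"])
       (use Suc differentiable_on_open_has_derivative[OF assms(1)] in \<open>auto intro!: has_derivative_add\<close>)
qed

lemma Ck_on_sum:
  assumes "open U" "\<And>i. i \<in> I \<Longrightarrow> Ck_on k U (f i)"
  shows "Ck_on k U (\<lambda>x. \<Sum>i\<in>I. f i x)"
  using assms(2)
  by (induction I rule: infinite_finite_induct) (auto intro: Ck_on_add Ck_on_const assms(1))

lemma Ck_on_bounded_linear_compose:
  assumes "open U" "bounded_linear h" "Ck_on k U f"
  shows "Ck_on k U (\<lambda>x. h (f x))"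
  using assms(3)
proof (induction k arbitrary: f)
  case 0 then show ?case using bounded_linear.continuous_on[OF assms(2)] by auto
next
  case (Suc k)
  show ?case
    by (rule Ck_on_Suc_has_derivativeI[OF assms(1), where
         f' = "\<lambda>x v. h (frechet_derivative f (at x) v)"])
       (use Suc in \<open>auto intro!: bounded_linear.has_derivative[OF assms(2)]
          differentiable_on_open_has_derivative[OF assms(1)]\<close>)
qed

lemma Ck_on_bounded_linear:
  assumes "open U" "bounded_linear h"
  shows "Ck_on k U h"
proof (cases k)
  case 0 then show ?thesis using bounded_linear.continuous_on[OF assms(2), of U "\<lambda>x. x"] by auto
next
  case (Suc j)
  show ?thesis unfolding Suc
    by (rule Ck_on_Suc_has_derivativeI[OF assms(1), where f' = "\<lambda>x v. h v"])
       (use bounded_linear_imp_has_derivative[OF assms(2)] Ck_on_const assms(1) in auto)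
qed

lemma Ck_on_scaleR:
  fixes f :: "'a::euclidean_space \<Rightarrow> real"
  assumes "open U" "Ck_on k U f" "Ck_on k U g"
  shows "Ck_on k U (\<lambda>x. f x *\<^sub>R g x)"
  using assms(2,3)
proof (induction k arbitrary: f g)
  case 0 then show ?case by (auto intro: continuous_intros)
next
  case (Suc k)
  note D = differentiable_on_open_has_derivative[OF assms(1)]
  show ?case
  proof (rule Ck_on_Suc_has_derivativeI[OF assms(1)])
    show "((\<lambda>x. f x *\<^sub>R g x) has_derivative
       (\<lambda>v. f x *\<^sub>R frechet_derivative g (at x) v + frechet_derivative f (at x) v *\<^sub>R g x)) (at x)"
      if "x \<in> U" for x
      by (rule has_derivative_scaleR) (use Suc.prems that D in auto)
    show "Ck_on k U (\<lambda>x. f x *\<^sub>R frechet_derivative g (at x) v + frechet_derivative f (at x) v *\<^sub>R g x)"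
      if "v \<in> Basis" for v
      by (intro Ck_on_add assms(1) Suc.IH)
         (use that Suc.prems Ck_on_Suc_imp_Ck_on in auto)
  qed
qed

lemma linear_euclidean_expansion:
  fixes h :: "'a::euclidean_space \<Rightarrow> 'b::real_normed_vector"
  assumes "linear h"
  shows "h w = (\<Sum>b\<in>Basis. (w \<bullet> b) *\<^sub>R h b)"
proof -
  have "h w = h (\<Sum>b\<in>Basis. (w \<bullet> b) *\<^sub>R b)" by (simp add: euclidean_representation)
  also have "\<dots> = (\<Sum>b\<in>Basis. (w \<bullet> b) *\<^sub>R h b)"
    by (simp add: linear_sum[OF assms] linear_cmul[OF assms])
  finally show ?thesis .
qed

text \<open>\<open>Ck_on\<close> controls derivatives along fixed basis vectors only. Expanding the
  moving direction \<open>Z x\<close> in the basis reduces to sums of products.\<close>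

lemma Ck_on_frechet_derivative:
  fixes f :: "'a::euclidean_space \<Rightarrow> 'b::real_normed_vector"
  assumes "open U" "Ck_on (Suc k) U f" "Ck_on k U Z"
  shows "Ck_on k U (\<lambda>x. frechet_derivative f (at x) (Z x))"
proof (rule Ck_on_cong[OF assms(1)])
  show "Ck_on k U (\<lambda>x. \<Sum>b\<in>Basis. (Z x \<bullet> b) *\<^sub>R frechet_derivative f (at x) b)"
    by (intro Ck_on_sum Ck_on_scaleR assms(1)
         Ck_on_bounded_linear_compose[OF assms(1) bounded_linear_inner_left])
       (use assms in auto)
  fix x assume "x \<in> U"
  then have "linear (frechet_derivative f (at x))"
    using differentiable_on_open_has_derivative[OF assms(1)] assms(2) has_derivative_linear
    by (metis Ck_on.simps(2))
  then show "(\<Sum>b\<in>Basis. (Z x \<bullet> b) *\<^sub>R frechet_derivative f (at x) b) = frechet_derivative f (at x) (Z x)"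
    using linear_euclidean_expansion by metis
qed

text \<open>Only \<open>g\<close> is generalised: the chain rule leaves products of derivatives of
  \<open>f\<close> with partial derivatives of \<open>g\<close> composed with the same
  \<open>f\<close>.\<close>

lemma Ck_on_compose:
  fixes f :: "'a::euclidean_space \<Rightarrow> 'b::euclidean_space" and g :: "'b \<Rightarrow> 'c::real_normed_vector"
  assumes "open U" "open V" "f ` U \<subseteq> V" "Ck_on k U f" "Ck_on k V g"
  shows "Ck_on k U (\<lambda>x. g (f x))"
  using assms(4,5)
proof (induction k arbitrary: g)
  case 0 then show ?case
    using continuous_on_compose2[of V g U f] assms(3) by auto
next
  case (Suc k)
  note DU = differentiable_on_open_has_derivative[OF assms(1)]
  note DV = differentiable_on_open_has_derivative[OF assms(2)]
  have lin: "linear (frechet_derivative g (at (f x)))" if "x \<in> U" for x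
    using DV[of g "f x"] Suc.prems that assms(3) has_derivative_linear by auto
  show ?case
  proof (rule Ck_on_Suc_has_derivativeI[OF assms(1)])
    show "((\<lambda>x. g (f x)) has_derivative (\<lambda>v. frechet_derivative g (at (f x)) (frechet_derivative f (at x) v))) (at x)"
      if "x \<in> U" for x
    proof -
      have "f x \<in> V" using that assms(3) by auto
      then show ?thesis
        using has_derivative_compose[OF DU DV] that Suc.prems by auto
    qed
    show "Ck_on k U (\<lambda>x. frechet_derivative g (at (f x)) (frechet_derivative f (at x) v))"
      if v: "v \<in> Basis" for v
    proof (rule Ck_on_cong[OF assms(1)])
      show "Ck_on k U (\<lambda>x. \<Sum>b\<in>Basis. (frechet_derivative f (at x) v \<bullet> b) *\<^sub>R
                frechet_derivative g (at (f x)) b)"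
        by (intro Ck_on_sum Ck_on_scaleR assms(1)
           Ck_on_bounded_linear_compose[OF assms(1) bounded_linear_inner_left]
           Suc.IH[of "\<lambda>y. frechet_derivative g (at y) b" for b] Ck_on_Suc_imp_Ck_on[OF Suc.prems(1)])
          (use v Suc.prems in auto)
    qed (metis linear_euclidean_expansion lin)
  qed
qed

text \<open>Mixed second partials agree by the mean value theorem applied to the second difference
  quotient, once in each order.\<close>

lemma second_difference_mean_value:
  fixes f :: "'a::euclidean_space \<Rightarrow> real"
  assumes U: "open U" and f: "Ck_on 2 U f" "\<And>v. (\<lambda>x. frechet_derivative f (at x) v) differentiable_on U"
    and h: "0 < h" and mem: "\<And>r q. 0 \<le> r \<Longrightarrow> r \<le> h \<Longrightarrow> 0 \<le> q \<Longrightarrow> q \<le> h \<Longrightarrow> x + r *\<^sub>R u + q *\<^sub>R v \<in> U"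
  obtains r q where "0 < r" "r < h" "0 < q" "q < h"
    "f (x + h *\<^sub>R u + h *\<^sub>R v) - f (x + h *\<^sub>R u) - f (x + h *\<^sub>R v) + f x
     = h\<^sup>2 * frechet_derivative (\<lambda>y. frechet_derivative f (at y) u) (at (x + r *\<^sub>R u + q *\<^sub>R v)) v"
proof -
  have fd: "(f has_derivative frechet_derivative f (at y)) (at y)" if "y \<in> U" for y
    by (rule differentiable_on_open_has_derivative[OF U _ that]) (use f(1) in \<open>simp add: numeral_2_eq_2\<close>)
  define g where "g y = frechet_derivative f (at y) u" for y
  have gd: "(g has_derivative frechet_derivative g (at y)) (at y)" if "y \<in> U" for y
    using differentiable_on_open_has_derivative[OF U _ that] f(2) unfolding g_def by blast
  define p where "p r = f (x + r *\<^sub>R u + h *\<^sub>R v) - f (x + r *\<^sub>R u)" for r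
  have pd: "(p has_real_derivative g (x + r *\<^sub>R u + h *\<^sub>R v) - g (x + r *\<^sub>R u)) (at r)"
    if "0 \<le> r" "r \<le> h" for r
  proof -
    have 1: "((\<lambda>r. x + r *\<^sub>R u + h *\<^sub>R v) has_derivative (\<lambda>s. s *\<^sub>R u)) (at r)"
      and 2: "((\<lambda>r. x + r *\<^sub>R u) has_derivative (\<lambda>s. s *\<^sub>R u)) (at r)"
      by (auto intro!: derivative_eq_intros)
    have m1: "x + r *\<^sub>R u + h *\<^sub>R v \<in> U" using mem[of r h] that h by auto
    have m2: "x + r *\<^sub>R u \<in> U" using mem[of r 0] that h by auto
    have "(p has_derivative (\<lambda>s. frechet_derivative f (at (x + r *\<^sub>R u + h *\<^sub>R v)) (s *\<^sub>R u)
            - frechet_derivative f (at (x + r *\<^sub>R u)) (s *\<^sub>R u))) (at r)"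
      unfolding p_def
      by (intro has_derivative_diff has_derivative_compose[OF 1 fd[OF m1]] has_derivative_compose[OF 2 fd[OF m2]])
    moreover have "linear (frechet_derivative f (at (x + r *\<^sub>R u + h *\<^sub>R v)))"
      "linear (frechet_derivative f (at (x + r *\<^sub>R u)))"
      using fd[OF m1] fd[OF m2] has_derivative_linear by blast+
    ultimately show ?thesis
      unfolding has_field_derivative_def g_def
      by (elim has_derivative_eq_rhs) (simp add: fun_eq_iff linear_cmul algebra_simps)
  qed
  obtain r where r: "0 < r" "r < h"
    "p h - p 0 = (h - 0) * (g (x + r *\<^sub>R u + h *\<^sub>R v) - g (x + r *\<^sub>R u))"
    using MVT2[OF h, of p "\<lambda>r. g (x + r *\<^sub>R u + h *\<^sub>R v) - g (x + r *\<^sub>R u)"] pd by auto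
  have qd: "((\<lambda>q. g (x + r *\<^sub>R u + q *\<^sub>R v)) has_real_derivative
      frechet_derivative g (at (x + r *\<^sub>R u + q *\<^sub>R v)) v) (at q)" if "0 \<le> q" "q \<le> h" for q
  proof -
    have 1: "((\<lambda>q. x + r *\<^sub>R u + q *\<^sub>R v) has_derivative (\<lambda>s. s *\<^sub>R v)) (at q)"
      by (auto intro!: derivative_eq_intros)
    have m1: "x + r *\<^sub>R u + q *\<^sub>R v \<in> U" using mem[of r q] that r by auto
    have "linear (frechet_derivative g (at (x + r *\<^sub>R u + q *\<^sub>R v)))"
      using gd[OF m1] has_derivative_linear by blast
    with has_derivative_compose[OF 1 gd[OF m1]] show ?thesis
      unfolding has_field_derivative_def
      by (elim has_derivative_eq_rhs) (simp add: fun_eq_iff linear_cmul mult.commute)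
  qed
  obtain q where q: "0 < q" "q < h"
    "g (x + r *\<^sub>R u + h *\<^sub>R v) - g (x + r *\<^sub>R u + 0 *\<^sub>R v)
      = (h - 0) * frechet_derivative g (at (x + r *\<^sub>R u + q *\<^sub>R v)) v"
    using MVT2[OF h, of "\<lambda>q. g (x + r *\<^sub>R u + q *\<^sub>R v)"
      "\<lambda>q. frechet_derivative g (at (x + r *\<^sub>R u + q *\<^sub>R v)) v"] qd by auto
  have "p h - p 0 = h\<^sup>2 * frechet_derivative g (at (x + r *\<^sub>R u + q *\<^sub>R v)) v"
    using r(3) q(3) by (simp add: power2_eq_square)
  then show ?thesis using that[OF r(1,2) q(1,2)] unfolding p_def g_def by (simp add: algebra_simps)
qed

lemma Ck_on_Suc_Suc_has_derivative:
  assumes "open U" "Ck_on (Suc (Suc k)) U f" "x \<in> U"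
  shows "((\<lambda>y. frechet_derivative f (at y) v) has_derivative
           frechet_derivative (\<lambda>y. frechet_derivative f (at y) v) (at x)) (at x)"
proof -
  have "Ck_on (Suc k) U (\<lambda>y. frechet_derivative f (at y) v)"
    using Ck_on_frechet_derivative[OF assms(1,2) Ck_on_const[OF assms(1)]] .
  then show ?thesis using differentiable_on_open_has_derivative[OF assms(1) _ assms(3)] by auto
qed

lemma second_derivative_symmetric_real:
  fixes f :: "'a::euclidean_space \<Rightarrow> real"
  assumes U: "open U" "x \<in> U" and f: "Ck_on 2 U f"
  shows "frechet_derivative (\<lambda>y. frechet_derivative f (at y) u) (at x) v
       = frechet_derivative (\<lambda>y. frechet_derivative f (at y) v) (at x) u"
proof -
  define A where "A u v y = frechet_derivative (\<lambda>y. frechet_derivative f (at y) u) (at y) v" for u v y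
  have f2: "Ck_on (Suc (Suc 0)) U f" using f by (simp only: numeral_2_eq_2)
  have c1: "Ck_on (Suc 0) U (\<lambda>y. frechet_derivative f (at y) u)" for u
    using Ck_on_frechet_derivative[OF U(1) f2 Ck_on_const[OF U(1)]] .
  then have d1: "(\<lambda>y. frechet_derivative f (at y) u) differentiable_on U" for u by auto
  have cA: "continuous_on U (A u v)" for u v
    using Ck_on_frechet_derivative[OF U(1) c1 Ck_on_const[OF U(1)]] unfolding A_def by auto
  have "dist (A u v x) (A v u x) \<le> e" if "0 < e" for e
  proof -
    have "isCont (A u v) x" "isCont (A v u) x"
      using cA U continuous_on_eq_continuous_at by blast+
    then have "\<exists>d>0. \<forall>y. dist y x < d \<longrightarrow> dist (A u v y) (A u v x) < e/2"
      "\<exists>d>0. \<forall>y. dist y x < d \<longrightarrow> dist (A v u y) (A v u x) < e/2"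
      using \<open>0 < e\<close> half_gt_zero unfolding continuous_at_eps_delta by blast+
    then obtain d1' d2' where d: "0 < d1'" "0 < d2'"
      "\<And>y. dist y x < d1' \<Longrightarrow> dist (A u v y) (A u v x) < e/2"
      "\<And>y. dist y x < d2' \<Longrightarrow> dist (A v u y) (A v u x) < e/2"
      by blast
    obtain d3 where d3: "0 < d3" "ball x d3 \<subseteq> U" using U openE by blast
    define d where "d = min d1' (min d2' d3)"
    have dpos: "0 < d" using d d3 by (simp add: d_def)
    \<comment> \<open>Small enough for the parallelogram with sides \<open>h u\<close> and
      \<open>h v\<close> to stay within \<open>d\<close> of \<open>x\<close>; the summand 1 covers u
      = v = 0.\<close>
    define h where "h = d / (2 * (norm u + norm v + 1))"
    have den: "norm u + norm v + 1 > 0" by (smt (verit) norm_ge_zero)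
    have h: "0 < h" using dpos den by (simp add: h_def)
    have near: "dist (x + r *\<^sub>R u + q *\<^sub>R v) x < d" if "0 \<le> r" "r \<le> h" "0 \<le> q" "q \<le> h" for r q
    proof -
      have "norm (r *\<^sub>R u + q *\<^sub>R v) \<le> r * norm u + q * norm v"
        using that norm_triangle_ineq[of "r *\<^sub>R u" "q *\<^sub>R v"] by simp
      also have "\<dots> \<le> h * norm u + h * norm v"
        using that by (intro add_mono mult_right_mono) auto
      also have "\<dots> \<le> h * (norm u + norm v + 1)" using h by (simp add: algebra_simps)
      also have "\<dots> = d / 2" using den unfolding h_def by (auto simp: divide_simps)
      also have "\<dots> < d" using dpos by simp
      finally show ?thesis by (simp add: dist_norm add.assoc)
    qed
    have mem: "x + r *\<^sub>R u + q *\<^sub>R v \<in> U" if "0 \<le> r" "r \<le> h" "0 \<le> q" "q \<le> h" for r q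
      using near[OF that] d3(2) by (auto simp: d_def dist_commute subset_iff)
    have mem': "x + r *\<^sub>R v + q *\<^sub>R u \<in> U" if "0 \<le> r" "r \<le> h" "0 \<le> q" "q \<le> h" for r q
      using mem[OF that(3,4,1,2)] by (simp add: add_ac)
    obtain r q where rq: "0 < r" "r < h" "0 < q" "q < h"
      "f (x + h *\<^sub>R u + h *\<^sub>R v) - f (x + h *\<^sub>R u) - f (x + h *\<^sub>R v) + f x
        = h\<^sup>2 * A u v (x + r *\<^sub>R u + q *\<^sub>R v)"
      using second_difference_mean_value[OF U(1) f d1 h mem] unfolding A_def by blast
    obtain r' q' where rq': "0 < r'" "r' < h" "0 < q'" "q' < h"
      "f (x + h *\<^sub>R v + h *\<^sub>R u) - f (x + h *\<^sub>R v) - f (x + h *\<^sub>R u) + f x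
        = h\<^sup>2 * A v u (x + r' *\<^sub>R v + q' *\<^sub>R u)"
      using second_difference_mean_value[OF U(1) f d1 h mem'] unfolding A_def by blast
    \<comment> \<open>The second difference is symmetric in \<open>u\<close> and \<open>v\<close>,
      so its two mean value forms agree.\<close>
    have "h\<^sup>2 * A u v (x + r *\<^sub>R u + q *\<^sub>R v) = h\<^sup>2 * A v u (x + r' *\<^sub>R v + q' *\<^sub>R u)"
      using rq(5) rq'(5) arg_cong[OF add.commute[of "h *\<^sub>R u" "h *\<^sub>R v"], of "\<lambda>w. f (x + w)"]
      unfolding add.assoc[of x] by linarith
    then have eq: "A u v (x + r *\<^sub>R u + q *\<^sub>R v) = A v u (x + r' *\<^sub>R v + q' *\<^sub>R u)"
      using h by simp
    have "dist (A u v (x + r *\<^sub>R u + q *\<^sub>R v)) (A u v x) < e/2"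
      using d(3) near[of r q] rq by (auto simp: d_def)
    moreover have "dist (A v u (x + r' *\<^sub>R v + q' *\<^sub>R u)) (A v u x) < e/2"
      using d(4) near[of q' r'] rq' by (auto simp: d_def add_ac)
    ultimately show ?thesis
      using eq dist_triangle3[of "A u v x" "A v u x" "A u v (x + r *\<^sub>R u + q *\<^sub>R v)"] by simp
  qed
  then have "dist (A u v x) (A v u x) = 0"
    using field_le_epsilon[of "dist (A u v x) (A v u x)" 0] zero_le_dist[of "A u v x" "A v u x"] by simp
  then show ?thesis by (simp add: A_def)
qed

text \<open>The mean value theorem is scalar, so the vector-valued case is read off
  componentwise.\<close>

lemma second_derivative_symmetric:
  fixes f :: "'a::euclidean_space \<Rightarrow> 'b::euclidean_space"
  assumes U: "open U" "x \<in> U" and f: "Ck_on 2 U f"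
  shows "frechet_derivative (\<lambda>y. frechet_derivative f (at y) u) (at x) v
       = frechet_derivative (\<lambda>y. frechet_derivative f (at y) v) (at x) u"
proof (rule euclidean_eqI)
  fix b :: 'b assume "b \<in> Basis"
  have f2: "Ck_on (Suc (Suc 0)) U f" using f by (simp only: numeral_2_eq_2)
  have lin: "bounded_linear (\<lambda>z. z \<bullet> b)" by (rule bounded_linear_inner_left)
  define g where "g y = f y \<bullet> b" for y
  have g: "Ck_on 2 U g" unfolding g_def by (rule Ck_on_bounded_linear_compose[OF U(1) lin f])
  have e: "frechet_derivative g (at y) w = frechet_derivative f (at y) w \<bullet> b" if "y \<in> U" for y w
  proof -
    have "(f has_derivative frechet_derivative f (at y)) (at y)"
      by (rule differentiable_on_open_has_derivative[OF U(1) _ that]) (use f2 in auto)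
    from bounded_linear.has_derivative[OF lin this]
    have "(g has_derivative (\<lambda>w. frechet_derivative f (at y) w \<bullet> b)) (at y)" unfolding g_def .
    then show ?thesis using frechet_derivative_at by metis
  qed
  have "frechet_derivative (\<lambda>y. frechet_derivative g (at y) u) (at x) v
      = frechet_derivative (\<lambda>y. frechet_derivative f (at y) u) (at x) v \<bullet> b" for u v
  proof -
    from bounded_linear.has_derivative[OF lin Ck_on_Suc_Suc_has_derivative[OF U(1) f2 U(2), of u]]
    have "((\<lambda>y. frechet_derivative g (at y) u) has_derivative
       (\<lambda>v. frechet_derivative (\<lambda>y. frechet_derivative f (at y) u) (at x) v \<bullet> b)) (at x)"
      by (rule has_derivative_transform_within_open[OF _ U]) (simp add: e)
    then show ?thesis using frechet_derivative_at by metis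
  qed
  then show "frechet_derivative (\<lambda>y. frechet_derivative f (at y) u) (at x) v \<bullet> b
     = frechet_derivative (\<lambda>y. frechet_derivative f (at y) v) (at x) u \<bullet> b"
    using second_derivative_symmetric_real[OF U g] by metis
qed

subsection \<open>Germs of smooth functions and Lie derivatives\<close>

text \<open>Lie derivatives, brackets and compositions each shrink the domain. Germs at 0 absorb
  this, and linear combinations are compared only near 0. One neighbourhood serves all orders of
  differentiability.\<close>

definition smooth_germ :: "('a::euclidean_space \<Rightarrow> 'b::real_normed_vector) \<Rightarrow> bool" where
  "smooth_germ f \<longleftrightarrow> (\<exists>V. open V \<and> 0 \<in> V \<and> smooth_on V f)"

definition lie_deriv :: "('a::euclidean_space \<Rightarrow> 'a) \<Rightarrow> ('a \<Rightarrow> 'b::real_normed_vector) \<Rightarrow> 'a \<Rightarrow> 'b" where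
  "lie_deriv Z f = (\<lambda>x. frechet_derivative f (at x) (Z x))"

text \<open>The bracket of \<open>lie_bracket\<close>, on any Euclidean space: it is needed on the
  product of time and space, where \<open>E\<close> and \<open>V\<close> live.\<close>

definition bracket_field :: "('a::euclidean_space \<Rightarrow> 'a) \<Rightarrow> ('a \<Rightarrow> 'a) \<Rightarrow> 'a \<Rightarrow> 'a" where
  "bracket_field A B = (\<lambda>x. lie_deriv A B x - lie_deriv B A x)"

lemma lie_bracket_eq_bracket_field: "lie_bracket A B = bracket_field A B"
  by (simp add: lie_bracket_def bracket_field_def lie_deriv_def)

lemma smooth_germI: "open V \<Longrightarrow> 0 \<in> V \<Longrightarrow> (\<And>k. Ck_on k V f) \<Longrightarrow> smooth_germ f"
  unfolding smooth_germ_def smooth_on_def by blast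

lemma smooth_germD: "smooth_germ f \<Longrightarrow> \<exists>V. open V \<and> 0 \<in> V \<and> (\<forall>k. Ck_on k V f)"
  unfolding smooth_germ_def smooth_on_def by blast

lemma smooth_germE2:
  assumes "smooth_germ f" "smooth_germ g"
  obtains V where "open V" "0 \<in> V" "\<And>k. Ck_on k V f" "\<And>k. Ck_on k V g"
proof -
  obtain V where V: "open V" "0 \<in> V" "\<And>k. Ck_on k V f" using smooth_germD[OF assms(1)] by blast
  obtain W where W: "open W" "0 \<in> W" "\<And>k. Ck_on k W g" using smooth_germD[OF assms(2)] by blast
  from V W show ?thesis using that[of "V \<inter> W"] Ck_on_subset[of _ V f "V \<inter> W"] Ck_on_subset[of _ W g "V \<inter> W"]
    by (simp add: open_Int)
qed

lemma smooth_germ_cong: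
  assumes "smooth_germ f" "\<forall>\<^sub>F x in nhds 0. f x = g x"
  shows "smooth_germ g"
proof -
  obtain V where V: "open V" "0 \<in> V" "\<And>k. Ck_on k V f" using smooth_germD[OF assms(1)] by blast
  obtain S where S: "open S" "0 \<in> S" "\<And>x. x \<in> S \<Longrightarrow> f x = g x"
    using assms(2) unfolding eventually_nhds by blast
  have "Ck_on k (V \<inter> S) g" for k
    by (rule Ck_on_cong[of _ f]) (use V S Ck_on_subset[of k V f "V \<inter> S"] in auto)
  then show ?thesis using smooth_germI[of "V \<inter> S" g] V S by auto
qed

lemma smooth_germ_const: "smooth_germ (\<lambda>x. c)"
  using smooth_germI[of UNIV] Ck_on_const by blast

lemma smooth_germ_bounded_linear: "bounded_linear h \<Longrightarrow> smooth_germ h"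
  using smooth_germI[of UNIV] Ck_on_bounded_linear by blast

lemma smooth_germ_bounded_linear_compose:
  assumes "bounded_linear h" "smooth_germ f"
  shows "smooth_germ (\<lambda>x. h (f x))"
  by (rule exE[OF smooth_germD[OF assms(2)]], rule smooth_germI) (auto intro: Ck_on_bounded_linear_compose assms(1))

lemma smooth_germ_add:
  assumes "smooth_germ f" "smooth_germ g"
  shows "smooth_germ (\<lambda>x. f x + g x)"
  by (rule smooth_germE2[OF assms], rule smooth_germI) (auto intro: Ck_on_add)

lemma smooth_germ_scaleR:
  assumes "smooth_germ f" "smooth_germ g"
  shows "smooth_germ (\<lambda>x. f x *\<^sub>R g x)"
  by (rule smooth_germE2[OF assms], rule smooth_germI) (auto intro: Ck_on_scaleR)

lemma smooth_germ_cscaleR: "smooth_germ f \<Longrightarrow> smooth_germ (\<lambda>x. c *\<^sub>R f x)"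
  using smooth_germ_scaleR[OF smooth_germ_const] .

lemma smooth_germ_diff:
  assumes "smooth_germ f" "smooth_germ g"
  shows "smooth_germ (\<lambda>x. f x - g x)"
  using smooth_germ_add[OF assms(1) smooth_germ_cscaleR[OF assms(2), of "-1"]] by simp

lemma smooth_germ_sum:
  assumes "\<And>i. i \<in> I \<Longrightarrow> smooth_germ (f i)"
  shows "smooth_germ (\<lambda>x. \<Sum>i\<in>I. f i x)"
  using assms
  by (induction I rule: infinite_finite_induct) (auto intro: smooth_germ_add smooth_germ_const)

lemma smooth_germ_lie_deriv:
  assumes "smooth_germ Z" "smooth_germ f"
  shows "smooth_germ (lie_deriv Z f)"
  unfolding lie_deriv_def
  by (rule smooth_germE2[OF assms], rule smooth_germI) (auto intro: Ck_on_frechet_derivative)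

lemma smooth_germ_lie_deriv_funpow:
  assumes "smooth_germ Z" "smooth_germ f"
  shows "smooth_germ ((lie_deriv Z ^^ k) f)"
  by (induction k) (auto intro: smooth_germ_lie_deriv assms)

lemma smooth_germ_bracket_field:
  assumes "smooth_germ A" "smooth_germ B"
  shows "smooth_germ (bracket_field A B)"
  unfolding bracket_field_def by (intro smooth_germ_diff smooth_germ_lie_deriv assms)

lemma smooth_germ_continuous:
  assumes "smooth_germ f"
  shows "\<forall>\<^sub>F x in nhds 0. isCont f x"
proof -
  obtain V where V: "open V" "0 \<in> V" "\<And>k. Ck_on k V f" using smooth_germD[OF assms(1)] by blast
  have "continuous_on V f" using V(3)[of 0] by simp
  then show ?thesis using V continuous_on_eq_continuous_at unfolding eventually_nhds by blast
qed

lemma smooth_germ_has_derivative: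
  assumes "smooth_germ f"
  shows "\<forall>\<^sub>F x in nhds 0. (f has_derivative frechet_derivative f (at x)) (at x)"
proof -
  obtain V where V: "open V" "0 \<in> V" "\<And>k. Ck_on k V f" using smooth_germD[OF assms(1)] by blast
  have "f differentiable_on V" using V(3)[of 1] by simp
  then show ?thesis using V differentiable_on_open_has_derivative unfolding eventually_nhds by blast
qed

lemma smooth_germ_compose:
  fixes f :: "'a::euclidean_space \<Rightarrow> 'b::euclidean_space" and g :: "'b \<Rightarrow> 'c::real_normed_vector"
  assumes "smooth_germ f" "f 0 = 0" "smooth_germ g"
  shows "smooth_germ (\<lambda>x. g (f x))"
proof -
  obtain V where V: "open V" "0 \<in> V" "\<And>k. Ck_on k V f" using smooth_germD[OF assms(1)] by blast
  obtain W where W: "open W" "0 \<in> W" "\<And>k. Ck_on k W g" using smooth_germD[OF assms(3)] by blast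
  define S where "S = V \<inter> f -` W"
  have "continuous_on V f" using V(3)[of 0] by simp
  then have S: "open S" unfolding S_def using V W continuous_open_preimage by blast
  have "Ck_on k S (\<lambda>x. g (f x))" for k
    by (rule Ck_on_compose[OF S W(1) _ Ck_on_subset[OF V(3)] W(3)]) (auto simp: S_def)
  then show ?thesis using smooth_germI[OF S] V W assms(2) by (auto simp: S_def)
qed

text \<open>Differentiability is not assumed: both sides are choices from one and the same
  predicate.\<close>

lemma frechet_derivative_cong_nhds:
  assumes "\<forall>\<^sub>F y in nhds x. f y = g y"
  shows "frechet_derivative f (at x) = frechet_derivative g (at x)"
proof -
  obtain S where S: "open S" "x \<in> S" "\<And>y. y \<in> S \<Longrightarrow> f y = g y"
    using assms unfolding eventually_nhds by blast
  have "(f has_derivative D) (at x) \<longleftrightarrow> (g has_derivative D) (at x)" for D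
    using has_derivative_transform_within_open[OF _ S(1,2), of f D UNIV g]
      has_derivative_transform_within_open[OF _ S(1,2), of g D UNIV f] S(3) by auto
  then show ?thesis unfolding frechet_derivative_def by simp
qed

lemma lie_deriv_cong:
  assumes "\<forall>\<^sub>F x in nhds 0. f x = g x" "\<forall>\<^sub>F x in nhds 0. Y x = Z x"
  shows "\<forall>\<^sub>F x in nhds 0. lie_deriv Y f x = lie_deriv Z g x"
proof -
  \<comment> \<open>A derivative at \<open>x\<close> depends on a neighbourhood of \<open>x\<close>,
    so equality near 0 is restated as equality near every nearby point.\<close>
  have "\<forall>\<^sub>F x in nhds 0. \<forall>\<^sub>F y in nhds x. f y = g y"
    using assms(1) by (simp add: eventually_eventually)
  then show ?thesis using assms(2)
    by eventually_elim (simp add: lie_deriv_def frechet_derivative_cong_nhds)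
qed

lemma bracket_field_cong:
  assumes "\<forall>\<^sub>F x in nhds 0. A x = A' x" "\<forall>\<^sub>F x in nhds 0. B x = B' x"
  shows "\<forall>\<^sub>F x in nhds 0. bracket_field A B x = bracket_field A' B' x"
  using lie_deriv_cong[OF assms] lie_deriv_cong[OF assms(2,1)]
  by eventually_elim (simp add: bracket_field_def)

lemma lie_deriv_funpow_cong:
  assumes "\<forall>\<^sub>F x in nhds 0. f x = g x"
  shows "\<forall>\<^sub>F x in nhds 0. (lie_deriv Z ^^ k) f x = (lie_deriv Z ^^ k) g x"
  by (induction k) (auto intro: lie_deriv_cong assms)

lemma lie_deriv_sum:
  assumes "finite I" "\<And>i. i \<in> I \<Longrightarrow> smooth_germ (f i)"
  shows "\<forall>\<^sub>F x in nhds 0. lie_deriv Z (\<lambda>x. \<Sum>i\<in>I. c i *\<^sub>R f i x) x = (\<Sum>i\<in>I. c i *\<^sub>R lie_deriv Z (f i) x)"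
proof -
  have "\<forall>\<^sub>F x in nhds 0. \<forall>i\<in>I. (f i has_derivative frechet_derivative (f i) (at x)) (at x)"
    using assms by (simp add: eventually_ball_finite smooth_germ_has_derivative)
  then show ?thesis
  proof eventually_elim
    case (elim x)
    then have "((\<lambda>x. \<Sum>i\<in>I. c i *\<^sub>R f i x) has_derivative
        (\<lambda>v. \<Sum>i\<in>I. c i *\<^sub>R frechet_derivative (f i) (at x) v)) (at x)"
      by (intro has_derivative_sum has_derivative_scaleR_right) auto
    from frechet_derivative_at[OF this, symmetric] show ?case unfolding lie_deriv_def by simp
  qed
qed

lemma lie_deriv_funpow_sum:
  assumes "finite I" "\<And>i. i \<in> I \<Longrightarrow> smooth_germ (f i)" "smooth_germ Z"
  shows "\<forall>\<^sub>F x in nhds 0. (lie_deriv Z ^^ k) (\<lambda>x. \<Sum>i\<in>I. c i *\<^sub>R f i x) x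
           = (\<Sum>i\<in>I. c i *\<^sub>R (lie_deriv Z ^^ k) (f i) x)"
proof (induction k)
  case (Suc k)
  have "\<forall>\<^sub>F x in nhds 0. lie_deriv Z (\<lambda>x. \<Sum>i\<in>I. c i *\<^sub>R (lie_deriv Z ^^ k) (f i) x) x
      = (\<Sum>i\<in>I. c i *\<^sub>R lie_deriv Z ((lie_deriv Z ^^ k) (f i)) x)"
    by (rule lie_deriv_sum) (use smooth_germ_lie_deriv_funpow assms in auto)
  with lie_deriv_cong[OF Suc.IH, of Z Z] show ?case
    by (auto elim: eventually_elim2)
qed simp

text \<open>Linearity of the derivative of \<open>f\<close> at a point is all that is used, so one
  neighbourhood serves all families of fields.\<close>

lemma lie_deriv_field_sum:
  assumes "smooth_germ f"
  shows "\<forall>\<^sub>F x in nhds 0. \<forall>I c Z. lie_deriv (\<lambda>x. \<Sum>i\<in>I. c i *\<^sub>R Z i x) f x = (\<Sum>i\<in>I. c i *\<^sub>R lie_deriv (Z i) f x)"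
  using smooth_germ_has_derivative[OF assms]
proof eventually_elim
  case (elim x)
  then have "linear (frechet_derivative f (at x))" using has_derivative_linear by blast
  then show ?case unfolding lie_deriv_def by (simp add: linear_sum linear_cmul)
qed

lemma bracket_field_sum:
  assumes "finite I" "\<And>i. i \<in> I \<Longrightarrow> smooth_germ (A i)" "finite J" "\<And>j. j \<in> J \<Longrightarrow> smooth_germ (B j)"
  shows "\<forall>\<^sub>F x in nhds 0. bracket_field (\<lambda>x. \<Sum>i\<in>I. c i *\<^sub>R A i x) (\<lambda>x. \<Sum>j\<in>J. d j *\<^sub>R B j x) x
           = (\<Sum>i\<in>I. \<Sum>j\<in>J. (c i * d j) *\<^sub>R bracket_field (A i) (B j) x)"
proof -
  have 1: "\<forall>\<^sub>F x in nhds 0. \<forall>j\<in>J. lie_deriv (\<lambda>x. \<Sum>i\<in>I. c i *\<^sub>R A i x) (B j) x = (\<Sum>i\<in>I. c i *\<^sub>R lie_deriv (A i) (B j) x)"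
    by (intro eventually_ball_finite ballI assms) (rule eventually_mono[OF lie_deriv_field_sum], use assms in auto)
  have 2: "\<forall>\<^sub>F x in nhds 0. \<forall>i\<in>I. lie_deriv (\<lambda>x. \<Sum>j\<in>J. d j *\<^sub>R B j x) (A i) x = (\<Sum>j\<in>J. d j *\<^sub>R lie_deriv (B j) (A i) x)"
    by (intro eventually_ball_finite ballI assms) (rule eventually_mono[OF lie_deriv_field_sum], use assms in auto)
  show ?thesis
    using 1 2
      lie_deriv_sum[where f = B and Z = "\<lambda>x. \<Sum>i\<in>I. c i *\<^sub>R A i x" and c = d, OF assms(3,4), simplified]
      lie_deriv_sum[where f = A and Z = "\<lambda>x. \<Sum>j\<in>J. d j *\<^sub>R B j x" and c = c, OF assms(1,2), simplified]
  proof eventually_elim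
    case (elim x)
    have "(\<Sum>j\<in>J. d j *\<^sub>R (\<Sum>i\<in>I. c i *\<^sub>R lie_deriv (A i) (B j) x))
        = (\<Sum>i\<in>I. \<Sum>j\<in>J. (c i * d j) *\<^sub>R lie_deriv (A i) (B j) x)"
      by (subst sum.swap) (simp add: scaleR_sum_right mult.commute)
    with elim show ?case
      by (simp add: bracket_field_def scaleR_sum_right scaleR_diff_right sum_subtractf)
  qed
qed

text \<open>Applying two fields in succession gives the derivative of \<open>f\<close> along one
  first-order field plus the second derivative at the two vectors. The latter is symmetric and
  cancels in the commutator.\<close>

lemma lie_deriv_bracket_field:
  fixes f :: "'a::euclidean_space \<Rightarrow> 'b::euclidean_space"
  assumes "smooth_germ A" "smooth_germ B" "smooth_germ f"
  shows "\<forall>\<^sub>F x in nhds 0. lie_deriv (bracket_field A B) f x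
           = lie_deriv A (lie_deriv B f) x - lie_deriv B (lie_deriv A f) x"
proof -
  obtain V where V: "open V" "0 \<in> V" "\<And>k. Ck_on k V f" using smooth_germD[OF assms(3)] by blast
  define H where "H x v w = frechet_derivative (\<lambda>y. frechet_derivative f (at y) v) (at x) w" for x v w
  have f2: "Ck_on (Suc (Suc 0)) V f" using V(3) .
  have lin: "linear (frechet_derivative f (at x))" if "x \<in> V" for x
    using differentiable_on_open_has_derivative[OF V(1) _ that, of f] V(3)[of 1] has_derivative_linear by auto
  have Hlin2: "linear (H x v)" if "x \<in> V" for x v
    unfolding H_def by (rule has_derivative_linear[OF Ck_on_Suc_Suc_has_derivative[OF V(1) f2 that]])
  have Hsym: "H x v w = H x w v" if "x \<in> V" for x v w
    using second_derivative_symmetric[OF V(1) that V(3)] unfolding H_def .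
  have key: "lie_deriv C (lie_deriv B f) x
      = frechet_derivative f (at x) (lie_deriv C B x) + H x (B x) (C x)"
    if x: "x \<in> V" and B: "(B has_derivative frechet_derivative B (at x)) (at x)" for B C x
  proof -
    \<comment> \<open>The basis expansion separates the two ways in which the derivative of
      \<open>f\<close> along \<open>B y\<close> depends on \<open>y\<close>, so that the product
      rule applies.\<close>
    have "((\<lambda>y. \<Sum>b\<in>Basis. (B y \<bullet> b) *\<^sub>R frechet_derivative f (at y) b) has_derivative
       (\<lambda>w. \<Sum>b\<in>Basis. (B x \<bullet> b) *\<^sub>R H x b w + (frechet_derivative B (at x) w \<bullet> b) *\<^sub>R frechet_derivative f (at x) b)) (at x)"
      unfolding H_def
      by (intro has_derivative_sum has_derivative_scaleR has_derivative_inner_left B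
            Ck_on_Suc_Suc_has_derivative[OF V(1) f2 x])
    then have "((\<lambda>y. frechet_derivative f (at y) (B y)) has_derivative
       (\<lambda>w. \<Sum>b\<in>Basis. (B x \<bullet> b) *\<^sub>R H x b w + (frechet_derivative B (at x) w \<bullet> b) *\<^sub>R frechet_derivative f (at x) b)) (at x)"
      by (rule has_derivative_transform_within_open[OF _ V(1) x])
         (rule linear_euclidean_expansion[OF lin, symmetric])
    note e = frechet_derivative_at[OF this]
    have "lie_deriv C (lie_deriv B f) x = frechet_derivative (\<lambda>y. frechet_derivative f (at y) (B y)) (at x) (C x)"
      by (simp add: lie_deriv_def)
    also have "\<dots> = (\<Sum>b\<in>Basis. (B x \<bullet> b) *\<^sub>R H x b (C x)
         + (lie_deriv C B x \<bullet> b) *\<^sub>R frechet_derivative f (at x) b)"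
      unfolding e[symmetric] by (simp add: lie_deriv_def)
    also have "\<dots> = (\<Sum>b\<in>Basis. (B x \<bullet> b) *\<^sub>R H x (C x) b)
         + (\<Sum>b\<in>Basis. (lie_deriv C B x \<bullet> b) *\<^sub>R frechet_derivative f (at x) b)"
      by (simp add: sum.distrib Hsym[OF x])
    also have "\<dots> = H x (C x) (B x) + frechet_derivative f (at x) (lie_deriv C B x)"
      by (simp only: linear_euclidean_expansion[OF Hlin2[OF x], of "C x" "B x"]
            linear_euclidean_expansion[OF lin[OF x], of "lie_deriv C B x"])
    finally show ?thesis using Hsym[OF x] by simp
  qed
  have "\<forall>\<^sub>F x in nhds 0. x \<in> V" using V eventually_nhds_in_open by blast
  then show ?thesis
    using smooth_germ_has_derivative[OF assms(1)] smooth_germ_has_derivative[OF assms(2)]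
  proof eventually_elim
    case (elim x)
    have "lie_deriv (bracket_field A B) f x
      = frechet_derivative f (at x) (lie_deriv A B x) - frechet_derivative f (at x) (lie_deriv B A x)"
      using linear_diff[OF lin[OF elim(1)]] by (simp add: lie_deriv_def bracket_field_def)
    then show ?case using key[OF elim(1,2), of B] key[OF elim(1,3), of A] Hsym[OF elim(1)]
      by simp
  qed
qed

subsection \<open>Flatness in time\<close>

lemma eventually_nhds_0_prodD:
  fixes P :: "real \<times> 'a::real_normed_vector \<Rightarrow> bool"
  assumes "\<forall>\<^sub>F p in nhds 0. P p"
  obtains r where "0 < r" "\<And>s y. \<bar>s\<bar> < r \<Longrightarrow> norm y < r \<Longrightarrow> P (s, y)"
proof -
  obtain d where d: "0 < d" "\<And>p. dist p 0 < d \<Longrightarrow> P p"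
    using assms unfolding eventually_nhds_metric by blast
  have "P (s, y)" if "\<bar>s\<bar> < d/2" "norm y < d/2" for s y
    using d(2)[of "(s,y)"] norm_Pair_le[of s y] that by (simp add: dist_norm zero_prod_def)
  then show ?thesis using that[of "d/2"] d(1) by auto
qed

lemma eventually_nhds_0_prodI:
  fixes P :: "real \<times> 'a::real_normed_vector \<Rightarrow> bool"
  assumes "0 < r" "\<And>s y. \<bar>s\<bar> < r \<Longrightarrow> norm y < r \<Longrightarrow> P (s, y)"
  shows "\<forall>\<^sub>F p in nhds 0. P p"
  unfolding eventually_nhds_metric
proof (intro exI conjI allI impI)
  fix p :: "real \<times> 'a" assume "dist p 0 < r"
  then have "norm (fst p) < r" "norm (snd p) < r"
    using norm_fst_le[of "fst p" "snd p"] norm_snd_le[of "snd p" "fst p"] by (auto simp: dist_norm)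
  then show "P p" using assms(2)[of "fst p" "snd p"] by simp
qed (rule assms(1))

lemma smooth_germ_bounded:
  assumes "smooth_germ f"
  obtains C where "0 < C" "\<forall>\<^sub>F x in nhds 0. norm (f x) \<le> C"
proof -
  have "isCont f 0" using smooth_germ_continuous[OF assms] by (rule eventually_nhds_x_imp_x)
  then have "(f \<longlongrightarrow> f 0) (nhds 0)" by (simp add: isCont_def tendsto_at_iff_tendsto_nhds)
  then have "\<forall>\<^sub>F x in nhds 0. dist (f x) (f 0) < 1" by (simp add: tendstoD)
  then have "\<forall>\<^sub>F x in nhds 0. norm (f x) \<le> norm (f 0) + 1"
    by eventually_elim (smt (verit) dist_norm norm_triangle_ineq2)
  moreover have "0 < norm (f 0) + 1" by (simp add: add_nonneg_pos)
  ultimately show ?thesis using that by blast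
qed

text \<open>The bound is required for nonnegative times only, so that one-sided Taylor expansion suffices.\<close>

definition flat :: "nat \<Rightarrow> (real \<times> 'a::euclidean_space \<Rightarrow> 'b::real_normed_vector) \<Rightarrow> bool" where
  "flat M f \<longleftrightarrow> (\<exists>C. \<forall>\<^sub>F p in nhds 0. 0 \<le> fst p \<longrightarrow> norm (f p) \<le> C * fst p ^ M)"

lemma flat_cong: "flat M f \<Longrightarrow> \<forall>\<^sub>F p in nhds 0. f p = g p \<Longrightarrow> flat M g"
  unfolding flat_def by (elim exE, rule exI) (auto elim: eventually_elim2)

lemma flat_add:
  assumes "flat M f" "flat M g"
  shows "flat M (\<lambda>p. f p + g p)"
proof -
  obtain C D where "\<forall>\<^sub>F p in nhds 0. 0 \<le> fst p \<longrightarrow> norm (f p) \<le> C * fst p ^ M"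
    "\<forall>\<^sub>F p in nhds 0. 0 \<le> fst p \<longrightarrow> norm (g p) \<le> D * fst p ^ M"
    using assms unfolding flat_def by blast
  then have "\<forall>\<^sub>F p in nhds 0. 0 \<le> fst p \<longrightarrow> norm (f p + g p) \<le> (C + D) * fst p ^ M"
    by eventually_elim (auto simp: distrib_right intro: norm_triangle_le add_mono)
  then show ?thesis unfolding flat_def by blast
qed

lemma flat_cscaleR:
  assumes "flat M f"
  shows "flat M (\<lambda>p. c *\<^sub>R f p)"
proof -
  obtain C where "\<forall>\<^sub>F p in nhds 0. 0 \<le> fst p \<longrightarrow> norm (f p) \<le> C * fst p ^ M"
    using assms unfolding flat_def by blast
  then have "\<forall>\<^sub>F p in nhds 0. 0 \<le> fst p \<longrightarrow> norm (c *\<^sub>R f p) \<le> (\<bar>c\<bar> * C) * fst p ^ M"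
    by eventually_elim (auto simp: mult.assoc intro: mult_left_mono)
  then show ?thesis unfolding flat_def by blast
qed

lemma flat_zero: "flat M (\<lambda>p. 0)"
  unfolding flat_def by (intro exI[of _ 0]) simp

lemma flat_sum:
  assumes "\<And>i. i \<in> I \<Longrightarrow> flat M (f i)"
  shows "flat M (\<lambda>p. \<Sum>i\<in>I. f i p)"
  using assms
  by (induction I rule: infinite_finite_induct) (auto intro: flat_add flat_zero)

text \<open>Stronger than \<open>flat\<close>: the quotient is smooth, so the order in time can be
  followed through differentiation. It serves the remainders that are explicit words in
  \<open>V\<close> and \<open>E\<close>.\<close>

definition time_divisible :: "nat \<Rightarrow> (real \<times> 'a::euclidean_space \<Rightarrow> 'b::real_normed_vector) \<Rightarrow> bool" where
  "time_divisible k f \<longleftrightarrow> (\<exists>h. smooth_germ h \<and> (\<forall>\<^sub>F p in nhds 0. f p = fst p ^ k *\<^sub>R h p))"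

lemma time_divisible_0: "smooth_germ f \<Longrightarrow> time_divisible 0 f"
  unfolding time_divisible_def by auto

lemma time_divisible_imp_flat:
  assumes "time_divisible k f" "M \<le> k"
  shows "flat M f"
proof -
  obtain h where h: "smooth_germ h" "\<forall>\<^sub>F p in nhds 0. f p = fst p ^ k *\<^sub>R h p"
    using assms unfolding time_divisible_def by blast
  obtain C where C: "0 < C" "\<forall>\<^sub>F p in nhds 0. norm (h p) \<le> C" using smooth_germ_bounded[OF h(1)] .
  have "\<forall>\<^sub>F p in nhds (0::real\<times>'a). \<bar>fst p\<bar> < 1"
    by (rule eventually_nhds_0_prodI[of 1]) auto
  with h(2) C(2) have "\<forall>\<^sub>F p in nhds 0. 0 \<le> fst p \<longrightarrow> norm (f p) \<le> C * fst p ^ M"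
  proof eventually_elim
    case (elim p)
    show ?case
    proof
      assume "0 \<le> fst p"
      then have "norm (f p) = fst p ^ k * norm (h p)" using elim by simp
      also have "\<dots> \<le> fst p ^ M * C"
        using elim \<open>0 \<le> fst p\<close> assms(2) by (intro mult_mono power_decreasing) auto
      finally show "norm (f p) \<le> C * fst p ^ M" by (simp add: mult.commute)
    qed
  qed
  then show ?thesis unfolding flat_def by blast
qed

lemma lie_deriv_time_power:
  fixes h :: "real \<times> 'a::euclidean_space \<Rightarrow> 'b::real_normed_vector"
  assumes "smooth_germ h"
  shows "\<forall>\<^sub>F p in nhds 0. \<forall>Z. lie_deriv Z (\<lambda>p. fst p ^ k *\<^sub>R h p) p
     = fst p ^ k *\<^sub>R lie_deriv Z h p + (of_nat k * fst p ^ (k - 1) * fst (Z p)) *\<^sub>R h p"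
  using smooth_germ_has_derivative[OF assms]
proof eventually_elim
  case (elim p)
  have "((\<lambda>p. fst p ^ k) has_derivative (\<lambda>w. of_nat k * fst w * fst p ^ (k - 1))) (at p)"
    by (rule has_derivative_power[OF has_derivative_fst[OF has_derivative_ident]])
  from frechet_derivative_at[OF has_derivative_scaleR[OF this elim], symmetric]
  show ?case unfolding lie_deriv_def by (simp add: mult_ac)
qed

text \<open>The power s^k is constant along the vertical \<open>u\<close>, and the factor s of the
  field raises the order by one.\<close>

lemma time_divisible_lie_deriv_vertical:
  assumes "time_divisible k f" "smooth_germ u" "\<And>p. fst (u p) = 0"
  shows "time_divisible (Suc k) (lie_deriv (\<lambda>p. fst p *\<^sub>R u p) f)"
proof -
  obtain h where h: "smooth_germ h" "\<forall>\<^sub>F p in nhds 0. f p = fst p ^ k *\<^sub>R h p"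
    using assms unfolding time_divisible_def by blast
  have "\<forall>\<^sub>F p in nhds 0. lie_deriv (\<lambda>p. fst p *\<^sub>R u p) f p = fst p ^ Suc k *\<^sub>R lie_deriv u h p"
    using lie_deriv_cong[OF h(2), of "\<lambda>p. fst p *\<^sub>R u p" "\<lambda>p. fst p *\<^sub>R u p", simplified]
      lie_deriv_time_power[OF h(1), of k] smooth_germ_has_derivative[OF h(1)]
  proof eventually_elim
    case (elim p)
    have "linear (frechet_derivative h (at p))" using elim(3) has_derivative_linear by blast
    with elim(1) elim(2)[rule_format, of "\<lambda>p. fst p *\<^sub>R u p"] assms(3) show ?case
      by (simp add: lie_deriv_def linear_cmul mult.commute)
  qed
  then show ?thesis unfolding time_divisible_def
    using smooth_germ_lie_deriv[OF assms(2) h(1)] by blast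
qed

lemma smooth_germ_euler: "smooth_germ (\<lambda>p::real \<times> 'a::euclidean_space. (fst p, 0::'b::euclidean_space))"
  by (intro smooth_germ_bounded_linear bounded_linear_Pair bounded_linear_fst bounded_linear_zero)

text \<open>The field s d/ds maps s^k to k s^k: the power lost by differentiation is
  restored.\<close>

lemma time_divisible_lie_deriv_euler:
  assumes "time_divisible k f"
  shows "time_divisible k (lie_deriv (\<lambda>p. (fst p, 0)) f)"
proof -
  obtain h where h: "smooth_germ h" "\<forall>\<^sub>F p in nhds 0. f p = fst p ^ k *\<^sub>R h p"
    using assms unfolding time_divisible_def by blast
  have "\<forall>\<^sub>F p in nhds 0. lie_deriv (\<lambda>p. (fst p, 0)) f p
      = fst p ^ k *\<^sub>R (lie_deriv (\<lambda>p. (fst p, 0)) h p + of_nat k *\<^sub>R h p)"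
    using lie_deriv_cong[OF h(2), of "\<lambda>p. (fst p, 0)" "\<lambda>p. (fst p, 0)", simplified]
      lie_deriv_time_power[OF h(1), of k]
  proof eventually_elim
    case (elim p)
    have "of_nat k * fst p ^ (k - 1) * fst p = fst p ^ k * of_nat k" by (cases k) auto
    with elim(1) elim(2)[rule_format, of "\<lambda>p. (fst p, 0)"] show ?case
      by (simp add: scaleR_add_right)
  qed
  moreover have "smooth_germ (\<lambda>p. lie_deriv (\<lambda>p. (fst p, 0)) h p + of_nat k *\<^sub>R h p)"
    by (intro smooth_germ_add smooth_germ_lie_deriv smooth_germ_cscaleR h(1) smooth_germ_euler)
  ultimately show ?thesis unfolding time_divisible_def by blast
qed

section \<open>Taylor expansion in time, solving for the starting point, and confinement of
  curves\<close>

lemma taylor_remainder_bound: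
  fixes Df :: "nat \<Rightarrow> real \<Rightarrow> 'b::banach"
  assumes "a \<le> b"
    and D: "\<And>j t. j < p \<Longrightarrow> a \<le> t \<Longrightarrow> t \<le> b \<Longrightarrow> (Df j has_vector_derivative Df (Suc j) t) (at t within {a..b})"
    and B: "\<And>t. a \<le> t \<Longrightarrow> t \<le> b \<Longrightarrow> norm (Df p t) \<le> B"
  shows "norm (Df 0 b - (\<Sum>j<p. ((b - a) ^ j / fact j) *\<^sub>R Df j a)) \<le> B * (b - a) ^ p"
proof (cases "p = 0")
  case True then show ?thesis using B[of b] assms(1) by simp
next
  case False
  have "0 \<le> B" using B[of a] assms(1) norm_ge_zero order_trans by blast
  have "norm (Df 0 b - (\<Sum>j<p. ((b - a) ^ j / fact j) *\<^sub>R Df j a)) \<le> (B * (b - a) ^ (p - 1)) * measure lborel {a..b}"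
  proof (rule has_integral_bound_real[OF _ finite.emptyI Taylor_has_integral])
    show "0 \<le> B * (b - a) ^ (p - 1)" using \<open>0 \<le> B\<close> assms(1) by simp
    show "norm (((b - t) ^ (p - 1) / fact (p - 1)) *\<^sub>R Df p t) \<le> B * (b - a) ^ (p - 1)"
      if "t \<in> {a..b} - {}" for t
    proof -
      \<comment> \<open>The factorial of the integral remainder is dropped; only the exponent of
        \<open>b - a\<close> matters below.\<close>
      have "(b - t) ^ (p - 1) / fact (p - 1) \<le> (b - t) ^ (p - 1)"
        using that fact_ge_1[of "p - 1", where 'a=real] by (simp add: divide_le_eq mult_le_cancel_left1)
      also have "\<dots> \<le> (b - a) ^ (p - 1)" using that by (intro power_mono) auto
      finally have "(b - t) ^ (p - 1) / fact (p - 1) * norm (Df p t) \<le> (b - a) ^ (p - 1) * B"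
        using that B[of t] by (intro mult_mono) auto
      then show ?thesis using that by (simp add: mult.commute[of B])
    qed
  qed (use False assms in auto)
  also have "\<dots> = B * ((b - a) ^ (p - 1) * (b - a))" using assms(1) by simp
  also have "(b - a) ^ (p - 1) * (b - a) = (b - a) ^ p" using False by (metis power_minus_mult neq0_conv)
  finally show ?thesis .
qed

text \<open>Letting s tend to 0 kills the constant term; dividing by s > 0 then lowers both the
  number of terms and the order of the bound.\<close>

lemma polynomial_coeffs_zero:
  fixes a :: "nat \<Rightarrow> 'b::real_normed_vector"
  assumes "\<forall>\<^sub>F s in at_right 0. norm (\<Sum>j<M. s ^ j *\<^sub>R a j) \<le> C * s ^ M" "j < M"
  shows "a j = 0"
  using assms
proof (induction M arbitrary: a j)
  case (Suc m)
  have lim: "((\<lambda>s. \<Sum>j<Suc m. s ^ j *\<^sub>R a j) \<longlongrightarrow> (\<Sum>j<Suc m. 0 ^ j *\<^sub>R a j)) (at_right 0)"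
    by (intro tendsto_intros)
  have "((\<lambda>s. C * s ^ Suc m) \<longlongrightarrow> C * 0 ^ Suc m) (at_right (0::real))"
    by (intro tendsto_intros)
  then have "((\<lambda>s. \<Sum>j<Suc m. s ^ j *\<^sub>R a j) \<longlongrightarrow> 0) (at_right 0)"
    using Lim_null_comparison[OF Suc.prems(1)] by simp
  with lim have "(\<Sum>j<Suc m. 0 ^ j *\<^sub>R a j) = 0"
    using tendsto_unique trivial_limit_at_right_real by blast
  then have a0: "a 0 = 0" unfolding sum.lessThan_Suc_shift by simp
  have "\<forall>\<^sub>F s in at_right (0::real). 0 < s" by (simp add: eventually_at_right_less)
  with Suc.prems(1) have "\<forall>\<^sub>F s in at_right 0. norm (\<Sum>j<m. s ^ j *\<^sub>R a (Suc j)) \<le> C * s ^ m"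
  proof eventually_elim
    case (elim s)
    have "(\<Sum>j<Suc m. s ^ j *\<^sub>R a j) = s *\<^sub>R (\<Sum>j<m. s ^ j *\<^sub>R a (Suc j))"
      unfolding sum.lessThan_Suc_shift using a0 by (simp add: scaleR_sum_right)
    with elim have "s * norm (\<Sum>j<m. s ^ j *\<^sub>R a (Suc j)) \<le> s * (C * s ^ m)"
      by (simp add: mult_ac)
    then show ?case using elim(2) by simp
  qed
  from Suc.IH[OF this] Suc.prems(2) a0 show ?case by (cases j) auto
qed simp

lemma smooth_germ_unit_time: "smooth_germ (\<lambda>p::'a::euclidean_space. (1::real, 0::'b::euclidean_space))"
  by (rule smooth_germ_const)

lemma has_vector_derivative_compose_has_derivative:
  assumes "(c has_vector_derivative v) (at t within S)" "(f has_derivative f') (at (c t))"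
  shows "((\<lambda>t. f (c t)) has_vector_derivative f' v) (at t within S)"
  using vector_derivative_diff_chain_within[OF assms(1) has_derivative_at_withinI[OF assms(2)]]
  by (simp add: o_def)

text \<open>\<open>r\<close> and \<open>C\<close> serve all \<open>y\<close> at once, since the time
  derivative of order \<open>M\<close> is bounded near the origin.\<close>

lemma smooth_germ_taylor_time:
  fixes k :: "real \<times> 'a::euclidean_space \<Rightarrow> 'b::banach"
  assumes "smooth_germ k"
  obtains r C where "0 < r" "0 < C" "\<And>s y. 0 \<le> s \<Longrightarrow> s < r \<Longrightarrow> norm y < r \<Longrightarrow>
    norm (k (s, y) - (\<Sum>j<M. (s ^ j / fact j) *\<^sub>R (lie_deriv (\<lambda>p. (1, 0)) ^^ j) k (0, y))) \<le> C * s ^ M"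
proof -
  let ?k = "\<lambda>j. (lie_deriv (\<lambda>p. (1::real, 0::'a)) ^^ j) k"
  have sm: "smooth_germ (?k j)" for j
    by (rule smooth_germ_lie_deriv_funpow[OF smooth_germ_unit_time assms])
  obtain C where C: "0 < C" "\<forall>\<^sub>F p in nhds 0. norm (?k M p) \<le> C" using smooth_germ_bounded[OF sm] .
  have "\<forall>\<^sub>F p in nhds 0. \<forall>j\<in>{..<M}. (?k j has_derivative frechet_derivative (?k j) (at p)) (at p)"
    by (intro eventually_ball_finite ballI smooth_germ_has_derivative sm) auto
  with C(2) have "\<forall>\<^sub>F p in nhds 0. norm (?k M p) \<le> C \<and>
      (\<forall>j\<in>{..<M}. (?k j has_derivative frechet_derivative (?k j) (at p)) (at p))"
    by (rule eventually_conj)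
  then obtain r where r: "0 < r" "\<And>s y. \<bar>s\<bar> < r \<Longrightarrow> norm y < r \<Longrightarrow> norm (?k M (s, y)) \<le> C \<and>
      (\<forall>j\<in>{..<M}. (?k j has_derivative frechet_derivative (?k j) (at (s, y))) (at (s, y)))"
    using eventually_nhds_0_prodD by blast
  have "norm (k (s, y) - (\<Sum>j<M. (s ^ j / fact j) *\<^sub>R ?k j (0, y))) \<le> C * s ^ M"
    if s: "0 \<le> s" "s < r" and y: "norm y < r" for s y
  proof -
    have "((\<lambda>t. ?k j (t, y)) has_vector_derivative ?k (Suc j) (t, y)) (at t within {0..s})"
      if "j < M" "0 \<le> t" "t \<le> s" for j t
    proof -
      have d: "(?k j has_derivative frechet_derivative (?k j) (at (t, y))) (at (t, y))"
        using r(2)[of t y] that s y by auto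
      have "((\<lambda>t. (t, y)) has_vector_derivative (1, 0)) (at t within {0..s})"
        by (auto intro!: derivative_eq_intros)
      from has_vector_derivative_compose_has_derivative[OF this d] show ?thesis by (simp add: lie_deriv_def)
    qed
    moreover have "norm (?k M (t, y)) \<le> C" if "0 \<le> t" "t \<le> s" for t
      using r(2)[of t y] that s y by auto
    ultimately show ?thesis
      using taylor_remainder_bound[of 0 s M "\<lambda>j t. ?k j (t, y)" C] s by simp
  qed
  then show ?thesis using that[OF r(1) C(1)] by blast
qed

text \<open>The constant and the range of s may depend on \<open>y\<close>. At each fixed
  \<open>y\<close> the Taylor polynomial in s is O(s^M), so it vanishes. With
  \<open>coeffs_zero_imp_flat\<close> this upgrades a pointwise bound to a uniform one.\<close>

lemma pointwise_flat_imp_coeffs_zero: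
  fixes k :: "real \<times> 'a::euclidean_space \<Rightarrow> 'b::banach"
  assumes "smooth_germ k"
    and "\<forall>\<^sub>F y in nhds 0. \<exists>C. \<forall>\<^sub>F s in at_right 0. norm (k (s, y)) \<le> C * s ^ M"
  shows "\<forall>\<^sub>F y in nhds 0. \<forall>j<M. (lie_deriv (\<lambda>p. (1, 0)) ^^ j) k (0, y) = 0"
proof -
  let ?k = "\<lambda>j. (lie_deriv (\<lambda>p. (1::real, 0::'a)) ^^ j) k"
  obtain r C where r: "0 < r" "0 < C" "\<And>s y. 0 \<le> s \<Longrightarrow> s < r \<Longrightarrow> norm y < r \<Longrightarrow>
    norm (k (s, y) - (\<Sum>j<M. (s ^ j / fact j) *\<^sub>R ?k j (0, y))) \<le> C * s ^ M"
    using smooth_germ_taylor_time[OF assms(1)] by blast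
  have "\<forall>\<^sub>F y in nhds (0::'a). norm y < r"
    using r(1) unfolding eventually_nhds_metric by (auto simp: dist_norm)
  with assms(2) show ?thesis
  proof eventually_elim
    case (elim y)
    then obtain D where "\<forall>\<^sub>F s in at_right 0. norm (k (s, y)) \<le> D * s ^ M" by blast
    moreover have "\<forall>\<^sub>F s in at_right (0::real). 0 < s \<and> s < r"
      using r(1) by (simp add: eventually_at_right_less eventually_conj eventually_at_right_field) (use r(1) in blast)
    ultimately have "\<forall>\<^sub>F s in at_right 0. norm (\<Sum>j<M. s ^ j *\<^sub>R ((1 / fact j) *\<^sub>R ?k j (0, y))) \<le> (C + D) * s ^ M"
    proof eventually_elim
      case (elim s)
      have "norm (\<Sum>j<M. (s ^ j / fact j) *\<^sub>R ?k j (0, y)) \<le> C * s ^ M + D * s ^ M"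
        using r(3)[of s y] elim \<open>norm y < r\<close> norm_triangle_sub[of "\<Sum>j<M. (s ^ j / fact j) *\<^sub>R ?k j (0, y)" "k (s, y)"]
        by (simp add: norm_minus_commute)
      then show ?case by (simp add: distrib_right)
    qed
    then show ?case using polynomial_coeffs_zero[of "\<lambda>j. (1 / fact j) *\<^sub>R ?k j (0, y)" M "C + D"] by simp
  qed
qed

lemma coeffs_zero_imp_flat:
  fixes k :: "real \<times> 'a::euclidean_space \<Rightarrow> 'b::banach"
  assumes "smooth_germ k" "\<forall>\<^sub>F y in nhds 0. \<forall>j<M. (lie_deriv (\<lambda>p. (1, 0)) ^^ j) k (0, y) = 0"
  shows "flat M k"
proof -
  let ?k = "\<lambda>j. (lie_deriv (\<lambda>p. (1::real, 0::'a)) ^^ j) k"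
  obtain r C where r: "0 < r" "0 < C" "\<And>s y. 0 \<le> s \<Longrightarrow> s < r \<Longrightarrow> norm y < r \<Longrightarrow>
    norm (k (s, y) - (\<Sum>j<M. (s ^ j / fact j) *\<^sub>R ?k j (0, y))) \<le> C * s ^ M"
    using smooth_germ_taylor_time[OF assms(1)] by blast
  obtain d where d: "0 < d" "\<And>y. norm y < d \<Longrightarrow> \<forall>j<M. ?k j (0, y) = 0"
    using assms(2) unfolding eventually_nhds_metric by (auto simp: dist_norm)
  have "\<forall>\<^sub>F p in nhds 0. 0 \<le> fst p \<longrightarrow> norm (k p) \<le> C * fst p ^ M"
  proof (rule eventually_nhds_0_prodI[of "min r d"])
    fix s :: real and y :: 'a assume "\<bar>s\<bar> < min r d" "norm y < min r d"
    then show "0 \<le> fst (s, y) \<longrightarrow> norm (k (s, y)) \<le> C * fst (s, y) ^ M"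
      using r(3)[of s y] d(2)[of y] by auto
  qed (use r d in auto)
  then show ?thesis unfolding flat_def by blast
qed

lemma lie_deriv_euler:
  fixes f :: "real \<times> 'a::euclidean_space \<Rightarrow> 'b::real_normed_vector"
  assumes "smooth_germ f"
  shows "\<forall>\<^sub>F p in nhds 0. lie_deriv (\<lambda>p. (fst p, 0)) f p = fst p *\<^sub>R lie_deriv (\<lambda>p. (1, 0)) f p"
  using smooth_germ_has_derivative[OF assms]
proof eventually_elim
  case (elim p)
  then have "linear (frechet_derivative f (at p))" using has_derivative_linear by blast
  from linear_cmul[OF this, of "fst p" "(1, 0)"] show ?case by (simp add: lie_deriv_def)
qed

text \<open>The time derivative loses one order of vanishing, and the factor s of the Euler field
  gives it back.\<close>

lemma coeffs_zero_imp_flat_euler: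
  fixes k :: "real \<times> 'a::euclidean_space \<Rightarrow> 'b::banach"
  assumes "smooth_germ k" "\<forall>\<^sub>F y in nhds 0. \<forall>j<M. (lie_deriv (\<lambda>p. (1, 0)) ^^ j) k (0, y) = 0" "0 < M"
  shows "flat M (lie_deriv (\<lambda>p. (fst p, 0)) k)"
proof -
  let ?t = "\<lambda>p::real \<times> 'a. (1::real, 0::'a)"
  obtain m where m: "M = Suc m" using assms(3) gr0_implies_Suc by blast
  have "flat m (lie_deriv ?t k)"
  proof (rule coeffs_zero_imp_flat)
    show "smooth_germ (lie_deriv ?t k)" by (intro smooth_germ_lie_deriv smooth_germ_unit_time assms)
    show "\<forall>\<^sub>F y in nhds 0. \<forall>j<m. (lie_deriv ?t ^^ j) (lie_deriv ?t k) (0, y) = 0"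
      using assms(2)
    proof eventually_elim
      case (elim y)
      then show ?case using m by (auto simp: funpow_swap1 dest: spec[of _ "Suc _"])
    qed
  qed
  then obtain C where "\<forall>\<^sub>F p in nhds 0. 0 \<le> fst p \<longrightarrow> norm (lie_deriv ?t k p) \<le> C * fst p ^ m"
    unfolding flat_def by blast
  with lie_deriv_euler[OF assms(1)]
  have "\<forall>\<^sub>F p in nhds 0. 0 \<le> fst p \<longrightarrow> norm (lie_deriv (\<lambda>p. (fst p, 0)) k p) \<le> C * fst p ^ M"
  proof eventually_elim
    case (elim p)
    show ?case
    proof
      assume "0 \<le> fst p"
      then have "norm (lie_deriv (\<lambda>p. (fst p, 0)) k p) \<le> fst p * (C * fst p ^ m)"
        using elim by (auto intro: mult_left_mono)
      then show "norm (lie_deriv (\<lambda>p. (fst p, 0)) k p) \<le> C * fst p ^ M" by (simp add: m mult_ac)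
    qed
  qed
  then show ?thesis unfolding flat_def by blast
qed

text \<open>At time s the map moves points by O(s), so Brouwer's theorem solves \<phi> (s, y) = x
  near the origin. The predicate \<open>P\<close> carries information from the starting point
  \<open>y\<close> to \<open>x\<close>.\<close>

lemma near_identity_surjective:
  fixes \<phi> :: "real \<times> 'a::euclidean_space \<Rightarrow> 'a"
  assumes "smooth_germ \<phi>" "\<forall>\<^sub>F y in nhds 0. \<phi> (0, y) = y" "\<forall>\<^sub>F p in nhds 0. P p"
  shows "\<forall>\<^sub>F p in nhds 0. 0 \<le> fst p \<longrightarrow> (\<exists>y. \<phi> (fst p, y) = snd p \<and> P (fst p, y))"
proof -
  have "flat 1 (\<lambda>p. \<phi> p - snd p)"
    by (rule coeffs_zero_imp_flat)
       (use assms in \<open>auto intro: smooth_germ_diff smooth_germ_bounded_linear[OF bounded_linear_snd]\<close>)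
  then obtain C where "\<forall>\<^sub>F p in nhds 0. 0 \<le> fst p \<longrightarrow> norm (\<phi> p - snd p) \<le> C * fst p"
    unfolding flat_def by auto
  with assms(3) smooth_germ_continuous[OF assms(1)]
  have "\<forall>\<^sub>F p in nhds 0. P p \<and> isCont \<phi> p \<and> (0 \<le> fst p \<longrightarrow> norm (\<phi> p - snd p) \<le> C * fst p)"
    by eventually_elim auto
  then obtain r where r: "0 < r" "\<And>s y. \<bar>s\<bar> < r \<Longrightarrow> norm y < r \<Longrightarrow>
      P (s, y) \<and> isCont \<phi> (s, y) \<and> (0 \<le> s \<longrightarrow> norm (\<phi> (s, y) - y) \<le> C * s)"
    using eventually_nhds_0_prodD by (metis (no_types, lifting) fst_conv snd_conv)
  \<comment> \<open>\<open>D\<close> is positive and dominates \<open>C\<close>. The factor 4 in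
    \<open>K\<close> bounds both the displacement \<open>C * s\<close> and the norm of
    \<open>x\<close> by \<open>r / 4\<close>, so the ball of radius \<open>r / 2\<close> is mapped
    into itself.\<close>
  define D where "D = \<bar>C\<bar> + 1"
  define K where "K = 4 * D"
  have D: "1 \<le> D" and K: "4 \<le> K" by (simp_all add: D_def K_def)
  show ?thesis
  proof (rule eventually_nhds_0_prodI[of "r / K"])
    show "0 < r / K" using r K by simp
    fix s :: real and x :: 'a assume "\<bar>s\<bar> < r / K" and x: "norm x < r / K"
    have "r / K \<le> r / 4" using r(1) K by (intro frac_le) auto
    show "0 \<le> fst (s, x) \<longrightarrow> (\<exists>y. \<phi> (fst (s, x), y) = snd (s, x) \<and> P (fst (s, x), y))"
    proof
      assume "0 \<le> fst (s, x)"
      then have s: "0 \<le> s" by simp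
      have sr: "\<bar>s\<bar> < r" and xr: "norm x \<le> r / 4" using \<open>\<bar>s\<bar> < r / K\<close> x \<open>r / K \<le> r / 4\<close> r(1) by linarith+
      have "C * s \<le> D * (r / K)" using s \<open>\<bar>s\<bar> < r / K\<close> by (intro mult_mono) (auto simp: D_def)
      also have "\<dots> = r / 4" using D by (simp add: K_def)
      finally have Cs: "C * s \<le> r / 4" .
      obtain y where y: "y \<in> cball 0 (r/2)" "y - \<phi> (s, y) + x = y"
      proof (rule brouwer[of "cball 0 (r/2)" "\<lambda>y. y - \<phi> (s, y) + x"])
        have "isCont (\<lambda>y. y - \<phi> (s, y) + x) y" if "y \<in> cball 0 (r/2)" for y
        proof -
          have "isCont \<phi> (s, y)" using r that sr by auto
          then have "isCont (\<lambda>y. \<phi> (s, y)) y"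
            by (intro isCont_o2[where g = \<phi> and f = "\<lambda>y. (s, y)"]) (auto intro: continuous_intros)
          then show ?thesis by (intro continuous_intros)
        qed
        then show "continuous_on (cball 0 (r/2)) (\<lambda>y. y - \<phi> (s, y) + x)"
          by (simp add: continuous_at_imp_continuous_on)
        have "norm (y - \<phi> (s, y) + x) \<le> r/2" if "norm y \<le> r/2" for y
        proof -
          have "norm (\<phi> (s, y) - y) \<le> C * s" using r(2)[OF sr, of y] s that r(1) by auto
          then show ?thesis using Cs xr norm_triangle_ineq[of "y - \<phi> (s, y)" x]
            by (simp add: norm_minus_commute)
        qed
        then show "(\<lambda>y. y - \<phi> (s, y) + x) \<in> cball 0 (r/2) \<rightarrow> cball 0 (r/2)" by auto
      qed (use r(1) in auto)
      then have "\<phi> (s, y) = x" "norm y < r" using r(1) by (auto simp: algebra_simps)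
      then show "\<exists>y. \<phi> (fst (s, x), y) = snd (s, x) \<and> P (fst (s, x), y)"
        using r(2)[OF sr, of y] by auto
    qed
  qed
qed

text \<open>\<open>flow1\<close> does not say where its curve runs. Up to a first exit time the
  speed is at most \<open>B\<close>, so the distance covered in unit time is at most B < \<rho>, and
  there is no exit.\<close>

lemma curve_stays_in_ball:
  fixes c :: "real \<Rightarrow> 'a::euclidean_space"
  assumes c: "\<And>\<tau>. \<tau> \<in> {0..1} \<Longrightarrow> (c has_vector_derivative F (c \<tau>)) (at \<tau> within {0..1})"
    and F: "\<And>x. norm (x - c 0) < \<rho> \<Longrightarrow> norm (F x) \<le> B" and B: "0 \<le> B" "B < \<rho>" and \<tau>: "\<tau> \<in> {0..1}"
  shows "norm (c \<tau> - c 0) < \<rho>"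
proof (rule ccontr)
  assume neg: "\<not> norm (c \<tau> - c 0) < \<rho>"
  have cont: "continuous_on {0..1} c"
    using c has_vector_derivative_continuous by (force simp: continuous_on_eq_continuous_within)
  \<comment> \<open>The times outside the open ball form a compact set, which therefore has a first
    element.\<close>
  define T where "T = {t \<in> {0..1}. \<rho> \<le> norm (c t - c 0)}"
  have "closed T" unfolding T_def
    by (intro continuous_on_closed_Collect_le continuous_intros cont closed_atLeastAtMost)
  then have "compact T" unfolding T_def
    by (metis (no_types, lifting) bounded_closed_interval bounded_subset compact_eq_bounded_closed mem_Collect_eq subsetI)
  moreover have "T \<noteq> {}" using neg \<tau> by (auto simp: T_def)
  ultimately obtain t where t: "t \<in> T" "\<And>t'. t' \<in> T \<Longrightarrow> t \<le> t'"
    using compact_attains_inf by metis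
  have t01: "0 < t" "t \<le> 1"
    using t(1) B by (auto simp: T_def less_eq_real_def)
  have less: "norm (c x - c 0) < \<rho>" if "0 \<le> x" "x < t" for x
    using t(2)[of x] that t01 by (force simp: T_def)
  have "norm (c t - c 0) \<le> B * t - B * 0"
  proof (rule differentiable_bound_general[OF t01(1)])
    show "continuous_on {0..t} c" using cont t01 by (auto intro: continuous_on_subset)
    show "(c has_vector_derivative F (c x)) (at x)" if "0 < x" "x < t" for x
    proof -
      have "(c has_vector_derivative F (c x)) (at x within {0<..<1})"
        using c[of x] that t01 by (auto intro: has_vector_derivative_within_subset)
      then show ?thesis using that t01 by (subst (asm) at_within_open) auto
    qed
    show "norm (F (c x)) \<le> B" if "0 < x" "x < t" for x using F less that by auto
    show "((\<lambda>t. B * t) has_vector_derivative B) (at x)" for x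
      by (auto intro!: derivative_eq_intros simp: has_real_derivative_iff_has_vector_derivative[symmetric])
  qed (auto intro!: continuous_intros)
  also have "\<dots> \<le> B" using B t01 mult_left_le by auto
  also have "\<dots> < \<rho>" by (rule B)
  finally show False using t(1) by (auto simp: T_def)
qed

subsection \<open>Taylor expansion along a flow\<close>

lemma smooth_germ_lipschitz:
  assumes "smooth_germ g"
  shows "\<exists>r>0. \<exists>L\<ge>0. \<forall>p q. norm p < r \<longrightarrow> norm q < r \<longrightarrow> norm (g p - g q) \<le> L * norm (p - q)"
proof -
  have "\<exists>C. \<forall>\<^sub>F p in nhds 0. norm (frechet_derivative g (at p) b) \<le> C" for b
    using smooth_germ_bounded[OF smooth_germ_lie_deriv[OF smooth_germ_const[of b] assms]]
    unfolding lie_deriv_def by blast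
  then obtain C where C: "\<And>b. \<forall>\<^sub>F p in nhds 0. norm (frechet_derivative g (at p) b) \<le> C b" by metis
  have "\<forall>\<^sub>F p in nhds 0. \<forall>b\<in>Basis. norm (frechet_derivative g (at p) b) \<le> C b"
    using C by (intro eventually_ball_finite) auto
  with smooth_germ_has_derivative[OF assms]
  have "\<forall>\<^sub>F p in nhds 0. (g has_derivative frechet_derivative g (at p)) (at p) \<and>
      (\<forall>b\<in>Basis. norm (frechet_derivative g (at p) b) \<le> C b)" by eventually_elim auto
  then obtain r where r: "0 < r" "\<And>p. norm p < r \<Longrightarrow> (g has_derivative frechet_derivative g (at p)) (at p) \<and>
      (\<forall>b\<in>Basis. norm (frechet_derivative g (at p) b) \<le> C b)"
    unfolding eventually_nhds_metric by (auto simp: dist_norm)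
  define L where "L = (\<Sum>b\<in>Basis. C b)"
  have on: "onorm (frechet_derivative g (at p)) \<le> L" if "norm p < r" for p
  proof (rule onorm_le)
    fix w
    have "linear (frechet_derivative g (at p))" using r(2)[OF that] has_derivative_linear by blast
    then have "norm (frechet_derivative g (at p) w) = norm (\<Sum>b\<in>Basis. (w \<bullet> b) *\<^sub>R frechet_derivative g (at p) b)"
      using linear_euclidean_expansion[of "frechet_derivative g (at p)" w] by simp
    also have "\<dots> \<le> (\<Sum>b\<in>Basis. \<bar>w \<bullet> b\<bar> * norm (frechet_derivative g (at p) b))"
      by (intro norm_sum[THEN order_trans]) simp
    also have "\<dots> \<le> (\<Sum>b\<in>Basis. norm w * C b)"
      using r(2)[OF that] by (intro sum_mono mult_mono) (auto simp: Basis_le_norm)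
    finally show "norm (frechet_derivative g (at p) w) \<le> L * norm w"
      by (simp add: L_def sum_distrib_left mult.commute)
  qed
  have "0 \<le> C b" if "b \<in> Basis" for b
    using r(2)[of 0] r(1) that order_trans[OF norm_ge_zero, of "frechet_derivative g (at 0) b" "C b"] by simp
  then have "0 \<le> L" unfolding L_def by (intro sum_nonneg)
  moreover have "norm (g p - g q) \<le> L * norm (p - q)" if "norm p < r" "norm q < r" for p q
    by (rule differentiable_bound[of "ball 0 r" g "\<lambda>p. frechet_derivative g (at p)"])
       (use that r on in \<open>auto intro: has_derivative_at_withinI\<close>)
  ultimately show ?thesis using r(1) by blast
qed

lemma smooth_germ_vertical:
  fixes u :: "'c::euclidean_space \<Rightarrow> 'b::euclidean_space"
  assumes "smooth_germ u"
  shows "smooth_germ (\<lambda>p. (0::'a::euclidean_space, u p))"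
  using smooth_germ_bounded_linear_compose[OF _ assms, of "\<lambda>y. (0, y)"]
  by (simp add: bounded_linear_Pair bounded_linear_zero bounded_linear_ident)

lemma smooth_germ_time_scaleR:
  fixes u :: "real \<times> 'a::euclidean_space \<Rightarrow> 'b::real_normed_vector"
  assumes "smooth_germ u"
  shows "smooth_germ (\<lambda>p. fst p *\<^sub>R u p)"
  by (intro smooth_germ_scaleR smooth_germ_bounded_linear bounded_linear_fst assms)

text \<open>With s frozen, differentiating \<open>g (s, c \<tau>)\<close> in \<tau> along an
  integral curve applies \<open>V\<close> to \<open>g\<close>, so Taylor's formula on the unit
  interval is the truncated exponential. The remainder has \<open>M\<close> factors
  \<open>V\<close>, hence is O(s^M). The gap between the endpoint \<open>z\<close> and
  \<open>\<phi> (s, y)\<close> is handled by a Lipschitz bound for \<open>g\<close>.\<close>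

lemma flow_taylor_pointwise:
  fixes \<phi> u :: "real \<times> (real^'n::finite) \<Rightarrow> real^'n" and g :: "real \<times> (real^'n) \<Rightarrow> 'b::banach"
  assumes u: "smooth_germ u" and \<phi>: "smooth_germ \<phi>" and \<phi>0: "\<forall>\<^sub>F y in nhds 0. \<phi> (0, y) = y"
    and flow: "\<forall>\<^sub>F y in nhds 0. \<exists>C. \<forall>\<^sub>F s in at_right 0.
        \<exists>z. flow1 (\<lambda>x. s *\<^sub>R u (s, x)) y z \<and> norm (\<phi> (s, y) - z) \<le> C * s ^ M"
    and g: "smooth_germ g"
  shows "\<forall>\<^sub>F y in nhds 0. \<exists>C. \<forall>\<^sub>F s in at_right 0.
     norm (g (s, \<phi> (s, y)) - (\<Sum>k<M. (1 / fact k) *\<^sub>R (lie_deriv (\<lambda>p. fst p *\<^sub>R (0, u p)) ^^ k) g (s, y))) \<le> C * s ^ M"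
proof -
  define V where "V = (\<lambda>p. fst p *\<^sub>R (0::real, u p))"
  let ?g = "\<lambda>k. (lie_deriv V ^^ k) g"
  have V: "smooth_germ V" unfolding V_def by (intro smooth_germ_time_scaleR smooth_germ_vertical u)
  have sm: "smooth_germ (?g k)" for k by (rule smooth_germ_lie_deriv_funpow[OF V g])
  have "time_divisible k (?g k)" for k
  proof (induction k)
    case (Suc k)
    then show ?case using time_divisible_lie_deriv_vertical[OF Suc smooth_germ_vertical[OF u]]
      by (simp add: V_def)
  qed (simp add: time_divisible_0 g)
  then have "flat M (?g M)" using time_divisible_imp_flat by blast
  then obtain B where B: "\<forall>\<^sub>F p in nhds 0. 0 \<le> fst p \<longrightarrow> norm (?g M p) \<le> B * fst p ^ M"
    unfolding flat_def by blast
  obtain K where K: "0 < K" "\<forall>\<^sub>F p in nhds 0. norm (u p) \<le> K" using smooth_germ_bounded[OF u] .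
  obtain L rL where L: "0 < rL" "0 \<le> L" "\<And>p q. norm p < rL \<Longrightarrow> norm q < rL \<Longrightarrow> norm (g p - g q) \<le> L * norm (p - q)"
    using smooth_germ_lipschitz[OF g] by blast
  have "\<forall>\<^sub>F p in nhds 0. \<forall>j\<in>{..<M}. (?g j has_derivative frechet_derivative (?g j) (at p)) (at p)"
    by (intro eventually_ball_finite ballI smooth_germ_has_derivative sm) auto
  moreover have "\<forall>\<^sub>F p in nhds (0::real\<times>(real^'n)). norm p < rL"
    using L(1) unfolding eventually_nhds_metric by (auto simp: dist_norm)
  ultimately have "\<forall>\<^sub>F p in nhds 0. (\<forall>j\<in>{..<M}. (?g j has_derivative frechet_derivative (?g j) (at p)) (at p))
      \<and> norm p < rL \<and> norm (u p) \<le> K \<and> (0 \<le> fst p \<longrightarrow> norm (?g M p) \<le> B * fst p ^ M) \<and> isCont \<phi> p"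
    using B K(2) smooth_germ_continuous[OF \<phi>] by eventually_elim auto
  then obtain r where r: "0 < r" "\<And>s y. \<bar>s\<bar> < r \<Longrightarrow> norm y < r \<Longrightarrow>
      (\<forall>j\<in>{..<M}. (?g j has_derivative frechet_derivative (?g j) (at (s, y))) (at (s, y)))
      \<and> norm (s, y) < rL \<and> norm (u (s, y)) \<le> K \<and> (0 \<le> fst (s, y) \<longrightarrow> norm (?g M (s, y)) \<le> B * fst (s, y) ^ M)
      \<and> isCont \<phi> (s, y)"
    by (rule eventually_nhds_0_prodD) blast
  have "\<forall>\<^sub>F y in nhds (0::real^'n). norm y < r/2"
    using r(1) unfolding eventually_nhds_metric by (auto simp: dist_norm intro: exI[of _ "r/2"])
  with flow \<phi>0 have "\<forall>\<^sub>F y in nhds 0. \<exists>C. \<forall>\<^sub>F s in at_right 0.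
     norm (g (s, \<phi> (s, y)) - (\<Sum>k<M. (1 / fact k) *\<^sub>R ?g k (s, y))) \<le> C * s ^ M"
  proof eventually_elim
    case (elim y)
    then obtain C where C: "\<forall>\<^sub>F s in at_right 0. \<exists>z. flow1 (\<lambda>x. s *\<^sub>R u (s, x)) y z \<and> norm (\<phi> (s, y) - z) \<le> C * s ^ M"
      by blast
    have "isCont \<phi> (0, y)" using r(2)[of 0 y] r(1) elim(3) by auto
    then have "isCont (\<lambda>s. \<phi> (s, y)) 0"
      by (intro isCont_o2[where g = \<phi> and f = "\<lambda>s. (s, y)"]) (auto intro: continuous_intros)
    then have "((\<lambda>s. \<phi> (s, y)) \<longlongrightarrow> y) (at_right 0)"
      using elim(2) unfolding isCont_def by (metis filterlim_at_split)
    then have "\<forall>\<^sub>F s in at_right 0. dist (\<phi> (s, y)) y < r/2" using r(1) by (intro tendstoD) auto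
    \<comment> \<open>The second bound keeps the displacement \<open>s * K\<close> below
      \<open>r / 2\<close>, so a curve starting within \<open>r / 2\<close> of 0 stays where the
      estimates hold.\<close>
    moreover have "0 < min r (r / (2 * K))" using r(1) K(1) by auto
    then have "\<forall>\<^sub>F s in at_right (0::real). 0 < s \<and> s < min r (r / (2 * K))"
      unfolding eventually_at_right_field by blast
    ultimately have "\<forall>\<^sub>F s in at_right 0. norm (g (s, \<phi> (s, y)) - (\<Sum>k<M. (1 / fact k) *\<^sub>R ?g k (s, y))) \<le> (B + L * C) * s ^ M"
      using C
    proof eventually_elim
      case (elim s)
      have s: "0 < s" "s < r" "\<bar>s\<bar> < r" "s * K < r / 2" using elim(2) K(1) by (auto simp: field_simps)
      obtain z c where z: "norm (\<phi> (s, y) - z) \<le> C * s ^ M" and c: "c 0 = y" "c 1 = z"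
        "\<And>\<tau>. \<tau> \<in> {0..1} \<Longrightarrow> (c has_vector_derivative s *\<^sub>R u (s, c \<tau>)) (at \<tau> within {0..1})"
        using elim(3) unfolding flow1_def by blast
      have bd: "norm (s *\<^sub>R u (s, x)) \<le> s * K" if "norm (x - c 0) < r/2" for x
      proof -
        have "norm x < r" using that \<open>norm y < r/2\<close> norm_triangle_sub[of x y] unfolding c(1) by linarith
        then show ?thesis using r(2)[OF s(3)] s(1) by (auto intro: mult_left_mono)
      qed
      have stay: "norm (c \<tau>) < r" if "\<tau> \<in> {0..1}" for \<tau>
      proof -
        have "norm (c \<tau> - c 0) < r/2"
          using curve_stays_in_ball[OF c(3) bd _ s(4) that] s(1) K(1) by simp
        then show ?thesis using \<open>norm y < r/2\<close> norm_triangle_sub[of "c \<tau>" y] unfolding c(1) by linarith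
      qed
      have "((\<lambda>\<tau>. ?g j (s, c \<tau>)) has_vector_derivative ?g (Suc j) (s, c \<tau>)) (at \<tau> within {0..1})"
        if "j < M" "0 \<le> \<tau>" "\<tau> \<le> 1" for j \<tau>
      proof -
        have "((\<lambda>\<tau>. (s, c \<tau>)) has_vector_derivative (0, s *\<^sub>R u (s, c \<tau>))) (at \<tau> within {0..1})"
          using c(3)[of \<tau>] that by (intro has_vector_derivative_Pair has_vector_derivative_const) auto
        moreover have "(?g j has_derivative frechet_derivative (?g j) (at (s, c \<tau>))) (at (s, c \<tau>))"
          using r(2)[OF s(3) stay[of \<tau>]] that by auto
        ultimately show ?thesis
          using has_vector_derivative_compose_has_derivative[of "\<lambda>\<tau>. (s, c \<tau>)"]
          by (fastforce simp: lie_deriv_def V_def)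
      qed
      moreover have "norm (?g M (s, c \<tau>)) \<le> B * s ^ M" if "0 \<le> \<tau>" "\<tau> \<le> 1" for \<tau>
        using r(2)[OF s(3) stay[of \<tau>]] that s(1) by auto
      ultimately have "norm (?g 0 (s, c 1) - (\<Sum>j<M. ((1 - 0) ^ j / fact j) *\<^sub>R ?g j (s, c 0))) \<le> B * s ^ M * (1 - 0) ^ M"
        by (intro taylor_remainder_bound) auto
      then have 1: "norm (g (s, z) - (\<Sum>j<M. (1 / fact j) *\<^sub>R ?g j (s, y))) \<le> B * s ^ M" using c by simp
      have "norm z < r" using stay[of 1] c(2) by simp
      moreover have "norm (\<phi> (s, y)) < r"
        using elim(1) \<open>norm y < r/2\<close> norm_triangle_sub[of "\<phi> (s, y)" y] by (simp add: dist_norm)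
      ultimately have "norm (g (s, \<phi> (s, y)) - g (s, z)) \<le> L * norm ((s, \<phi> (s, y)) - (s, z))"
        using r(2)[OF s(3)] by (intro L(3)) auto
      also have "\<dots> = L * norm (\<phi> (s, y) - z)" by (simp add: norm_Pair)
      also have "\<dots> \<le> L * (C * s ^ M)" using z L(2) by (intro mult_left_mono)
      finally have "norm (g (s, \<phi> (s, y)) - g (s, z)) \<le> L * (C * s ^ M)" .
      with 1 norm_triangle_ineq[of "g (s, \<phi> (s, y)) - g (s, z)" "g (s, z) - (\<Sum>j<M. (1 / fact j) *\<^sub>R ?g j (s, y))"]
      show ?case by (simp add: distrib_right mult.assoc)
    qed
    then show ?case by blast
  qed
  then show ?thesis unfolding V_def .
qed

subsection \<open>Truncated exponentials and iterated brackets\<close>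

text \<open>Pascal's rule for one more commutator with \<open>V\<close>: the new factor goes to the
  right (first sum) or, with a minus sign, to the left (second sum); \<open>a\<close> counts the
  factors on the left.\<close>

lemma signed_pascal_sum:
  fixes H :: "nat \<Rightarrow> nat \<Rightarrow> 'b::real_vector"
  shows "(\<Sum>a\<le>Suc k. ((-1) ^ a * of_nat (Suc k choose a)) *\<^sub>R H a (Suc k - a))
    = (\<Sum>a\<le>k. ((-1) ^ a * of_nat (k choose a)) *\<^sub>R H a (Suc k - a))
      - (\<Sum>a\<le>k. ((-1) ^ a * of_nat (k choose a)) *\<^sub>R H (Suc a) (k - a))"
proof -
  have "(\<Sum>a\<le>k. ((-1) ^ a * of_nat (k choose a)) *\<^sub>R H a (Suc k - a))
      = (\<Sum>a\<le>Suc k. ((-1) ^ a * of_nat (k choose a)) *\<^sub>R H a (Suc k - a))"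
    by (simp add: binomial_eq_0)
  also have "\<dots> = H 0 (Suc k) + (\<Sum>a\<le>k. ((-1) ^ Suc a * of_nat (k choose Suc a)) *\<^sub>R H (Suc a) (k - a))"
    by (subst sum.atMost_Suc_shift) simp
  finally have 1: "(\<Sum>a\<le>k. ((-1) ^ a * of_nat (k choose a)) *\<^sub>R H a (Suc k - a))
    = H 0 (Suc k) + (\<Sum>a\<le>k. ((-1) ^ Suc a * of_nat (k choose Suc a)) *\<^sub>R H (Suc a) (k - a))" .
  have "(\<Sum>a\<le>Suc k. ((-1) ^ a * of_nat (Suc k choose a)) *\<^sub>R H a (Suc k - a))
      = H 0 (Suc k) + (\<Sum>a\<le>k. ((-1) ^ Suc a * of_nat (Suc k choose Suc a)) *\<^sub>R H (Suc a) (k - a))"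
    by (subst sum.atMost_Suc_shift) simp
  also have "(\<Sum>a\<le>k. ((-1) ^ Suc a * of_nat (Suc k choose Suc a)) *\<^sub>R H (Suc a) (k - a))
      = (\<Sum>a\<le>k. ((-1) ^ Suc a * of_nat (k choose Suc a)) *\<^sub>R H (Suc a) (k - a))
        - (\<Sum>a\<le>k. ((-1) ^ a * of_nat (k choose a)) *\<^sub>R H (Suc a) (k - a))"
    unfolding sum_subtractf[symmetric]
    by (intro sum.cong refl) (simp add: distrib_left scaleR_diff_left[symmetric] del: scaleR_minus_left)
  finally show ?thesis using 1 by simp
qed

text \<open>One bracket of \<open>G\<close> with \<open>V\<close> acts as \<open>G\<close> after
  \<open>V\<close> minus \<open>V\<close> after \<open>G\<close>. The induction generalises
  \<open>f\<close> because the first term applies the hypothesis to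
  \<open>lie_deriv V f\<close>.\<close>

lemma lie_deriv_iterated_bracket:
  fixes f :: "'a::euclidean_space \<Rightarrow> 'b::euclidean_space"
  assumes E: "smooth_germ E" and V: "smooth_germ V" and f: "smooth_germ f"
  shows "smooth_germ (((\<lambda>A. bracket_field A V) ^^ k) E) \<and>
    (\<forall>\<^sub>F p in nhds 0. lie_deriv (((\<lambda>A. bracket_field A V) ^^ k) E) f p
       = (\<Sum>a\<le>k. ((-1) ^ a * of_nat (k choose a)) *\<^sub>R (lie_deriv V ^^ a) (lie_deriv E ((lie_deriv V ^^ (k - a)) f)) p))"
  using f
proof (induction k arbitrary: f)
  case 0 then show ?case using E by simp
next
  case (Suc k)
  let ?G = "((\<lambda>A. bracket_field A V) ^^ k) E"
  define H where "H a b = (lie_deriv V ^^ a) (lie_deriv E ((lie_deriv V ^^ b) f))" for a b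
  let ?c = "\<lambda>a. (-1) ^ a * of_nat (k choose a) :: real"
  have G: "smooth_germ ?G" using Suc by blast
  have Vf: "smooth_germ (lie_deriv V f)" by (intro smooth_germ_lie_deriv V Suc.prems)
  have smH: "smooth_germ (H a b)" for a b
    unfolding H_def by (intro smooth_germ_lie_deriv_funpow smooth_germ_lie_deriv V E Suc.prems)
  have "\<forall>\<^sub>F p in nhds 0. lie_deriv ?G (lie_deriv V f) p
      = (\<Sum>a\<le>k. ?c a *\<^sub>R (lie_deriv V ^^ a) (lie_deriv E ((lie_deriv V ^^ (k - a)) (lie_deriv V f))) p)"
    using Suc.IH[OF Vf] by blast
  moreover have "(lie_deriv V ^^ (k - a)) (lie_deriv V f) = (lie_deriv V ^^ (Suc k - a)) f" if "a \<le> k" for a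
    using that by (simp add: funpow_swap1[symmetric] Suc_diff_le)
  ultimately have 1: "\<forall>\<^sub>F p in nhds 0. lie_deriv ?G (lie_deriv V f) p = (\<Sum>a\<le>k. ?c a *\<^sub>R H a (Suc k - a) p)"
    unfolding H_def by (auto elim!: eventually_mono intro!: sum.cong)
  have "\<forall>\<^sub>F p in nhds 0. lie_deriv ?G f p = (\<Sum>a\<le>k. ?c a *\<^sub>R H a (k - a) p)"
    using Suc.IH[OF Suc.prems] unfolding H_def by blast
  from lie_deriv_cong[OF this, of V V]
  have 2: "\<forall>\<^sub>F p in nhds 0. lie_deriv V (lie_deriv ?G f) p = lie_deriv V (\<lambda>p. \<Sum>a\<le>k. ?c a *\<^sub>R H a (k - a) p) p"
    by simp
  have 3: "\<forall>\<^sub>F p in nhds 0. lie_deriv V (\<lambda>p. \<Sum>a\<le>k. ?c a *\<^sub>R H a (k - a) p) p = (\<Sum>a\<le>k. ?c a *\<^sub>R H (Suc a) (k - a) p)"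
    using lie_deriv_sum[of "{..k}" "\<lambda>a. H a (k - a)" V ?c] smH by (simp add: H_def)
  have "\<forall>\<^sub>F p in nhds 0. lie_deriv (bracket_field ?G V) f p
      = (\<Sum>a\<le>Suc k. ((-1) ^ a * of_nat (Suc k choose a)) *\<^sub>R H a (Suc k - a) p)"
    using lie_deriv_bracket_field[OF G V Suc.prems] 1 2 3
  proof eventually_elim
    case (elim p)
    then show ?case using signed_pascal_sum[of k "\<lambda>a b. H a b p"] by simp
  qed
  then show ?case using smooth_germ_bracket_field[OF G V] unfolding H_def by simp
qed

text \<open>A product of two truncated series: the full diagonals below \<open>M\<close>, and a
  corner in which the total order is at least \<open>M\<close>. The corner becomes the flat
  remainder below.\<close>

lemma truncated_double_sum:
  fixes H :: "nat \<Rightarrow> nat \<Rightarrow> 'b::comm_monoid_add"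
  shows "(\<Sum>a<M. \<Sum>b<M. H a b) = (\<Sum>k<M. \<Sum>a\<le>k. H a (k - a))
     + (\<Sum>(a, b)\<in>{(a, b). a < M \<and> b < M \<and> M \<le> a + b}. H a b)"
proof -
  have fin: "finite {(a, b). a + b < M}" "finite {(a, b). a < M \<and> b < M \<and> M \<le> a + b}"
    by (rule finite_subset[of _ "{..<M} \<times> {..<M}"]; auto)+
  have "(\<Sum>a<M. \<Sum>b<M. H a b) = (\<Sum>(a, b)\<in>{..<M} \<times> {..<M}. H a b)"
    by (simp add: sum.cartesian_product)
  also have "{..<M} \<times> {..<M} = {(a, b). a + b < M} \<union> {(a, b). a < M \<and> b < M \<and> M \<le> a + b}"
    by auto
  also have "(\<Sum>(a, b)\<in>\<dots>. H a b) = (\<Sum>(a, b)\<in>{(a, b). a + b < M}. H a b)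
     + (\<Sum>(a, b)\<in>{(a, b). a < M \<and> b < M \<and> M \<le> a + b}. H a b)"
    by (rule sum.union_disjoint) (use fin in auto)
  finally show ?thesis by (simp add: sum.triangle_reindex)
qed

text \<open>The operator exponential of \<open>c V\<close> cut off at order \<open>M\<close>; on
  merely smooth functions the full series need not converge.\<close>

definition trunc_exp :: "nat \<Rightarrow> real \<Rightarrow> ('a::euclidean_space \<Rightarrow> 'a) \<Rightarrow> ('a \<Rightarrow> 'b::real_normed_vector) \<Rightarrow> 'a \<Rightarrow> 'b" where
  "trunc_exp M c V f = (\<lambda>p. \<Sum>k<M. (c ^ k / fact k) *\<^sub>R (lie_deriv V ^^ k) f p)"

lemma smooth_germ_trunc_exp: "smooth_germ V \<Longrightarrow> smooth_germ f \<Longrightarrow> smooth_germ (trunc_exp M c V f)"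
  unfolding trunc_exp_def
  by (intro smooth_germ_sum smooth_germ_cscaleR smooth_germ_lie_deriv_funpow)

lemma trunc_exp_cong:
  assumes "\<forall>\<^sub>F p in nhds 0. f p = g p"
  shows "\<forall>\<^sub>F p in nhds 0. trunc_exp M c V f p = trunc_exp M c V g p"
proof -
  have "\<forall>\<^sub>F p in nhds 0. \<forall>k\<in>{..<M}. (lie_deriv V ^^ k) f p = (lie_deriv V ^^ k) g p"
    by (intro eventually_ball_finite ballI lie_deriv_funpow_cong assms) auto
  then show ?thesis by eventually_elim (simp add: trunc_exp_def)
qed

text \<open>The family \<open>h\<close> is general because two cases occur: powers of
  \<open>V\<close> applied to \<open>f\<close>, and \<open>E\<close> applied to powers of
  \<open>V\<close> on \<open>snd\<close>.\<close>

lemma trunc_exp_sum: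
  assumes V: "smooth_germ V" and h: "\<And>b. smooth_germ (h b)"
    and f: "\<forall>\<^sub>F p in nhds 0. f p = (\<Sum>b<M. d b *\<^sub>R h b p)"
  shows "\<forall>\<^sub>F p in nhds 0. trunc_exp M c V f p
      = (\<Sum>k<M. \<Sum>a\<le>k. (c ^ a / fact a * d (k - a)) *\<^sub>R (lie_deriv V ^^ a) (h (k - a)) p)
        + (\<Sum>(a, b)\<in>{(a, b). a < M \<and> b < M \<and> M \<le> a + b}. (c ^ a / fact a * d b) *\<^sub>R (lie_deriv V ^^ a) (h b) p)"
proof -
  have "\<forall>\<^sub>F p in nhds 0. \<forall>a\<in>{..<M}. (lie_deriv V ^^ a) (\<lambda>p. \<Sum>b<M. d b *\<^sub>R h b p) p
      = (\<Sum>b<M. d b *\<^sub>R (lie_deriv V ^^ a) (h b) p)"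
    by (intro eventually_ball_finite ballI lie_deriv_funpow_sum V h) auto
  with trunc_exp_cong[OF f, of M c V] show ?thesis
  proof eventually_elim
    case (elim p)
    have "trunc_exp M c V f p = (\<Sum>a<M. \<Sum>b<M. (c ^ a / fact a * d b) *\<^sub>R (lie_deriv V ^^ a) (h b) p)"
      using elim unfolding trunc_exp_def by (simp add: scaleR_sum_right)
    then show ?case
      unfolding truncated_double_sum[of "\<lambda>a b. (c ^ a / fact a * d b) *\<^sub>R (lie_deriv V ^^ a) (h b) p"] .
  qed
qed

lemma inverse_fact_eq_binomial:
  assumes "a \<le> k"
  shows "1 / (fact a * fact (k - a)) = (of_nat (k choose a) / fact k :: real)"
  using assms by (simp add: binomial_fact)

lemma time_divisible_funpow:
  assumes "time_divisible b h" "smooth_germ u" "\<And>p. fst (u p) = 0"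
  shows "time_divisible (a + b) ((lie_deriv (\<lambda>p. fst p *\<^sub>R u p) ^^ a) h)"
  by (induction a) (auto intro: time_divisible_lie_deriv_vertical assms)

text \<open>The diagonal of order k carries (1 - 1)^k / k!, which vanishes unless k = 0; the corner
  terms have at least \<open>M\<close> factors \<open>V\<close>.\<close>

lemma trunc_exp_inverse_flat:
  assumes u: "smooth_germ u" "\<And>p. fst (u p) = 0" and f: "smooth_germ f" and M: "0 < M"
  defines "V \<equiv> \<lambda>p. fst p *\<^sub>R u p"
  shows "flat M (\<lambda>p. trunc_exp M 1 V (trunc_exp M (-1) V f) p - f p)"
proof -
  have V: "smooth_germ V" unfolding V_def by (intro smooth_germ_time_scaleR u)
  let ?R = "\<lambda>p. \<Sum>(a, b)\<in>{(a, b). a < M \<and> b < M \<and> M \<le> a + b}.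
     (1 ^ a / fact a * ((-1) ^ b / fact b)) *\<^sub>R (lie_deriv V ^^ a) ((lie_deriv V ^^ b) f) p"
  have "time_divisible (a + b) ((lie_deriv V ^^ a) ((lie_deriv V ^^ b) f))" for a b
    using time_divisible_funpow[OF time_divisible_funpow[OF time_divisible_0[OF f] u, of b] u, of a]
    unfolding V_def by simp
  then have R: "flat M ?R"
    by (auto intro!: flat_sum flat_cscaleR time_divisible_imp_flat simp: case_prod_unfold)
  have "\<forall>\<^sub>F p in nhds 0. trunc_exp M 1 V (trunc_exp M (-1) V f) p
      = (\<Sum>k<M. \<Sum>a\<le>k. (1 ^ a / fact a * ((-1) ^ (k - a) / fact (k - a))) *\<^sub>R (lie_deriv V ^^ a) ((lie_deriv V ^^ (k - a)) f) p) + ?R p"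
    by (rule trunc_exp_sum[OF V smooth_germ_lie_deriv_funpow[OF V f]]) (simp add: trunc_exp_def)
  moreover have "(\<Sum>k<M. \<Sum>a\<le>k. (1 ^ a / fact a * ((-1) ^ (k - a) / fact (k - a))) *\<^sub>R (lie_deriv V ^^ a) ((lie_deriv V ^^ (k - a)) f) p) = f p" for p
  proof -
    have "(\<Sum>a\<le>k. (1 ^ a / fact a * ((-1) ^ (k - a) / fact (k - a))) *\<^sub>R (lie_deriv V ^^ a) ((lie_deriv V ^^ (k - a)) f) p)
        = (if k = 0 then f p else 0)" for k
    proof -
      have "(\<Sum>a\<le>k. (1 ^ a / fact a * ((-1) ^ (k - a) / fact (k - a))) *\<^sub>R (lie_deriv V ^^ a) ((lie_deriv V ^^ (k - a)) f) p)
        = (\<Sum>a\<le>k. (of_nat (k choose a) * 1 ^ a * (-1) ^ (k - a)) * (1 / fact k)) *\<^sub>R (lie_deriv V ^^ k) f p"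
        unfolding scaleR_sum_left
      proof (intro sum.cong refl arg_cong2[where f = scaleR])
        fix a assume "a \<in> {..k}"
        then have a: "a \<le> k" by simp
        show "1 ^ a / fact a * ((-1) ^ (k - a) / fact (k - a)) = of_nat (k choose a) * 1 ^ a * (-1) ^ (k - a) * (1 / fact k :: real)"
          using a inverse_fact_eq_binomial[OF a] by (simp add: field_simps)
        show "(lie_deriv V ^^ a) ((lie_deriv V ^^ (k - a)) f) p = (lie_deriv V ^^ k) f p"
          using a by (metis comp_apply funpow_add le_add_diff_inverse)
      qed
      also have "(\<Sum>a\<le>k. (of_nat (k choose a) * 1 ^ a * (-1) ^ (k - a)) * (1 / fact k)) = (0::real) ^ k / fact k"
        using binomial_ring[of "1::real" "-1" k] by (simp add: sum_divide_distrib)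
      finally show ?thesis by simp
    qed
    then show ?thesis using M by simp
  qed
  ultimately have "\<forall>\<^sub>F p in nhds 0. ?R p = trunc_exp M 1 V (trunc_exp M (-1) V f) p - f p"
    by (auto elim: eventually_mono)
  then show ?thesis by (rule flat_cong[OF R])
qed

lemma lie_deriv_snd: "lie_deriv Z snd = (\<lambda>p. snd (Z p))"
proof -
  have "frechet_derivative snd (at p) = snd" for p :: "'a \<times> 'b"
    using frechet_derivative_at[OF bounded_linear_imp_has_derivative[OF bounded_linear_snd]] by metis
  then show ?thesis by (simp add: lie_deriv_def)
qed

text \<open>The diagonal of order k is the k-fold bracket of \<open>E\<close> with \<open>V\<close>,
  divided by k!, acting on \<open>snd\<close>, and a field acting on \<open>snd\<close> returns its
  own spatial component. In the corner \<open>E\<close> preserves the order in time, so all factors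
  s from \<open>V\<close> survive.\<close>

lemma trunc_exp_conjugate_flat:
  fixes u :: "real \<times> 'a::euclidean_space \<Rightarrow> real \<times> 'a"
  assumes u: "smooth_germ u" "\<And>p. fst (u p) = 0"
  defines "V \<equiv> \<lambda>p. fst p *\<^sub>R u p" and "E \<equiv> \<lambda>p. (fst p, 0)"
  shows "flat M (\<lambda>p. trunc_exp M (-1) V (lie_deriv E (trunc_exp M 1 V snd)) p
      - (\<Sum>k<M. (1 / fact k) *\<^sub>R snd (((\<lambda>A. bracket_field A V) ^^ k) E p)))"
proof -
  have V: "smooth_germ V" unfolding V_def by (intro smooth_germ_time_scaleR u)
  have E: "smooth_germ E" unfolding E_def by (rule smooth_germ_euler)
  have S: "smooth_germ (snd :: real \<times> 'a \<Rightarrow> 'a)" by (intro smooth_germ_bounded_linear bounded_linear_snd)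
  let ?h = "\<lambda>b. lie_deriv E ((lie_deriv V ^^ b) (snd :: real \<times> 'a \<Rightarrow> 'a))"
  have h: "smooth_germ (?h b)" for b
    by (intro smooth_germ_lie_deriv smooth_germ_lie_deriv_funpow E V S)
  let ?R = "\<lambda>p. \<Sum>(a, b)\<in>{(a, b). a < M \<and> b < M \<and> M \<le> a + b}.
     ((-1) ^ a / fact a * (1 / fact b)) *\<^sub>R (lie_deriv V ^^ a) (?h b) p"
  have "time_divisible (a + b) ((lie_deriv V ^^ a) (?h b))" for a b
    using time_divisible_funpow[OF time_divisible_lie_deriv_euler[OF time_divisible_funpow[OF time_divisible_0[OF S] u, of b]] u, of a]
    unfolding V_def E_def by simp
  then have R: "flat M ?R"
    by (auto intro!: flat_sum flat_cscaleR time_divisible_imp_flat simp: case_prod_unfold)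
  have "\<forall>\<^sub>F p in nhds 0. lie_deriv E (trunc_exp M 1 V snd) p = (\<Sum>b<M. (1 / fact b) *\<^sub>R ?h b p)"
    unfolding trunc_exp_def power_one
    by (rule lie_deriv_sum) (auto intro: smooth_germ_lie_deriv_funpow V S)
  from trunc_exp_sum[OF V h this, of "-1"]
  have 1: "\<forall>\<^sub>F p in nhds 0. trunc_exp M (-1) V (lie_deriv E (trunc_exp M 1 V snd)) p
      = (\<Sum>k<M. \<Sum>a\<le>k. ((-1) ^ a / fact a * (1 / fact (k - a))) *\<^sub>R (lie_deriv V ^^ a) (?h (k - a)) p) + ?R p" .
  have 2: "\<forall>\<^sub>F p in nhds 0. \<forall>k\<in>{..<M}. lie_deriv (((\<lambda>A. bracket_field A V) ^^ k) E) snd p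
       = (\<Sum>a\<le>k. ((-1) ^ a * of_nat (k choose a)) *\<^sub>R (lie_deriv V ^^ a) (?h (k - a)) p)"
    using lie_deriv_iterated_bracket[OF E V S] by (intro eventually_ball_finite ballI) auto
  have "\<forall>\<^sub>F p in nhds 0. ?R p = trunc_exp M (-1) V (lie_deriv E (trunc_exp M 1 V snd)) p
      - (\<Sum>k<M. (1 / fact k) *\<^sub>R snd (((\<lambda>A. bracket_field A V) ^^ k) E p))"
    using 1 2
  proof eventually_elim
    case (elim p)
    have "(\<Sum>a\<le>k. ((-1) ^ a / fact a * (1 / fact (k - a))) *\<^sub>R (lie_deriv V ^^ a) (?h (k - a)) p)
      = (1 / fact k) *\<^sub>R snd (((\<lambda>A. bracket_field A V) ^^ k) E p)" if "k \<in> {..<M}" for k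
    proof -
      have "(1 / fact k) *\<^sub>R snd (((\<lambda>A. bracket_field A V) ^^ k) E p)
         = (\<Sum>a\<le>k. (1 / fact k) *\<^sub>R ((-1) ^ a * of_nat (k choose a)) *\<^sub>R (lie_deriv V ^^ a) (?h (k - a)) p)"
        using elim(2) that unfolding lie_deriv_snd by (simp only: scaleR_sum_right)
      also have "\<dots> = (\<Sum>a\<le>k. ((-1) ^ a / fact a * (1 / fact (k - a))) *\<^sub>R (lie_deriv V ^^ a) (?h (k - a)) p)"
      proof (intro sum.cong refl)
        fix a assume "a \<in> {..k}"
        then have "(1 / fact k) * ((-1) ^ a * of_nat (k choose a)) = ((-1) ^ a / fact a * (1 / fact (k - a)) :: real)"
          using inverse_fact_eq_binomial[of a k] by (simp add: field_simps)
        then show "(1 / fact k) *\<^sub>R ((-1) ^ a * of_nat (k choose a)) *\<^sub>R (lie_deriv V ^^ a) (?h (k - a)) p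
            = ((-1) ^ a / fact a * (1 / fact (k - a))) *\<^sub>R (lie_deriv V ^^ a) (?h (k - a)) p"
          by (simp only: scaleR_scaleR)
      qed
      finally show ?thesis by simp
    qed
    then show ?case using elim(1) by simp
  qed
  then show ?thesis by (rule flat_cong[OF R])
qed

lemma lie_deriv_diff:
  assumes "smooth_germ f" "smooth_germ g"
  shows "\<forall>\<^sub>F x in nhds 0. lie_deriv Z (\<lambda>x. f x - g x) x = lie_deriv Z f x - lie_deriv Z g x"
  using smooth_germ_has_derivative[OF assms(1)] smooth_germ_has_derivative[OF assms(2)]
proof eventually_elim
  case (elim x)
  from frechet_derivative_at[OF has_derivative_diff[OF elim], symmetric]
  show ?case by (simp add: lie_deriv_def)
qed

text \<open>Writing \<open>x = \<phi> (s, y)\<close>, both \<open>w (s, x)\<close> and every \<open>f (s, y)\<close> can be expanded at \<open>x\<close>: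
  \<open>f (s, y)\<close> agrees with \<open>e\<^sup>-\<^sup>V f\<close> at \<open>(s, x)\<close>. Hence \<open>w\<close> is
  \<open>e\<^sup>-\<^sup>V E e\<^sup>V\<close> applied to the identity.\<close>

theorem log_derivative_expansion:
  fixes \<phi> u w :: "real \<times> (real^'n::finite) \<Rightarrow> real^'n"
  assumes u: "smooth_germ u" and \<phi>: "smooth_germ \<phi>" and \<phi>0: "\<forall>\<^sub>F y in nhds 0. \<phi> (0, y) = y"
    and flow: "\<forall>\<^sub>F y in nhds 0. \<exists>C. \<forall>\<^sub>F s in at_right 0.
        \<exists>z. flow1 (\<lambda>x. s *\<^sub>R u (s, x)) y z \<and> norm (\<phi> (s, y) - z) \<le> C * s ^ M"
    and M: "0 < M"
  defines "V \<equiv> \<lambda>p. fst p *\<^sub>R (0, u p)" and "E \<equiv> \<lambda>p. (fst p, 0)"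
  assumes w: "\<forall>\<^sub>F p in nhds 0. w (fst p, \<phi> p) = lie_deriv E \<phi> p"
  shows "flat M (\<lambda>p. w p - (\<Sum>k<M. (1 / fact k) *\<^sub>R snd (((\<lambda>A. bracket_field A V) ^^ k) E p)))"
proof -
  have u': "smooth_germ (\<lambda>p. (0::real, u p))" by (rule smooth_germ_vertical[OF u])
  have V: "smooth_germ V" unfolding V_def by (intro smooth_germ_time_scaleR u')
  have E: "smooth_germ E" unfolding E_def by (rule smooth_germ_euler)
  have S: "smooth_germ (snd :: real \<times> (real^'n) \<Rightarrow> real^'n)" by (intro smooth_germ_bounded_linear bounded_linear_snd)
  have \<phi>00: "\<phi> (0, 0) = 0" using eventually_nhds_x_imp_x[OF \<phi>0] .
  have "smooth_germ (\<lambda>p. (fst p, 0) + (0, \<phi> p))"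
    by (intro smooth_germ_add smooth_germ_euler smooth_germ_vertical \<phi>)
  then have \<Phi>: "smooth_germ (\<lambda>p. (fst p, \<phi> p))" by simp
  have smk: "smooth_germ (\<lambda>p. g (fst p, \<phi> p) - trunc_exp M 1 V g p)"
    if "smooth_germ g" for g :: "real \<times> (real^'n) \<Rightarrow> real^'n"
    by (intro smooth_germ_diff smooth_germ_compose[OF \<Phi>] smooth_germ_trunc_exp V that)
       (simp add: \<phi>00 zero_prod_def)
  have coeffs: "\<forall>\<^sub>F y in nhds 0. \<forall>j<M. (lie_deriv (\<lambda>p. (1, 0)) ^^ j) (\<lambda>p. g (fst p, \<phi> p) - trunc_exp M 1 V g p) (0, y) = 0"
    if g: "smooth_germ g" for g :: "real \<times> (real^'n) \<Rightarrow> real^'n"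
    by (rule pointwise_flat_imp_coeffs_zero[OF smk[OF g]])
       (use flow_taylor_pointwise[OF u \<phi> \<phi>0 flow g] in \<open>simp add: trunc_exp_def V_def\<close>)
  have A1: "flat M (\<lambda>p. g (fst p, \<phi> p) - trunc_exp M 1 V g p)"
    if "smooth_germ g" for g :: "real \<times> (real^'n) \<Rightarrow> real^'n"
    by (rule coeffs_zero_imp_flat[OF smk[OF that] coeffs[OF that]])
  define f where "f = lie_deriv E (trunc_exp M 1 V snd)"
  have f: "smooth_germ f" unfolding f_def by (intro smooth_germ_lie_deriv E smooth_germ_trunc_exp V S)
  \<comment> \<open>A bound alone could not be differentiated along \<open>E\<close>; the vanishing
    of the Taylor coefficients can.\<close>
  have "flat M (lie_deriv E (\<lambda>p. \<phi> p - trunc_exp M 1 V snd p))"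
    using coeffs_zero_imp_flat_euler[OF smk[OF S] coeffs[OF S] M] unfolding E_def by simp
  then have A2: "flat M (\<lambda>p. lie_deriv E \<phi> p - f p)" unfolding f_def
    by (rule flat_cong) (intro lie_deriv_diff \<phi> smooth_germ_trunc_exp V S)
  have A3: "flat M (\<lambda>p. trunc_exp M 1 V (trunc_exp M (-1) V f) p - f p)"
    using trunc_exp_inverse_flat[OF u' _ f M] unfolding V_def by simp
  let ?q = "trunc_exp M (-1) V f"
  have A4: "flat M (\<lambda>p. ?q p - (\<Sum>k<M. (1 / fact k) *\<^sub>R snd (((\<lambda>A. bracket_field A V) ^^ k) E p)))"
    using trunc_exp_conjugate_flat[OF u', of M] unfolding f_def V_def E_def by simp
  obtain C1 C2 C3 where
    C1: "\<forall>\<^sub>F p in nhds 0. 0 \<le> fst p \<longrightarrow> norm (?q (fst p, \<phi> p) - trunc_exp M 1 V ?q p) \<le> C1 * fst p ^ M" and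
    C2: "\<forall>\<^sub>F p in nhds 0. 0 \<le> fst p \<longrightarrow> norm (lie_deriv E \<phi> p - f p) \<le> C2 * fst p ^ M" and
    C3: "\<forall>\<^sub>F p in nhds 0. 0 \<le> fst p \<longrightarrow> norm (trunc_exp M 1 V ?q p - f p) \<le> C3 * fst p ^ M"
    using A1[OF smooth_germ_trunc_exp[OF V f]] A2 A3 unfolding flat_def by blast
  \<comment> \<open>At (s, \<phi> (s, y)) the value of \<open>w\<close> is
    \<open>lie_deriv E \<phi>\<close> at (s, y), which is close to \<open>f\<close>, then to the
    exponential of \<open>V\<close> applied to \<open>?q\<close>, then to \<open>?q\<close> at (s,
    \<phi> (s, y)).\<close>
  have "\<forall>\<^sub>F p in nhds 0. 0 \<le> fst p \<longrightarrow> norm (w (fst p, \<phi> p) - ?q (fst p, \<phi> p)) \<le> (C1 + C2 + C3) * fst p ^ M"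
    using C1 C2 C3 w
  proof eventually_elim
    case (elim p)
    show ?case
    proof
      assume "0 \<le> fst p"
      have "norm (w (fst p, \<phi> p) - ?q (fst p, \<phi> p)) = norm ((lie_deriv E \<phi> p - f p)
        - ((?q (fst p, \<phi> p) - trunc_exp M 1 V ?q p) + (trunc_exp M 1 V ?q p - f p)))"
        using elim(4) by simp
      also have "\<dots> \<le> norm (lie_deriv E \<phi> p - f p) + (norm (?q (fst p, \<phi> p) - trunc_exp M 1 V ?q p) + norm (trunc_exp M 1 V ?q p - f p))"
        by (rule order_trans[OF norm_triangle_ineq4 add_left_mono[OF norm_triangle_ineq]])
      also have "\<dots> \<le> C2 * fst p ^ M + (C1 * fst p ^ M + C3 * fst p ^ M)"
        using elim \<open>0 \<le> fst p\<close> by (intro add_mono) auto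
      finally show "norm (w (fst p, \<phi> p) - ?q (fst p, \<phi> p)) \<le> (C1 + C2 + C3) * fst p ^ M"
        by (simp add: algebra_simps)
    qed
  qed
  \<comment> \<open>For small s \<ge> 0 every nearby (s, x) is of the form (s, \<phi> (s, y)) with
    \<open>y\<close> subject to the estimate.\<close>
  from near_identity_surjective[OF \<phi> \<phi>0 this]
  have "\<forall>\<^sub>F p in nhds 0. 0 \<le> fst p \<longrightarrow> norm (w p - ?q p) \<le> (C1 + C2 + C3) * fst p ^ M"
    by eventually_elim (metis fst_conv prod.collapse)
  then have "flat M (\<lambda>p. w p - ?q p)" unfolding flat_def by blast
  from flat_add[OF this A4] show ?thesis by simp
qed

subsection \<open>Coefficients of monomials\<close>

lemma mi_abs_add: "mi_abs (\<alpha> + \<beta>) = mi_abs \<alpha> + mi_abs \<beta>"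
  by (simp add: mi_abs_def sum.distrib)

lemma mi_abs_zero: "mi_abs 0 = 0"
  by (simp add: mi_abs_def)

lemma tmono_add: "tmono t (\<alpha> + \<beta>) = tmono t \<alpha> * tmono t \<beta>"
  by (simp add: tmono_def power_add prod.distrib)

lemma tmono_scaleR: "tmono (s *\<^sub>R t) \<alpha> = s ^ mi_abs \<alpha> * tmono t \<alpha>"
  by (simp add: tmono_def mi_abs_def power_mult_distrib prod.distrib power_sum)

lemma finite_mi_abs_less: "finite {\<alpha> :: 'N::finite \<Rightarrow> nat. mi_abs \<alpha> < M}"
proof (rule finite_subset)
  show "{\<alpha> :: 'N \<Rightarrow> nat. mi_abs \<alpha> < M} \<subseteq> (\<Pi>\<^sub>E i\<in>UNIV. {..M})"
  proof
    fix \<alpha> :: "'N \<Rightarrow> nat" assume "\<alpha> \<in> {\<alpha>. mi_abs \<alpha> < M}"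
    moreover have "\<alpha> i \<le> mi_abs \<alpha>" for i unfolding mi_abs_def by (rule member_le_sum) auto
    ultimately show "\<alpha> \<in> (\<Pi>\<^sub>E i\<in>UNIV. {..M})" by (auto intro: order_trans less_imp_le)
  qed
qed (simp add: finite_PiE)

text \<open>Distinct monomials are distinct multiplicative characters, so Dedekind's argument shows
  that they are linearly independent; finitely many evaluation points suffice.\<close>

lemma monomials_separated_by_finite_set:
  fixes S :: "('N::finite \<Rightarrow> nat) set"
  assumes "finite S"
  shows "\<exists>T. finite T \<and> (\<forall>c :: ('N \<Rightarrow> nat) \<Rightarrow> 'b::real_vector.
     (\<forall>t\<in>T. (\<Sum>\<alpha>\<in>S. tmono t \<alpha> *\<^sub>R c \<alpha>) = 0) \<longrightarrow> (\<forall>\<alpha>\<in>S. c \<alpha> = 0))"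
  using assms
proof (induction S)
  case empty show ?case by (intro exI[of _ "{}"]) auto
next
  case (insert \<alpha> S)
  obtain T where T: "finite T" "\<And>c :: ('N \<Rightarrow> nat) \<Rightarrow> 'b.
     \<forall>t\<in>T. (\<Sum>\<beta>\<in>S. tmono t \<beta> *\<^sub>R c \<beta>) = 0 \<Longrightarrow> \<forall>\<beta>\<in>S. c \<beta> = 0"
    using insert.IH by blast
  have "\<exists>u::real^'N. tmono u \<beta> \<noteq> tmono u \<alpha>" if "\<beta> \<in> S" for \<beta>
  proof -
    have "\<beta> \<noteq> \<alpha>" using that insert.hyps by blast
    then obtain i where i: "\<beta> i \<noteq> \<alpha> i" by (auto simp: fun_eq_iff)
    \<comment> \<open>The point with 2 in slot \<open>i\<close> and 1 elsewhere reads off the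
      exponent at \<open>i\<close>, and so separates \<beta> from \<alpha>.\<close>
    have "tmono (\<chi> j. if j = i then 2 else 1) \<delta> = 2 ^ \<delta> i" for \<delta> :: "'N \<Rightarrow> nat"
    proof -
      have "tmono (\<chi> j. if j = i then 2 else 1) \<delta> = (\<Prod>j\<in>UNIV. if j = i then 2 ^ \<delta> i else 1)"
        unfolding tmono_def by (intro prod.cong) auto
      then show ?thesis by (simp add: prod.delta)
    qed
    then show ?thesis using i by (intro exI[of _ "\<chi> j. if j = i then 2 else 1"]) simp
  qed
  then obtain u :: "('N \<Rightarrow> nat) \<Rightarrow> real^'N" where u: "\<And>\<beta>. \<beta> \<in> S \<Longrightarrow> tmono (u \<beta>) \<beta> \<noteq> tmono (u \<beta>) \<alpha>"
    by metis
  define m :: "real^'N \<Rightarrow> real^'N \<Rightarrow> real^'N" where "m t t' = (\<chi> j. t $ j * t' $ j)" for t t'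
  have m: "tmono (m t t') \<delta> = tmono t \<delta> * tmono t' \<delta>" for t t' and \<delta> :: "'N \<Rightarrow> nat"
    by (simp add: tmono_def m_def power_mult_distrib prod.distrib)
  \<comment> \<open>The translates of \<open>T\<close> eliminate \<alpha> and force the coefficients
    on \<open>S\<close> to vanish; at the all-ones point every monomial is 1, which leaves
    \<open>c \<alpha>\<close>.\<close>
  let ?T = "insert (\<chi> j. 1) (T \<union> (\<Union>\<beta>\<in>S. m (u \<beta>) ` T))"
  show ?case
  proof (intro exI[of _ ?T] conjI allI impI)
    show "finite ?T" using T(1) insert.hyps(1) by auto
    fix c :: "('N \<Rightarrow> nat) \<Rightarrow> 'b"
    assume c: "\<forall>t\<in>?T. (\<Sum>\<beta>\<in>insert \<alpha> S. tmono t \<beta> *\<^sub>R c \<beta>) = 0"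
    have cS: "c \<beta> = 0" if \<beta>: "\<beta> \<in> S" for \<beta>
    proof -
      \<comment> \<open>The relation at \<open>m (u \<beta>) t\<close>, minus
        \<open>tmono (u \<beta>) \<alpha>\<close> times the relation at \<open>t\<close>, has no
        \<alpha> term.\<close>
      have "(\<Sum>\<delta>\<in>S. tmono t \<delta> *\<^sub>R (tmono (u \<beta>) \<delta> - tmono (u \<beta>) \<alpha>) *\<^sub>R c \<delta>) = 0" if "t \<in> T" for t
      proof -
        have "(\<Sum>\<delta>\<in>insert \<alpha> S. tmono (m (u \<beta>) t) \<delta> *\<^sub>R c \<delta>)
            - tmono (u \<beta>) \<alpha> *\<^sub>R (\<Sum>\<delta>\<in>insert \<alpha> S. tmono t \<delta> *\<^sub>R c \<delta>) = 0"
        proof -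
          have "m (u \<beta>) t \<in> ?T" "t \<in> ?T" using that \<beta> by blast+
          then show ?thesis by (simp only: bspec[OF c] scaleR_zero_right diff_zero)
        qed
        then have "(\<Sum>\<delta>\<in>insert \<alpha> S. tmono t \<delta> *\<^sub>R (tmono (u \<beta>) \<delta> - tmono (u \<beta>) \<alpha>) *\<^sub>R c \<delta>) = 0"
          unfolding scaleR_sum_right sum_subtractf[symmetric] m
          by (simp add: algebra_simps)
        then show ?thesis using insert.hyps by simp
      qed
      then have "(tmono (u \<beta>) \<beta> - tmono (u \<beta>) \<alpha>) *\<^sub>R c \<beta> = 0"
        using T(2)[of "\<lambda>\<delta>. (tmono (u \<beta>) \<delta> - tmono (u \<beta>) \<alpha>) *\<^sub>R c \<delta>"] \<beta> by blast
      then show ?thesis using u[OF \<beta>] by simp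
    qed
    moreover have "tmono (\<chi> j. 1) \<alpha> = 1" by (simp add: tmono_def)
    then have "c \<alpha> = 0" using c insert.hyps cS by simp
    ultimately show "\<forall>\<beta>\<in>insert \<alpha> S. c \<beta> = 0" by simp
  qed
qed

text \<open>Terms of exponent at least \<open>M\<close> are absorbed into the error for s < 1; the
  others, grouped by exponent, form a polynomial of degree below \<open>M\<close>.\<close>

lemma graded_coeffs_zero:
  fixes y :: "'i \<Rightarrow> 'b::real_normed_vector"
  assumes I: "finite I" and bound: "\<forall>\<^sub>F s in at_right 0. norm (\<Sum>i\<in>I. s ^ d i *\<^sub>R y i) \<le> C * s ^ M" and m: "m < M"
  shows "(\<Sum>i\<in>{i\<in>I. d i = m}. y i) = 0"
proof -
  let ?lo = "{i\<in>I. d i < M}" and ?hi = "{i\<in>I. \<not> d i < M}"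
  define K where "K = (\<Sum>i\<in>?hi. norm (y i))"
  have "\<forall>\<^sub>F s in at_right (0::real). 0 < s \<and> s < 1" unfolding eventually_at_right_field by (intro exI[of _ 1]) auto
  with bound have "\<forall>\<^sub>F s in at_right 0. norm (\<Sum>k<M. s ^ k *\<^sub>R (\<Sum>i\<in>{i\<in>I. d i = k}. y i)) \<le> (C + K) * s ^ M"
  proof eventually_elim
    case (elim s)
    have "(\<Sum>k<M. s ^ k *\<^sub>R (\<Sum>i\<in>{i\<in>I. d i = k}. y i)) = (\<Sum>k<M. \<Sum>i\<in>{i\<in>?lo. d i = k}. s ^ d i *\<^sub>R y i)"
      unfolding scaleR_sum_right by (intro sum.cong) auto
    also have "\<dots> = (\<Sum>i\<in>?lo. s ^ d i *\<^sub>R y i)"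
      by (rule sum.group) (use I in auto)
    also have "\<dots> = (\<Sum>i\<in>I. s ^ d i *\<^sub>R y i) - (\<Sum>i\<in>?hi. s ^ d i *\<^sub>R y i)"
    proof -
      have "I = ?lo \<union> ?hi" by auto
      then have "(\<Sum>i\<in>I. s ^ d i *\<^sub>R y i) = (\<Sum>i\<in>?lo \<union> ?hi. s ^ d i *\<^sub>R y i)" by simp
      also have "\<dots> = (\<Sum>i\<in>?lo. s ^ d i *\<^sub>R y i) + (\<Sum>i\<in>?hi. s ^ d i *\<^sub>R y i)"
        by (rule sum.union_disjoint) (use I in auto)
      finally show ?thesis by simp
    qed
    finally have eq: "(\<Sum>k<M. s ^ k *\<^sub>R (\<Sum>i\<in>{i\<in>I. d i = k}. y i))
        = (\<Sum>i\<in>I. s ^ d i *\<^sub>R y i) - (\<Sum>i\<in>?hi. s ^ d i *\<^sub>R y i)" .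
    have "norm (\<Sum>i\<in>?hi. s ^ d i *\<^sub>R y i) \<le> (\<Sum>i\<in>?hi. s ^ M * norm (y i))"
    proof (rule sum_norm_le)
      fix i assume "i \<in> ?hi"
      then have "s ^ d i \<le> s ^ M" using elim(2) by (intro power_decreasing) auto
      then show "norm (s ^ d i *\<^sub>R y i) \<le> s ^ M * norm (y i)"
        using elim(2) by (simp add: mult_right_mono)
    qed
    also have "\<dots> = K * s ^ M" by (simp add: K_def sum_distrib_left mult.commute)
    finally have "norm (\<Sum>i\<in>?hi. s ^ d i *\<^sub>R y i) \<le> K * s ^ M" .
    with elim(1) show ?case unfolding eq distrib_right
      by (intro order_trans[OF norm_triangle_ineq4]) auto
  qed
  then show ?thesis using polynomial_coeffs_zero[of "\<lambda>k. \<Sum>i\<in>{i\<in>I. d i = k}. y i" M "C + K" m] m by blast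
qed

text \<open>The coefficient of a monomial in the iterated bracket of \<open>E\<close> with
  \<open>V\<close>. The last letter is bracketed with \<open>E\<close> first, which multiplies its
  field by \<open>mi_abs \<beta>\<close>; each earlier letter is then bracketed on the right. The
  empty word stands for \<open>E\<close>, whose spatial part is 0.\<close>

fun lie_word :: "(('N::finite \<Rightarrow> nat) \<Rightarrow> 'n::finite vf) \<Rightarrow> ('N \<Rightarrow> nat) list \<Rightarrow> 'n vf" where
  "lie_word Z [] = (\<lambda>x. 0)"
| "lie_word Z [\<beta>] = (\<lambda>x. real (mi_abs \<beta>) *\<^sub>R Z \<beta> x)"
| "lie_word Z (\<beta> # l) = lie_bracket (lie_word Z l) (Z \<beta>)"

lemma lie_word_Cons: "l \<noteq> [] \<Longrightarrow> lie_word Z (\<beta> # l) = lie_bracket (lie_word Z l) (Z \<beta>)"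
  by (cases l) auto

lemma smooth_germ_lie_word:
  assumes "\<And>\<beta>. smooth_germ (Z \<beta>)"
  shows "smooth_germ (lie_word Z l)"
proof (induction l)
  case (Cons \<beta> l)
  show ?case
  proof (cases "l = []")
    case True then show ?thesis by (simp add: smooth_germ_cscaleR assms)
  next
    case False then show ?thesis
      using smooth_germ_bracket_field[OF Cons assms] by (simp add: lie_word_Cons lie_bracket_eq_bracket_field)
  qed
qed (simp add: smooth_germ_const)

lemma smooth_germ_time_monomial:
  fixes Y :: "'a::euclidean_space \<Rightarrow> 'a"
  assumes "smooth_germ Y"
  shows "smooth_germ (\<lambda>p::real \<times> 'a. (0::real, (c * fst p ^ k) *\<^sub>R Y (snd p)))"
proof (rule smooth_germ_vertical)
  have "smooth_germ (\<lambda>p::real \<times> 'a. fst p ^ k *\<^sub>R Y (snd p))"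
  proof (induction k)
    case 0 show ?case
      using smooth_germ_compose[OF smooth_germ_bounded_linear[OF bounded_linear_snd] _ assms] by simp
  next
    case (Suc k) show ?case using smooth_germ_time_scaleR[OF Suc] by simp
  qed
  then show "smooth_germ (\<lambda>p::real \<times> 'a. (c * fst p ^ k) *\<^sub>R Y (snd p))"
    using smooth_germ_cscaleR by fastforce
qed

lemma eventually_snd_nhds_0:
  fixes P :: "'a::real_normed_vector \<Rightarrow> bool"
  assumes "\<forall>\<^sub>F x in nhds 0. P x"
  shows "\<forall>\<^sub>F p in nhds (0::real \<times> 'a). P (snd p)"
proof -
  obtain d where "0 < d" "\<And>x. norm x < d \<Longrightarrow> P x"
    using assms unfolding eventually_nhds_metric by (auto simp: dist_norm)
  then show ?thesis by (intro eventually_nhds_0_prodI[of d]) auto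
qed

lemma frechet_derivative_time_monomial:
  fixes Y :: "'a::euclidean_space \<Rightarrow> 'a"
  assumes "(Y has_derivative frechet_derivative Y (at (snd p))) (at (snd p))"
  shows "frechet_derivative (\<lambda>p::real \<times> 'a. (0::real, (c * fst p ^ k) *\<^sub>R Y (snd p))) (at p) w
    = (0, (c * fst p ^ k) *\<^sub>R frechet_derivative Y (at (snd p)) (snd w)
        + (c * (of_nat k * fst w * fst p ^ (k - 1))) *\<^sub>R Y (snd p))"
proof -
  have "((\<lambda>p::real \<times> 'a. Y (snd p)) has_derivative (\<lambda>w. frechet_derivative Y (at (snd p)) (snd w))) (at p)"
    by (rule has_derivative_compose[OF has_derivative_snd[OF has_derivative_ident] assms])
  moreover have "((\<lambda>p::real \<times> 'a. c * fst p ^ k) has_derivative (\<lambda>w. c * (of_nat k * fst w * fst p ^ (k - 1)))) (at p)"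
    by (intro has_derivative_mult_right has_derivative_power has_derivative_fst has_derivative_ident)
  ultimately have "((\<lambda>p::real \<times> 'a. (0::real, (c * fst p ^ k) *\<^sub>R Y (snd p))) has_derivative
      (\<lambda>w. (0, (c * fst p ^ k) *\<^sub>R frechet_derivative Y (at (snd p)) (snd w)
        + (c * (of_nat k * fst w * fst p ^ (k - 1))) *\<^sub>R Y (snd p)))) (at p)"
    by (intro has_derivative_Pair has_derivative_const has_derivative_scaleR)
  from frechet_derivative_at[OF this, symmetric] show ?thesis by simp
qed

text \<open>Both fields are vertical, so neither differentiates the powers of time.\<close>

lemma bracket_time_monomials:
  fixes Y Z :: "'n::finite vf"
  assumes "smooth_germ Y" "smooth_germ Z"
  shows "\<forall>\<^sub>F p in nhds 0. bracket_field (\<lambda>p::real \<times> (real^'n). (0::real, (c * fst p ^ k) *\<^sub>R Y (snd p)))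
      (\<lambda>p. (0, (d * fst p ^ m) *\<^sub>R Z (snd p))) p = (0, (c * d * fst p ^ (k + m)) *\<^sub>R lie_bracket Y Z (snd p))"
  using eventually_snd_nhds_0[OF smooth_germ_has_derivative[OF assms(1)]]
    eventually_snd_nhds_0[OF smooth_germ_has_derivative[OF assms(2)]]
proof eventually_elim
  case (elim p)
  have "linear (frechet_derivative Y (at (snd p)))" "linear (frechet_derivative Z (at (snd p)))"
    using elim has_derivative_linear by blast+
  then show ?case
    unfolding bracket_field_def lie_deriv_def lie_bracket_def
      frechet_derivative_time_monomial[OF elim(1)] frechet_derivative_time_monomial[OF elim(2)]
    by (simp add: linear_cmul power_add algebra_simps)
qed

text \<open>\<open>E\<close> measures the degree in time, and being independent of \<open>x\<close>
  it has zero derivative along a vertical field.\<close>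

lemma bracket_euler_time_monomial:
  fixes Z :: "'n::finite vf"
  assumes "smooth_germ Z"
  shows "\<forall>\<^sub>F p in nhds 0. bracket_field (\<lambda>p::real \<times> (real^'n). (fst p, 0))
      (\<lambda>p. (0, (d * fst p ^ m) *\<^sub>R Z (snd p))) p = (0, (d * fst p ^ m) *\<^sub>R real m *\<^sub>R Z (snd p))"
  using eventually_snd_nhds_0[OF smooth_germ_has_derivative[OF assms]]
proof eventually_elim
  case (elim p)
  have E: "frechet_derivative (\<lambda>p::real \<times> (real^'n). (fst p, 0::real^'n)) (at p) = (\<lambda>p. (fst p, 0))"
    by (rule frechet_derivative_at[symmetric])
       (intro bounded_linear_imp_has_derivative bounded_linear_Pair bounded_linear_fst bounded_linear_zero)
  have lin: "linear (frechet_derivative Z (at (snd p)))"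
    using elim has_derivative_linear by blast
  have "d * (real m * fst p * fst p ^ (m - 1)) = d * fst p ^ m * real m" by (cases m) auto
  then show ?case
    unfolding bracket_field_def lie_deriv_def E frechet_derivative_time_monomial[OF elim]
    using linear_0[OF lin] by (simp add: zero_prod_def)
qed

abbreviation words_of_length :: "'a set \<Rightarrow> nat \<Rightarrow> 'a list set" where
  "words_of_length F k \<equiv> {l. set l \<subseteq> F \<and> length l = k}"

lemma sum_words_of_length_Suc:
  "(\<Sum>l\<in>words_of_length F k. \<Sum>\<beta>\<in>F. h (\<beta> # l)) = (\<Sum>l\<in>words_of_length F (Suc k). h l)"
proof -
  have "words_of_length F (Suc k) = (\<lambda>(l, \<beta>). \<beta> # l) ` (words_of_length F k \<times> F)"
    by (auto simp: length_Suc_conv image_iff)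
  moreover have "inj_on (\<lambda>(l, \<beta>). \<beta> # l) (words_of_length F k \<times> F)"
    by (auto simp: inj_on_def)
  ultimately show ?thesis by (simp add: sum.reindex sum.cartesian_product o_def case_prod_unfold)
qed

lemma words_of_length_0: "words_of_length F 0 = {[]}"
  by auto

text \<open>The induction starts at one bracket because \<open>E\<close> itself is not vertical;
  from then on each bracket prepends a letter.\<close>

lemma iterated_bracket_eq_words:
  fixes Z :: "('N::finite \<Rightarrow> nat) \<Rightarrow> 'n::finite vf" and v :: "real^'N"
  assumes Z: "\<And>\<beta>. smooth_germ (Z \<beta>)" and F: "finite F"
  defines "V \<equiv> \<lambda>p::real \<times> (real^'n). \<Sum>\<beta>\<in>F. (0::real, (tmono v \<beta> * fst p ^ mi_abs \<beta>) *\<^sub>R Z \<beta> (snd p))"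
  shows "\<forall>\<^sub>F p in nhds 0. ((\<lambda>A. bracket_field A V) ^^ Suc k) (\<lambda>p. (fst p, 0)) p
     = (\<Sum>l\<in>words_of_length F (Suc k). (0, (tmono v (sum_list l) * fst p ^ mi_abs (sum_list l)) *\<^sub>R lie_word Z l (snd p)))"
proof (induction k)
  case 0
  let ?E = "\<lambda>p::real \<times> (real^'n). (fst p, 0::real^'n)"
  let ?B = "\<lambda>\<beta> (p::real \<times> (real^'n)). (0::real, (tmono v \<beta> * fst p ^ mi_abs \<beta>) *\<^sub>R Z \<beta> (snd p))"
  have "\<forall>\<^sub>F p in nhds 0. bracket_field (\<lambda>x. \<Sum>i\<in>{()}. 1 *\<^sub>R ?E x) (\<lambda>x. \<Sum>\<beta>\<in>F. 1 *\<^sub>R ?B \<beta> x) p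
      = (\<Sum>i\<in>{()}. \<Sum>\<beta>\<in>F. (1 * 1) *\<^sub>R bracket_field ?E (?B \<beta>) p)"
    by (rule bracket_field_sum) (auto intro: smooth_germ_euler smooth_germ_time_monomial Z F)
  moreover have "\<forall>\<^sub>F p in nhds 0. \<forall>\<beta>\<in>F. bracket_field ?E (?B \<beta>) p
      = (0, (tmono v \<beta> * fst p ^ mi_abs \<beta>) *\<^sub>R real (mi_abs \<beta>) *\<^sub>R Z \<beta> (snd p))"
    by (intro eventually_ball_finite ballI bracket_euler_time_monomial Z F)
  ultimately show ?case
  proof eventually_elim
    case (elim p)
    have "(\<Sum>l\<in>words_of_length F (Suc 0). (0::real, (tmono v (sum_list l) * fst p ^ mi_abs (sum_list l)) *\<^sub>R lie_word Z l (snd p)))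
       = (\<Sum>\<beta>\<in>F. (0, (tmono v \<beta> * fst p ^ mi_abs \<beta>) *\<^sub>R real (mi_abs \<beta>) *\<^sub>R Z \<beta> (snd p)))"
      unfolding sum_words_of_length_Suc[symmetric] words_of_length_0 by simp
    then show ?case using elim by (simp add: V_def)
  qed
next
  case (Suc k)
  let ?A = "\<lambda>l (p::real \<times> (real^'n)). (0::real, (tmono v (sum_list l) * fst p ^ mi_abs (sum_list l)) *\<^sub>R lie_word Z l (snd p))"
  let ?B = "\<lambda>\<beta> (p::real \<times> (real^'n)). (0::real, (tmono v \<beta> * fst p ^ mi_abs \<beta>) *\<^sub>R Z \<beta> (snd p))"
  let ?W = "words_of_length F (Suc k)"
  have W: "finite ?W" by (rule finite_lists_length_eq[OF F])
  have "\<forall>\<^sub>F p in nhds 0. bracket_field (((\<lambda>A. bracket_field A V) ^^ Suc k) (\<lambda>p. (fst p, 0))) V p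
      = bracket_field (\<lambda>p. \<Sum>l\<in>?W. ?A l p) V p"
    by (rule bracket_field_cong[OF Suc.IH]) simp
  moreover have "\<forall>\<^sub>F p in nhds 0. bracket_field (\<lambda>x. \<Sum>l\<in>?W. 1 *\<^sub>R ?A l x) (\<lambda>x. \<Sum>\<beta>\<in>F. 1 *\<^sub>R ?B \<beta> x) p
      = (\<Sum>l\<in>?W. \<Sum>\<beta>\<in>F. (1 * 1) *\<^sub>R bracket_field (?A l) (?B \<beta>) p)"
    by (rule bracket_field_sum) (auto intro: smooth_germ_time_monomial smooth_germ_lie_word Z F W)
  moreover have "\<forall>\<^sub>F p in nhds 0. \<forall>l\<in>?W. \<forall>\<beta>\<in>F. bracket_field (?A l) (?B \<beta>) p
      = (0, (tmono v (sum_list l) * tmono v \<beta> * fst p ^ (mi_abs (sum_list l) + mi_abs \<beta>)) *\<^sub>R lie_bracket (lie_word Z l) (Z \<beta>) (snd p))"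
    by (intro eventually_ball_finite ballI bracket_time_monomials smooth_germ_lie_word Z F W)
  ultimately show ?case
  proof eventually_elim
    case (elim p)
    have "bracket_field (?A l) (?B \<beta>) p = ?A (\<beta> # l) p" if "l \<in> ?W" "\<beta> \<in> F" for l \<beta>
    proof -
      have "l \<noteq> []" using that by auto
      then show ?thesis using elim(3) that
        by (simp add: lie_word_Cons tmono_add mi_abs_add mult.commute add.commute)
    qed
    then have "((\<lambda>A. bracket_field A V) ^^ Suc (Suc k)) (\<lambda>p. (fst p, 0)) p = (\<Sum>l\<in>?W. \<Sum>\<beta>\<in>F. ?A (\<beta> # l) p)"
      using elim(1,2) by (simp add: V_def)
    then show ?case by (rule trans[OF _ sum_words_of_length_Suc[where h = "\<lambda>l. ?A l p"]])
  qed
qed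

lemma snd_iterated_bracket_eq_words:
  fixes Z :: "('N::finite \<Rightarrow> nat) \<Rightarrow> 'n::finite vf" and v :: "real^'N"
  assumes Z: "\<And>\<beta>. smooth_germ (Z \<beta>)" and F: "finite F"
  defines "V \<equiv> \<lambda>p::real \<times> (real^'n). \<Sum>\<beta>\<in>F. (0::real, (tmono v \<beta> * fst p ^ mi_abs \<beta>) *\<^sub>R Z \<beta> (snd p))"
  shows "\<forall>\<^sub>F p in nhds 0. snd (((\<lambda>A. bracket_field A V) ^^ k) (\<lambda>p. (fst p, 0)) p)
     = (\<Sum>l\<in>words_of_length F k. tmono (fst p *\<^sub>R v) (sum_list l) *\<^sub>R lie_word Z l (snd p))"
proof (cases k)
  case 0
  show ?thesis unfolding 0 words_of_length_0 by simp
next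
  case (Suc j)
  show ?thesis using iterated_bracket_eq_words[where Z = Z and v = v and k = j, OF Z F] unfolding Suc V_def
    by eventually_elim (simp add: snd_sum tmono_scaleR mult.commute)
qed

section \<open>Restriction to rays and comparison of Taylor coefficients\<close>

lemma filterlim_at_right_scaleR: "filterlim (\<lambda>s::real. s *\<^sub>R v) (nhds (0::'a::real_normed_vector)) (at_right 0)"
proof -
  have "((\<lambda>s::real. s *\<^sub>R v) \<longlongrightarrow> 0 *\<^sub>R v) (at_right 0)" by (intro tendsto_intros)
  then show ?thesis by simp
qed

text \<open>The estimate is an abstract \<open>Q\<close> because both a norm bound and the existence
  of a flow endpoint with an error bound are restricted to rays.\<close>

lemma eventually_ray_bound:
  fixes v :: "'a::real_normed_vector"
  assumes "\<forall>\<^sub>F t in nhds 0. Q t (C * norm t ^ M)"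
  shows "\<forall>\<^sub>F s in at_right 0. Q (s *\<^sub>R v) (C * norm v ^ M * s ^ M)"
proof -
  have "\<forall>\<^sub>F s in at_right 0. Q (s *\<^sub>R v) (C * norm (s *\<^sub>R v) ^ M)"
    by (rule eventually_compose_filterlim[OF assms filterlim_at_right_scaleR])
  moreover have "\<forall>\<^sub>F s in at_right (0::real). 0 < s" by (rule eventually_at_right_less)
  ultimately show ?thesis by eventually_elim (simp add: power_mult_distrib mult_ac)
qed

lemma log_derivative_along_ray:
  fixes \<gamma> :: "real^'N::finite \<Rightarrow> real^'n::finite \<Rightarrow> real^'n" and W :: "real^'N \<Rightarrow> 'n vf"
    and Xh :: "('N \<Rightarrow> nat) \<Rightarrow> 'n vf" and v :: "real^'N"
  assumes U: "open U" "(0, 0) \<in> U"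
    and \<gamma>: "smooth_on U (\<lambda>p. \<gamma> (fst p) (snd p))" and \<gamma>0: "\<And>x. (0, x) \<in> U \<Longrightarrow> \<gamma> 0 x = x"
    and W: "\<forall>\<^sub>F (t, y) in nhds (0, 0).
              ((\<lambda>\<epsilon>::real. \<gamma> (\<epsilon> *\<^sub>R t) y) has_vector_derivative W t (\<gamma> t y)) (at 1)"
    and Xh: "\<And>\<alpha>. smooth_germ (Xh \<alpha>)"
    and Xh_exp: "\<forall>\<^sub>F x in nhds 0. \<exists>C. \<forall>\<^sub>F t in nhds 0.
              \<exists>z. flow1 (trunc_series Xh M t) x z \<and> norm (\<gamma> t x - z) \<le> C * norm t ^ M"
    and M: "0 < M"
  defines "F \<equiv> {\<alpha>. 0 < mi_abs \<alpha> \<and> mi_abs \<alpha> < M}"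
  shows "flat M (\<lambda>p. W (fst p *\<^sub>R v) (snd p) -
     (\<Sum>k<M. (1 / fact k) *\<^sub>R (\<Sum>l\<in>words_of_length F k. tmono (fst p *\<^sub>R v) (sum_list l) *\<^sub>R lie_word Xh l (snd p))))"
proof -
  have F: "finite F" unfolding F_def by (rule finite_subset[OF _ finite_mi_abs_less[of M]]) auto
  define \<phi> where "\<phi> p = \<gamma> (fst p *\<^sub>R v) (snd p)" for p
  define w where "w p = W (fst p *\<^sub>R v) (snd p)" for p
  \<comment> \<open>The truncated series along the ray divided by s; the exponents stay natural
    since indices in \<open>F\<close> have positive order.\<close>
  define u where "u p = (\<Sum>\<beta>\<in>F. (tmono v \<beta> * fst p ^ (mi_abs \<beta> - 1)) *\<^sub>R Xh \<beta> (snd p))" for p :: "real \<times> (real^'n)"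
  define V where "V = (\<lambda>p. fst p *\<^sub>R (0::real, u p))"
  define E where "E = (\<lambda>p::real \<times> (real^'n). (fst p, 0::real^'n))"
  have us: "fst p *\<^sub>R u p = trunc_series Xh M (fst p *\<^sub>R v) (snd p)" for p
    unfolding u_def trunc_series_def F_def[symmetric] scaleR_sum_right
  proof (rule sum.cong)
    fix \<beta> assume "\<beta> \<in> F"
    then have "fst p * fst p ^ (mi_abs \<beta> - 1) = fst p ^ mi_abs \<beta>" by (cases "mi_abs \<beta>") (auto simp: F_def)
    then show "fst p *\<^sub>R (tmono v \<beta> * fst p ^ (mi_abs \<beta> - 1)) *\<^sub>R Xh \<beta> (snd p) = tmono (fst p *\<^sub>R v) \<beta> *\<^sub>R Xh \<beta> (snd p)"
      by (simp add: tmono_scaleR mult_ac)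
  qed simp
  have V_eq: "V = (\<lambda>p. \<Sum>\<beta>\<in>F. (0::real, (tmono v \<beta> * fst p ^ mi_abs \<beta>) *\<^sub>R Xh \<beta> (snd p)))"
    unfolding V_def
    by (rule ext, rule prod_eqI)
       (simp_all add: fst_sum snd_sum us trunc_series_def F_def[symmetric] tmono_scaleR mult.commute)
  have u: "smooth_germ u"
  proof -
    have "smooth_germ (\<lambda>p::real \<times> (real^'n). (tmono v \<beta> * fst p ^ k) *\<^sub>R Xh \<beta> (snd p))" for \<beta> k
      using smooth_germ_bounded_linear_compose[OF bounded_linear_snd smooth_germ_time_monomial[OF Xh]] by simp
    then show ?thesis unfolding u_def[abs_def] by (intro smooth_germ_sum)
  qed
  have lin: "bounded_linear (\<lambda>p::real \<times> (real^'n). (fst p *\<^sub>R v, snd p))"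
    by (intro bounded_linear_Pair bounded_linear_snd bounded_linear_scaleR_const bounded_linear_fst)
  have "smooth_germ (\<lambda>p. \<gamma> (fst p) (snd p))"
    using U \<gamma> unfolding smooth_germ_def zero_prod_def by blast
  from smooth_germ_compose[OF smooth_germ_bounded_linear[OF lin] _ this]
  have \<phi>: "smooth_germ \<phi>" unfolding \<phi>_def[abs_def] by (simp add: zero_prod_def)
  have "\<forall>\<^sub>F p in nhds (0::(real^'N) \<times> (real^'n)). p \<in> U"
    using U by (intro eventually_nhds_in_open) (auto simp: zero_prod_def)
  moreover have "filterlim (\<lambda>y::real^'n. (0::real^'N, y)) (nhds 0) (nhds 0)"
  proof -
    have "isCont (\<lambda>y::real^'n. (0::real^'N, y)) 0" by (intro continuous_intros)
    then show ?thesis by (simp add: isCont_def tendsto_at_iff_tendsto_nhds zero_prod_def)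
  qed
  ultimately have "\<forall>\<^sub>F y in nhds (0::real^'n). (0, y) \<in> U" by (rule eventually_compose_filterlim)
  then have \<phi>0: "\<forall>\<^sub>F y in nhds 0. \<phi> (0, y) = y"
    by eventually_elim (simp add: \<phi>_def \<gamma>0)
  have flow: "\<forall>\<^sub>F y in nhds 0. \<exists>C. \<forall>\<^sub>F s in at_right 0.
        \<exists>z. flow1 (\<lambda>x. s *\<^sub>R u (s, x)) y z \<and> norm (\<phi> (s, y) - z) \<le> C * s ^ M"
    using Xh_exp
  proof eventually_elim
    case (elim y)
    then obtain C where C: "\<forall>\<^sub>F t in nhds 0. \<exists>z. flow1 (trunc_series Xh M t) y z \<and> norm (\<gamma> t y - z) \<le> C * norm t ^ M"
      by blast
    have fl: "(\<lambda>x. s *\<^sub>R u (s, x)) = trunc_series Xh M (s *\<^sub>R v)" for s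
      using us[of "(s, _)"] by auto
    show ?case
      unfolding fl \<phi>_def fst_conv snd_conv
      by (rule exI, rule eventually_ray_bound[where
            Q = "\<lambda>t b. \<exists>z. flow1 (trunc_series Xh M t) y z \<and> norm (\<gamma> t y - z) \<le> b", OF C])
  qed
  have w: "\<forall>\<^sub>F p in nhds 0. w (fst p, \<phi> p) = lie_deriv E \<phi> p"
  proof -
    have "isCont (\<lambda>p::real \<times> (real^'n). (fst p *\<^sub>R v, snd p)) 0" by (intro continuous_intros)
    then have lim: "filterlim (\<lambda>p::real \<times> (real^'n). (fst p *\<^sub>R v, snd p)) (nhds (0, 0)) (nhds 0)"
      using tendsto_at_iff_tendsto_nhds[of "\<lambda>p::real \<times> (real^'n). (fst p *\<^sub>R v, snd p)" 0]
      by (simp add: isCont_def)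
    have "\<forall>\<^sub>F p in nhds 0. ((\<lambda>\<epsilon>::real. \<gamma> (\<epsilon> *\<^sub>R (fst p *\<^sub>R v)) (snd p)) has_vector_derivative
        W (fst p *\<^sub>R v) (\<gamma> (fst p *\<^sub>R v) (snd p))) (at 1)"
      using eventually_compose_filterlim[OF W lim] by simp
    with smooth_germ_has_derivative[OF \<phi>] show ?thesis
    proof eventually_elim
      case (elim p)
      \<comment> \<open>Scaling \<open>t\<close> by \<epsilon> scales s by \<epsilon>, so the
        derivative at \<epsilon> = 1 is the derivative along \<open>E\<close>.\<close>
      have "((\<lambda>\<epsilon>::real. (\<epsilon> * fst p, snd p)) has_vector_derivative (fst p, 0)) (at 1)"
        by (auto intro!: derivative_eq_intros has_vector_derivative_Pair simp: has_real_derivative_iff_has_vector_derivative[symmetric])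
      then have "((\<lambda>\<epsilon>. \<phi> (\<epsilon> * fst p, snd p)) has_vector_derivative frechet_derivative \<phi> (at p) (fst p, 0)) (at 1)"
        by (rule has_vector_derivative_compose_has_derivative) (use elim(1) in simp)
      moreover have "((\<lambda>\<epsilon>. \<phi> (\<epsilon> * fst p, snd p)) has_vector_derivative w (fst p, \<phi> p)) (at 1)"
        using elim(2) by (simp add: \<phi>_def w_def)
      ultimately show ?case
        by (simp add: lie_deriv_def E_def vector_derivative_unique_at)
    qed
  qed
  have "flat M (\<lambda>p. w p - (\<Sum>k<M. (1 / fact k) *\<^sub>R snd (((\<lambda>A. bracket_field A V) ^^ k) E p)))"
    using log_derivative_expansion[OF u \<phi> \<phi>0 flow M] w unfolding V_def E_def by blast
  then show ?thesis
  proof (rule flat_cong)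
    have "\<forall>\<^sub>F p in nhds 0. \<forall>k\<in>{..<M}. snd (((\<lambda>A. bracket_field A V) ^^ k) E p)
       = (\<Sum>l\<in>words_of_length F k. tmono (fst p *\<^sub>R v) (sum_list l) *\<^sub>R lie_word Xh l (snd p))"
      unfolding V_eq E_def
      by (intro eventually_ball_finite ballI snd_iterated_bracket_eq_words Xh F) auto
    then show "\<forall>\<^sub>F p in nhds 0. w p - (\<Sum>k<M. (1 / fact k) *\<^sub>R snd (((\<lambda>A. bracket_field A V) ^^ k) E p))
      = W (fst p *\<^sub>R v) (snd p) - (\<Sum>k<M. (1 / fact k) *\<^sub>R (\<Sum>l\<in>words_of_length F k. tmono (fst p *\<^sub>R v) (sum_list l) *\<^sub>R lie_word Xh l (snd p)))"
      by eventually_elim (simp add: w_def)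
  qed
qed

lemma flat_at_point:
  fixes f :: "real \<times> 'a::euclidean_space \<Rightarrow> 'b::real_normed_vector"
  assumes "flat M f"
  shows "\<forall>\<^sub>F x in nhds 0. \<exists>C. \<forall>\<^sub>F s in at_right 0. norm (f (s, x)) \<le> C * s ^ M"
proof -
  obtain C where "\<forall>\<^sub>F p in nhds 0. 0 \<le> fst p \<longrightarrow> norm (f p) \<le> C * fst p ^ M"
    using assms unfolding flat_def by blast
  then obtain r where r: "0 < r" "\<And>s x. \<bar>s\<bar> < r \<Longrightarrow> norm x < r \<Longrightarrow>
      0 \<le> fst (s, x) \<longrightarrow> norm (f (s, x)) \<le> C * fst (s, x) ^ M"
    by (rule eventually_nhds_0_prodD) blast
  have "\<forall>\<^sub>F s in at_right 0. norm (f (s, x)) \<le> C * s ^ M" if "norm x < r" for x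
    unfolding eventually_at_right_field using r that by (intro exI[of _ r]) auto
  moreover have "\<forall>\<^sub>F x in nhds (0::'a). norm x < r"
    using r(1) unfolding eventually_nhds_metric by (auto simp: dist_norm)
  ultimately show ?thesis by (auto elim!: eventually_mono)
qed

text \<open>Along every ray the Taylor series of \<open>W\<close> and the word expansion differ by
  O(s^M). The part of order |\<alpha>| in s is then a polynomial identity in the direction
  \<open>v\<close>, and independence of monomials isolates the coefficient of \<alpha>.\<close>

lemma taylor_coefficient_formula:
  fixes \<gamma> :: "real^'N::finite \<Rightarrow> real^'n::finite \<Rightarrow> real^'n" and W :: "real^'N \<Rightarrow> 'n vf"
    and X Xh :: "('N \<Rightarrow> nat) \<Rightarrow> 'n vf"
  assumes U: "open U" "(0, 0) \<in> U"
    and \<gamma>: "smooth_on U (\<lambda>p. \<gamma> (fst p) (snd p))" and \<gamma>0: "\<And>x. (0, x) \<in> U \<Longrightarrow> \<gamma> 0 x = x"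
    and W: "\<forall>\<^sub>F (t, y) in nhds (0, 0).
              ((\<lambda>\<epsilon>::real. \<gamma> (\<epsilon> *\<^sub>R t) y) has_vector_derivative W t (\<gamma> t y)) (at 1)"
    and X: "\<forall>\<^sub>F x in nhds 0. \<exists>C. \<forall>\<^sub>F t in nhds 0.
              norm (W t x - trunc_series X M t x) \<le> C * norm t ^ M"
    and Xh: "\<And>\<alpha>. smooth_germ (Xh \<alpha>)"
    and Xh_exp: "\<forall>\<^sub>F x in nhds 0. \<exists>C. \<forall>\<^sub>F t in nhds 0.
              \<exists>z. flow1 (trunc_series Xh M t) x z \<and> norm (\<gamma> t x - z) \<le> C * norm t ^ M"
    and \<alpha>: "0 < mi_abs \<alpha>" "mi_abs \<alpha> < M"
  defines "F \<equiv> {\<alpha>. 0 < mi_abs \<alpha> \<and> mi_abs \<alpha> < M}"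
  shows "\<forall>\<^sub>F x in nhds 0. X \<alpha> x = (\<Sum>l\<in>{l. set l \<subseteq> F \<and> length l < M \<and> sum_list l = \<alpha>}. (1 / fact (length l)) *\<^sub>R lie_word Xh l x)"
proof -
  have F: "finite F" unfolding F_def by (rule finite_subset[OF _ finite_mi_abs_less[of M]]) auto
  have M: "0 < M" using \<alpha> by simp
  define J where "J = {l. set l \<subseteq> F \<and> length l < M}"
  have J: "finite J" unfolding J_def
    by (rule finite_subset[OF _ finite_lists_length_le[OF F, of M]]) auto
  \<comment> \<open>Words with letters in \<open>F\<close> may sum to an index of order at least
    \<open>M\<close>. Such indices are kept here and discarded by
    \<open>graded_coeffs_zero\<close>.\<close>
  define S where "S = F \<union> sum_list ` J"
  have S: "finite S" using F J by (simp add: S_def)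
  define c where "c x \<beta> = (if \<beta> \<in> F then X \<beta> x else 0)
      - (\<Sum>l\<in>{l\<in>J. sum_list l = \<beta>}. (1 / fact (length l)) *\<^sub>R lie_word Xh l x)" for x \<beta>
  have expand: "trunc_series X M t x - (\<Sum>k<M. (1 / fact k) *\<^sub>R (\<Sum>l\<in>words_of_length F k. tmono t (sum_list l) *\<^sub>R lie_word Xh l x))
      = (\<Sum>\<beta>\<in>S. tmono t \<beta> *\<^sub>R c x \<beta>)" for t x
  proof -
    have "(\<Sum>k<M. (1 / fact k) *\<^sub>R (\<Sum>l\<in>words_of_length F k. tmono t (sum_list l) *\<^sub>R lie_word Xh l x))
        = (\<Sum>k<M. \<Sum>l\<in>{l\<in>J. length l = k}. tmono t (sum_list l) *\<^sub>R (1 / fact (length l)) *\<^sub>R lie_word Xh l x)"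
      unfolding scaleR_sum_right by (intro sum.cong) (auto simp: J_def)
    also have "\<dots> = (\<Sum>l\<in>J. tmono t (sum_list l) *\<^sub>R (1 / fact (length l)) *\<^sub>R lie_word Xh l x)"
      by (rule sum.group[OF J]) (auto simp: J_def)
    also have "\<dots> = (\<Sum>\<beta>\<in>S. \<Sum>l\<in>{l\<in>J. sum_list l = \<beta>}. tmono t (sum_list l) *\<^sub>R (1 / fact (length l)) *\<^sub>R lie_word Xh l x)"
      by (rule sum.group[symmetric, OF J S]) (auto simp: S_def)
    also have "\<dots> = (\<Sum>\<beta>\<in>S. tmono t \<beta> *\<^sub>R (\<Sum>l\<in>{l\<in>J. sum_list l = \<beta>}. (1 / fact (length l)) *\<^sub>R lie_word Xh l x))"
      unfolding scaleR_sum_right by (intro sum.cong) auto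
    finally have 1: "(\<Sum>k<M. (1 / fact k) *\<^sub>R (\<Sum>l\<in>words_of_length F k. tmono t (sum_list l) *\<^sub>R lie_word Xh l x))
        = (\<Sum>\<beta>\<in>S. tmono t \<beta> *\<^sub>R (\<Sum>l\<in>{l\<in>J. sum_list l = \<beta>}. (1 / fact (length l)) *\<^sub>R lie_word Xh l x))" .
    have "trunc_series X M t x = (\<Sum>\<beta>\<in>F. tmono t \<beta> *\<^sub>R (if \<beta> \<in> F then X \<beta> x else 0))"
      unfolding trunc_series_def F_def by (intro sum.cong) auto
    also have "\<dots> = (\<Sum>\<beta>\<in>S. tmono t \<beta> *\<^sub>R (if \<beta> \<in> F then X \<beta> x else 0))"
      by (rule sum.mono_neutral_left) (use S in \<open>auto simp: S_def\<close>)
    finally show ?thesis unfolding 1 c_def by (simp only: scaleR_diff_right sum_subtractf)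
  qed
  have ray: "\<forall>\<^sub>F x in nhds 0. \<exists>C. \<forall>\<^sub>F s in at_right 0. norm (\<Sum>\<beta>\<in>S. s ^ mi_abs \<beta> *\<^sub>R tmono v \<beta> *\<^sub>R c x \<beta>) \<le> C * s ^ M" for v
  proof -
    have "flat M (\<lambda>p. W (fst p *\<^sub>R v) (snd p) -
       (\<Sum>k<M. (1 / fact k) *\<^sub>R (\<Sum>l\<in>words_of_length F k. tmono (fst p *\<^sub>R v) (sum_list l) *\<^sub>R lie_word Xh l (snd p))))"
      unfolding F_def by (rule log_derivative_along_ray[OF U \<gamma> \<gamma>0 W Xh Xh_exp M])
    from flat_at_point[OF this] X show ?thesis
    proof eventually_elim
    case (elim x)
    then obtain C1 C2 where
      "\<forall>\<^sub>F s in at_right 0. norm (W (s *\<^sub>R v) x - (\<Sum>k<M. (1 / fact k) *\<^sub>R (\<Sum>l\<in>words_of_length F k. tmono (s *\<^sub>R v) (sum_list l) *\<^sub>R lie_word Xh l x))) \<le> C1 * s ^ M"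
      "\<forall>\<^sub>F t in nhds 0. norm (W t x - trunc_series X M t x) \<le> C2 * norm t ^ M" by auto
    note this(1) eventually_ray_bound[where Q = "\<lambda>t b. norm (W t x - trunc_series X M t x) \<le> b", OF this(2), of v]
    then have "\<forall>\<^sub>F s in at_right 0. norm (\<Sum>\<beta>\<in>S. s ^ mi_abs \<beta> *\<^sub>R tmono v \<beta> *\<^sub>R c x \<beta>) \<le> (C1 + C2 * norm v ^ M) * s ^ M"
    proof eventually_elim
      case (elim s)
      have "(\<Sum>\<beta>\<in>S. s ^ mi_abs \<beta> *\<^sub>R tmono v \<beta> *\<^sub>R c x \<beta>) = (\<Sum>\<beta>\<in>S. tmono (s *\<^sub>R v) \<beta> *\<^sub>R c x \<beta>)"
        by (simp add: tmono_scaleR)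
      also have "\<dots> = (W (s *\<^sub>R v) x - (\<Sum>k<M. (1 / fact k) *\<^sub>R (\<Sum>l\<in>words_of_length F k. tmono (s *\<^sub>R v) (sum_list l) *\<^sub>R lie_word Xh l x)))
          - (W (s *\<^sub>R v) x - trunc_series X M (s *\<^sub>R v) x)"
        unfolding expand[symmetric] by simp
      finally have eq: "(\<Sum>\<beta>\<in>S. s ^ mi_abs \<beta> *\<^sub>R tmono v \<beta> *\<^sub>R c x \<beta>)
          = (W (s *\<^sub>R v) x - (\<Sum>k<M. (1 / fact k) *\<^sub>R (\<Sum>l\<in>words_of_length F k. tmono (s *\<^sub>R v) (sum_list l) *\<^sub>R lie_word Xh l x)))
          - (W (s *\<^sub>R v) x - trunc_series X M (s *\<^sub>R v) x)" .
      show ?case unfolding eq distrib_right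
        by (rule order_trans[OF norm_triangle_ineq4 add_mono[OF elim]])
    qed
    then show ?case by blast
    qed
  qed
  obtain T where T: "finite T" "\<And>d :: ('N \<Rightarrow> nat) \<Rightarrow> real^'n.
     \<forall>t\<in>T. (\<Sum>\<beta>\<in>S. tmono t \<beta> *\<^sub>R d \<beta>) = 0 \<Longrightarrow> \<forall>\<beta>\<in>S. d \<beta> = 0"
    using monomials_separated_by_finite_set[OF S] by blast
  \<comment> \<open>The neighbourhood of \<open>x\<close> depends on the direction; finiteness of
    \<open>T\<close> allows the intersection.\<close>
  have "\<forall>\<^sub>F x in nhds 0. \<forall>v\<in>T. \<exists>C. \<forall>\<^sub>F s in at_right 0. norm (\<Sum>\<beta>\<in>S. s ^ mi_abs \<beta> *\<^sub>R tmono v \<beta> *\<^sub>R c x \<beta>) \<le> C * s ^ M"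
    using ray by (intro eventually_ball_finite ballI T(1))
  then show ?thesis
  proof eventually_elim
    case (elim x)
    \<comment> \<open>Coefficients of the other orders are replaced by 0 so that the separation
      property applies to all of \<open>S\<close>.\<close>
    have "(\<Sum>\<beta>\<in>S. tmono v \<beta> *\<^sub>R (if mi_abs \<beta> = mi_abs \<alpha> then c x \<beta> else 0)) = 0" if "v \<in> T" for v
    proof -
      obtain C where "\<forall>\<^sub>F s in at_right 0. norm (\<Sum>\<beta>\<in>S. s ^ mi_abs \<beta> *\<^sub>R tmono v \<beta> *\<^sub>R c x \<beta>) \<le> C * s ^ M"
        using elim \<open>v \<in> T\<close> by blast
      from graded_coeffs_zero[OF S this \<alpha>(2)]
      have "(\<Sum>\<beta>\<in>{\<beta>\<in>S. mi_abs \<beta> = mi_abs \<alpha>}. tmono v \<beta> *\<^sub>R c x \<beta>) = 0" .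
      moreover have "(\<Sum>\<beta>\<in>S. tmono v \<beta> *\<^sub>R (if mi_abs \<beta> = mi_abs \<alpha> then c x \<beta> else 0))
         = (\<Sum>\<beta>\<in>{\<beta>\<in>S. mi_abs \<beta> = mi_abs \<alpha>}. tmono v \<beta> *\<^sub>R c x \<beta>)"
        by (rule sum.mono_neutral_cong_right) (use S in auto)
      ultimately show ?thesis by simp
    qed
    then have z: "\<forall>\<beta>\<in>S. (if mi_abs \<beta> = mi_abs \<alpha> then c x \<beta> else 0) = 0" by (intro T(2)) blast
    have "\<alpha> \<in> F" using \<alpha> by (simp add: F_def)
    then have "\<alpha> \<in> S" by (simp add: S_def)
    from bspec[OF z this] have "c x \<alpha> = 0" by simp
    with \<open>\<alpha> \<in> F\<close> show ?case by (simp add: c_def J_def conj_assoc)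
  qed
qed

subsection \<open>Graded Lie closures\<close>

lemma lin_comb_same_degI:
  assumes "finite I" "\<And>i. i \<in> I \<Longrightarrow> (Y i, d) \<in> A" "\<forall>\<^sub>F x in nhds 0. Z x = (\<Sum>i\<in>I. c i *\<^sub>R Y i x)"
  shows "lin_comb_same_deg A Z d"
proof -
  obtain h where h: "bij_betw h {..<card I} I"
    using ex_bij_betw_nat_finite[OF assms(1)] by (auto simp: atLeast0LessThan)
  have "(Y (h j), d) \<in> A" if "j < card I" for j
    using assms(2) bij_betwE[OF h] that by blast
  moreover have "(\<Sum>i\<in>I. c i *\<^sub>R Y i x) = (\<Sum>j<card I. c (h j) *\<^sub>R Y (h j) x)" for x
    by (rule sum.reindex_bij_betw[OF h, symmetric])
  then have "\<forall>\<^sub>F x in nhds 0. Z x = (\<Sum>j<card I. c (h j) *\<^sub>R Y (h j) x)"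
    using assms(3) by simp
  ultimately show ?thesis unfolding lin_comb_same_deg_def
    by (intro exI[of _ "card I"] exI[of _ "\<lambda>j. c (h j)"] exI[of _ "\<lambda>j. Y (h j)"]) auto
qed

lemma lin_comb_same_degD:
  assumes "lin_comb_same_deg A Z d"
  shows "\<exists>(k::nat) c Y. (\<forall>j<k. (Y j, d) \<in> A) \<and> (\<forall>\<^sub>F x in nhds 0. Z x = (\<Sum>j<k. c j *\<^sub>R Y j x))"
  using assms unfolding lin_comb_same_deg_def .

lemma lin_comb_same_deg_mono:
  assumes "lin_comb_same_deg A Z d" "\<And>Y. (Y, d) \<in> A \<Longrightarrow> (Y, d') \<in> B"
  shows "lin_comb_same_deg B Z d'"
  using assms unfolding lin_comb_same_deg_def by blast

lemma lin_comb_same_deg_base: "(Z, d) \<in> A \<Longrightarrow> lin_comb_same_deg A Z d"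
  by (rule lin_comb_same_degI[of "{()}" "\<lambda>_. Z" d A Z "\<lambda>_. 1"]) auto

lemma lin_comb_same_deg_cong:
  assumes "lin_comb_same_deg A Z d" "\<forall>\<^sub>F x in nhds 0. Y x = Z x"
  shows "lin_comb_same_deg A Y d"
proof -
  obtain k :: nat and c Y' where k: "\<forall>j<k. (Y' j, d) \<in> A" "\<forall>\<^sub>F x in nhds 0. Z x = (\<Sum>j<k. c j *\<^sub>R Y' j x)"
    using lin_comb_same_degD[OF assms(1)] by blast
  from assms(2) k(2) have "\<forall>\<^sub>F x in nhds 0. Y x = (\<Sum>j<k. c j *\<^sub>R Y' j x)" by eventually_elim simp
  with k(1) show ?thesis by (intro lin_comb_same_degI[of "{..<k}"]) auto
qed

lemma lin_comb_same_deg_zero: "lin_comb_same_deg A (\<lambda>x. 0) d"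
  by (rule lin_comb_same_degI[of "{}"]) auto

lemma lin_comb_same_deg_add_scaleR:
  assumes "lin_comb_same_deg A Y d" "lin_comb_same_deg A Z d"
  shows "lin_comb_same_deg A (\<lambda>x. a *\<^sub>R Y x + Z x) d"
proof -
  obtain k :: nat and c Y' where k: "\<forall>j<k. (Y' j, d) \<in> A" "\<forall>\<^sub>F x in nhds 0. Y x = (\<Sum>j<k. c j *\<^sub>R Y' j x)"
    using lin_comb_same_degD[OF assms(1)] by blast
  obtain m :: nat and b Z' where m: "\<forall>j<m. (Z' j, d) \<in> A" "\<forall>\<^sub>F x in nhds 0. Z x = (\<Sum>j<m. b j *\<^sub>R Z' j x)"
    using lin_comb_same_degD[OF assms(2)] by blast
  from k(2) m(2) have "\<forall>\<^sub>F x in nhds 0. a *\<^sub>R Y x + Z x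
      = (\<Sum>i\<in>{..<k} <+> {..<m}. case_sum (\<lambda>j. a * c j) b i *\<^sub>R case_sum Y' Z' i x)"
    by eventually_elim (simp add: sum.Plus scaleR_sum_right)
  then show ?thesis
    by (rule lin_comb_same_degI[rotated 2]) (use k m in auto)
qed

lemma lin_comb_same_deg_sum:
  assumes "finite I" "\<And>i. i \<in> I \<Longrightarrow> lin_comb_same_deg A (Y i) d"
  shows "lin_comb_same_deg A (\<lambda>x. \<Sum>i\<in>I. c i *\<^sub>R Y i x) d"
  using assms
  by (induction I rule: finite_induct) (auto intro: lin_comb_same_deg_zero lin_comb_same_deg_add_scaleR)

lemma smooth_germ_Lie_closure:
  assumes "\<And>Z d. (Z, d) \<in> S \<Longrightarrow> smooth_germ Z" "(Z, d) \<in> Lie_closure S"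
  shows "smooth_germ Z"
  using assms(2)
proof (induction "(Z, d)" arbitrary: Z d)
  case base then show ?case using assms(1) by blast
next
  case bracket then show ?case by (simp add: lie_bracket_eq_bracket_field smooth_germ_bracket_field)
qed

text \<open>The bracket is expanded bilinearly; this uses smoothness, which passes from the
  generators to the whole closure.\<close>

lemma lin_comb_same_deg_lie_bracket:
  assumes S: "\<And>Z d. (Z, d) \<in> S \<Longrightarrow> smooth_germ Z"
    and 1: "lin_comb_same_deg (Lie_closure S) Z1 d1" and 2: "lin_comb_same_deg (Lie_closure S) Z2 d2"
  shows "lin_comb_same_deg (Lie_closure S) (lie_bracket Z1 Z2) (d1 + d2)"
proof -
  obtain k :: nat and c Y where k: "\<forall>j<k. (Y j, d1) \<in> Lie_closure S" "\<forall>\<^sub>F x in nhds 0. Z1 x = (\<Sum>j<k. c j *\<^sub>R Y j x)"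
    using lin_comb_same_degD[OF 1] by blast
  obtain m :: nat and b Y' where m: "\<forall>j<m. (Y' j, d2) \<in> Lie_closure S" "\<forall>\<^sub>F x in nhds 0. Z2 x = (\<Sum>j<m. b j *\<^sub>R Y' j x)"
    using lin_comb_same_degD[OF 2] by blast
  have sm: "smooth_germ (Y j)" if "j \<in> {..<k}" for j 
    by (rule smooth_germ_Lie_closure[where S = S and d = d1]) (use S k(1) that in auto)
  have sm': "smooth_germ (Y' j)" if "j \<in> {..<m}" for j 
    by (rule smooth_germ_Lie_closure[where S = S and d = d2]) (use S m(1) that in auto)
  have "\<forall>\<^sub>F x in nhds 0. bracket_field (\<lambda>x. \<Sum>i\<in>{..<k}. c i *\<^sub>R Y i x) (\<lambda>x. \<Sum>j\<in>{..<m}. b j *\<^sub>R Y' j x) x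
           = (\<Sum>i\<in>{..<k}. \<Sum>j\<in>{..<m}. (c i * b j) *\<^sub>R bracket_field (Y i) (Y' j) x)"
    by (rule bracket_field_sum) (auto intro: sm sm')
  with bracket_field_cong[OF k(2) m(2)]
  have "\<forall>\<^sub>F x in nhds 0. lie_bracket Z1 Z2 x
      = (\<Sum>p\<in>{..<k} \<times> {..<m}. (c (fst p) * b (snd p)) *\<^sub>R lie_bracket (Y (fst p)) (Y' (snd p)) x)"
    by eventually_elim (simp add: lie_bracket_eq_bracket_field sum.cartesian_product case_prod_unfold)
  then show ?thesis
    by (rule lin_comb_same_degI[rotated 2]) (use k(1) m(1) in \<open>auto intro: Lie_closure.bracket\<close>)
qed

lemma Lie_closure_lin_comb:
  assumes S': "\<And>Z d. (Z, d) \<in> S' \<Longrightarrow> smooth_germ Z"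
    and S: "\<And>Z d. (Z, d) \<in> S \<Longrightarrow> lin_comb_same_deg (Lie_closure S') Z d"
    and Z: "(Z, d) \<in> Lie_closure S"
  shows "lin_comb_same_deg (Lie_closure S') Z d"
  using Z
proof (induction "(Z, d)" arbitrary: Z d)
  case base then show ?case using S by blast
next
  case bracket then show ?case by (intro lin_comb_same_deg_lie_bracket S')
qed

lemma lie_word_lin_comb:
  assumes S: "\<And>Z d. (Z, d) \<in> S \<Longrightarrow> smooth_germ Z"
    and l: "l \<noteq> []" "\<And>\<beta>. \<beta> \<in> set l \<Longrightarrow> lin_comb_same_deg (Lie_closure S) (Z \<beta>) \<beta>"
  shows "lin_comb_same_deg (Lie_closure S) (lie_word Z l) (sum_list l)"
  using l
proof (induction l rule: list_nonempty_induct)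
  case (single \<beta>)
  then have "lin_comb_same_deg (Lie_closure S) (Z \<beta>) \<beta>" by simp
  from lin_comb_same_deg_add_scaleR[OF this lin_comb_same_deg_zero, of "real (mi_abs \<beta>)"] show ?case by simp
next
  case (cons \<beta> l)
  then have "lin_comb_same_deg (Lie_closure S) (lie_bracket (lie_word Z l) (Z \<beta>)) (sum_list l + \<beta>)"
    by (intro lin_comb_same_deg_lie_bracket S) auto
  moreover have "sum_list (\<beta> # l) = sum_list l + \<beta>" by (simp only: sum_list.Cons add.commute[of \<beta>])
  ultimately show ?case using lie_word_Cons[OF cons(1)] by metis
qed

text \<open>Each field has its own multi-index as degree. This is the finest grading:
  \<open>mdeg e\<close> is additive, so a statement here yields the one for any
  \<open>e\<close>.\<close>

abbreviation graded_family :: "(('N::finite \<Rightarrow> nat) \<Rightarrow> 'n::finite vf) \<Rightarrow> ('n vf \<times> ('N \<Rightarrow> nat)) set" where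
  "graded_family Z \<equiv> {(Z \<alpha>, \<alpha>) | \<alpha>. 0 < mi_abs \<alpha>}"

lemma mi_abs_less_of_mem_word:
  assumes "\<And>\<beta>. \<beta> \<in> set l \<Longrightarrow> 0 < mi_abs \<beta>" "2 \<le> length l" "\<beta> \<in> set l"
  shows "mi_abs \<beta> < mi_abs (sum_list l)"
proof -
  obtain xs ys where l: "l = xs @ \<beta> # ys" using split_list[OF assms(3)] by blast
  have pos: "0 < mi_abs (sum_list zs)" if "zs \<noteq> []" "set zs \<subseteq> set l" for zs
    using that assms(1) by (cases zs) (auto simp: mi_abs_add)
  have "xs \<noteq> [] \<or> ys \<noteq> []" using assms(2) l by auto
  moreover have "set xs \<subseteq> set l" "set ys \<subseteq> set l" using l by auto
  ultimately have "0 < mi_abs (sum_list xs) \<or> 0 < mi_abs (sum_list ys)" using pos[of xs] pos[of ys] by argo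
  then show ?thesis by (auto simp: l mi_abs_add)
qed

lemma graded_families_equivalent:
  fixes X Xh :: "('N::finite \<Rightarrow> nat) \<Rightarrow> 'n::finite vf"
  assumes Xh: "\<And>\<alpha>. smooth_germ (Xh \<alpha>)"
    and formula: "\<And>\<alpha> M. 0 < mi_abs \<alpha> \<Longrightarrow> mi_abs \<alpha> < M \<Longrightarrow> \<forall>\<^sub>F x in nhds 0. X \<alpha> x =
      (\<Sum>l\<in>{l. set l \<subseteq> {\<alpha>. 0 < mi_abs \<alpha> \<and> mi_abs \<alpha> < M} \<and> length l < M \<and> sum_list l = \<alpha>}. (1 / fact (length l)) *\<^sub>R lie_word Xh l x)"
    and \<alpha>: "0 < mi_abs \<alpha>"
  shows "lin_comb_same_deg (Lie_closure (graded_family Xh)) (X \<alpha>) \<alpha>" (is ?X)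
    and "smooth_germ (X \<alpha>)" (is ?sm)
    and "lin_comb_same_deg (Lie_closure (graded_family X)) (Xh \<alpha>) \<alpha>" (is ?Xh)
proof -
  \<comment> \<open>The index set of the formula for the least admissible cutoff, M = |\<alpha>| +
    1.\<close>
  define L where "L \<alpha> = {l. set l \<subseteq> {\<beta>. 0 < mi_abs \<beta> \<and> mi_abs \<beta> < Suc (mi_abs \<alpha>)} \<and> length l < Suc (mi_abs \<alpha>) \<and> sum_list l = \<alpha>}"
    for \<alpha> :: "'N \<Rightarrow> nat"
  have fin: "finite (L \<alpha>)" for \<alpha>
  proof -
    have "finite {\<beta> :: 'N \<Rightarrow> nat. 0 < mi_abs \<beta> \<and> mi_abs \<beta> < Suc (mi_abs \<alpha>)}"
      by (rule finite_subset[OF _ finite_mi_abs_less[of "Suc (mi_abs \<alpha>)"]]) auto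
    from finite_lists_length_le[OF this, of "mi_abs \<alpha>"] show ?thesis
      by (rule finite_subset[rotated]) (auto simp: L_def)
  qed
  have X_eq: "\<forall>\<^sub>F x in nhds 0. X \<alpha> x = (\<Sum>l\<in>L \<alpha>. (1 / fact (length l)) *\<^sub>R lie_word Xh l x)"
    if "0 < mi_abs \<alpha>" for \<alpha>
    using formula[OF that, of "Suc (mi_abs \<alpha>)"] unfolding L_def by simp
  have ne: "l \<noteq> []" if "l \<in> L \<alpha>" "0 < mi_abs \<alpha>" for l \<alpha>
    using that by (auto simp: L_def mi_abs_zero)
  have gXh: "smooth_germ Z" if "(Z, d) \<in> graded_family Xh" for Z d using that Xh by auto
  have "lin_comb_same_deg (Lie_closure (graded_family Xh)) (lie_word Xh l) \<alpha>" if "l \<in> L \<alpha>" "0 < mi_abs \<alpha>" for l \<alpha>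
  proof -
    have "lin_comb_same_deg (Lie_closure (graded_family Xh)) (Xh \<beta>) \<beta>" if "\<beta> \<in> set l" for \<beta>
      using that \<open>l \<in> L \<alpha>\<close> by (intro lin_comb_same_deg_base Lie_closure.base) (auto simp: L_def)
    then have "lin_comb_same_deg (Lie_closure (graded_family Xh)) (lie_word Xh l) (sum_list l)"
      by (intro lie_word_lin_comb gXh ne[OF that])
    then show ?thesis using that(1) by (simp add: L_def)
  qed
  then have X: "lin_comb_same_deg (Lie_closure (graded_family Xh)) (X \<alpha>) \<alpha>" if "0 < mi_abs \<alpha>" for \<alpha>
    using that by (intro lin_comb_same_deg_cong[OF lin_comb_same_deg_sum[OF fin] X_eq])
  then show ?X using \<alpha> .
  \<comment> \<open>Smoothness of \<open>X \<alpha>\<close> is a consequence of the formula;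
    expanding brackets over the closure of the fields \<open>X\<close> depends on it.\<close>
  have smX: "smooth_germ (X \<alpha>)" if "0 < mi_abs \<alpha>" for \<alpha>
  proof (rule smooth_germ_cong)
    show "smooth_germ (\<lambda>x. \<Sum>l\<in>L \<alpha>. (1 / fact (length l)) *\<^sub>R lie_word Xh l x)"
      by (intro smooth_germ_sum smooth_germ_cscaleR smooth_germ_lie_word Xh)
    show "\<forall>\<^sub>F x in nhds 0. (\<Sum>l\<in>L \<alpha>. (1 / fact (length l)) *\<^sub>R lie_word Xh l x) = X \<alpha> x"
      using X_eq[OF that] by eventually_elim simp
  qed
  then show ?sm using \<alpha> .
  have gX: "smooth_germ Z" if "(Z, d) \<in> graded_family X" for Z d using that smX by auto
  show ?Xh using \<alpha>
  proof (induction "mi_abs \<alpha>" arbitrary: \<alpha> rule: less_induct)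
    case less
    let ?A = "Lie_closure (graded_family X)"
    \<comment> \<open>This word contributes |\<alpha>| times \<open>Xh \<alpha>\<close>, an
      invertible diagonal term. All other words have at least two letters, each of smaller order
      than \<alpha>.\<close>
    have mem: "[\<alpha>] \<in> L \<alpha>" using less.prems by (simp add: L_def)
    have "lin_comb_same_deg ?A (lie_word Xh l) \<alpha>" if "l \<in> L \<alpha> - {[\<alpha>]}" for l
    proof -
      have l: "sum_list l = \<alpha>" "\<And>\<beta>. \<beta> \<in> set l \<Longrightarrow> 0 < mi_abs \<beta>" using that by (auto simp: L_def)
      have "l \<noteq> []" using that ne less.prems by blast
      moreover have "length l \<noteq> 1" using that l(1) by (auto simp: length_Suc_conv)
      ultimately have "2 \<le> length l" by (cases l; cases "tl l") auto
      then have "mi_abs \<beta> < mi_abs \<alpha>" if "\<beta> \<in> set l" for \<beta>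
        using mi_abs_less_of_mem_word[OF l(2) _ that] l(1) by blast
      then have "lin_comb_same_deg ?A (Xh \<beta>) \<beta>" if "\<beta> \<in> set l" for \<beta>
        using less.hyps l(2) that by blast
      then have "lin_comb_same_deg ?A (lie_word Xh l) (sum_list l)"
        by (intro lie_word_lin_comb gX \<open>l \<noteq> []\<close>)
      then show ?thesis using l(1) by simp
    qed
    then have "lin_comb_same_deg ?A (\<lambda>x. \<Sum>l\<in>L \<alpha> - {[\<alpha>]}. (1 / fact (length l)) *\<^sub>R lie_word Xh l x) \<alpha>"
      by (intro lin_comb_same_deg_sum finite_Diff fin)
    moreover have "lin_comb_same_deg ?A (X \<alpha>) \<alpha>"
      using less.prems by (intro lin_comb_same_deg_base Lie_closure.base) auto
    ultimately have "lin_comb_same_deg ?A (\<lambda>x. (-1) *\<^sub>R (\<Sum>l\<in>L \<alpha> - {[\<alpha>]}. (1 / fact (length l)) *\<^sub>R lie_word Xh l x) + X \<alpha> x) \<alpha>"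
      by (rule lin_comb_same_deg_add_scaleR)
    from lin_comb_same_deg_add_scaleR[OF this lin_comb_same_deg_zero, of "1 / real (mi_abs \<alpha>)"]
    show ?case
    proof (rule lin_comb_same_deg_cong)
      show "\<forall>\<^sub>F x in nhds 0. Xh \<alpha> x = (1 / real (mi_abs \<alpha>)) *\<^sub>R ((-1) *\<^sub>R (\<Sum>l\<in>L \<alpha> - {[\<alpha>]}. (1 / fact (length l)) *\<^sub>R lie_word Xh l x) + X \<alpha> x) + 0"
        using X_eq[OF less.prems]
      proof eventually_elim
        case (elim x)
        have "X \<alpha> x = real (mi_abs \<alpha>) *\<^sub>R Xh \<alpha> x + (\<Sum>l\<in>L \<alpha> - {[\<alpha>]}. (1 / fact (length l)) *\<^sub>R lie_word Xh l x)"
          unfolding elim sum.remove[OF fin mem] by simp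
        then show ?case using less.prems by simp
      qed
    qed
  qed
qed

section \<open>Passage from multi-indices to degrees, and pure indices\<close>

lemma mdeg_add: "mdeg e (\<alpha> + \<beta>) = mdeg e \<alpha> + mdeg e \<beta>"
  by (simp add: mdeg_def scaleR_add_left sum.distrib)

text \<open>Nonnegativity excludes cancellation, so the nonzero components of the degree of \<alpha>
  lie among those of the sum, which is a single one; a nonzero \<open>e i\<close> with \<alpha> i >
  0 makes them nonempty.\<close>

lemma pure_add:
  fixes e :: "'N::finite \<Rightarrow> real^'v::finite"
  assumes e: "\<And>i \<mu>. e i $ \<mu> \<ge> 0" "\<And>i. e i \<noteq> 0"
    and \<alpha>: "0 < mi_abs \<alpha>" and p: "pure e (\<alpha> + \<beta>)"
  shows "pure e \<alpha>"
proof -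
  have nonneg: "0 \<le> mdeg e \<delta> $ \<mu>" for \<delta> \<mu>
    unfolding mdeg_def by (simp add: sum_nonneg e(1))
  have "\<exists>i. \<alpha> i \<noteq> 0" using \<alpha> by (rule contrapos_pp) (simp add: mi_abs_def)
  then obtain i where i: "0 < \<alpha> i" by blast
  obtain \<mu> where \<mu>: "e i $ \<mu> \<noteq> 0" using e(2)[of i] by (auto simp: vec_eq_iff)
  have "0 < real (\<alpha> i) * e i $ \<mu>" using i \<mu> e(1)[of i \<mu>] by simp
  also have "\<dots> \<le> (\<Sum>i\<in>UNIV. real (\<alpha> i) * e i $ \<mu>)"
    by (rule member_le_sum) (auto simp: e(1))
  finally have "mdeg e \<alpha> $ \<mu> \<noteq> 0" by (simp add: mdeg_def)
  then have ne: "{\<mu>. mdeg e \<alpha> $ \<mu> \<noteq> 0} \<noteq> {}" by blast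
  have "{\<mu>. mdeg e \<alpha> $ \<mu> \<noteq> 0} \<subseteq> {\<mu>. mdeg e (\<alpha> + \<beta>) $ \<mu> \<noteq> 0}"
    using nonneg by (auto simp: mdeg_add add_nonneg_eq_0_iff)
  moreover obtain \<nu> where "{\<mu>. mdeg e (\<alpha> + \<beta>) $ \<mu> \<noteq> 0} = {\<nu>}"
    using p unfolding pure_def by (rule card_1_singletonE)
  ultimately have "{\<mu>. mdeg e \<alpha> $ \<mu> \<noteq> 0} \<subseteq> {\<nu>}" by (simp only:)
  from subset_singletonD[OF this] ne have "{\<mu>. mdeg e \<alpha> $ \<mu> \<noteq> 0} = {\<nu>}" by argo
  then show ?thesis unfolding pure_def by simp
qed

text \<open>\<open>P\<close> is inherited by summands, so an element whose index satisfies
  \<open>P\<close> is built from generators satisfying \<open>P\<close>. Positivity of the order is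
  carried along because inheritance requires it.\<close>

lemma Lie_closure_graded_family_mdeg:
  assumes P: "\<And>\<alpha> \<beta>. 0 < mi_abs \<alpha> \<Longrightarrow> 0 < mi_abs \<beta> \<Longrightarrow> P (\<alpha> + \<beta>) \<Longrightarrow> P \<alpha> \<and> P \<beta>"
    and "(Y, \<alpha>) \<in> Lie_closure (graded_family Z)"
  shows "0 < mi_abs \<alpha> \<and> (P \<alpha> \<longrightarrow> (Y, mdeg e \<alpha>) \<in> Lie_closure {(Z \<alpha>, mdeg e \<alpha>) | \<alpha>. 0 < mi_abs \<alpha> \<and> P \<alpha>})"
  using assms(2)
proof (induction "(Y, \<alpha>)" arbitrary: Y \<alpha>)
  case base then show ?case by (auto intro!: Lie_closure.base)
next
  case (bracket Z1 d1 Z2 d2)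
  then show ?case using P[of d1 d2] by (auto simp: mdeg_add mi_abs_add intro: Lie_closure.bracket)
qed

lemma Lie_closure_mdeg_lin_comb:
  fixes Y Z :: "('N::finite \<Rightarrow> nat) \<Rightarrow> 'n::finite vf"
  assumes P: "\<And>\<alpha> \<beta>. 0 < mi_abs \<alpha> \<Longrightarrow> 0 < mi_abs \<beta> \<Longrightarrow> P (\<alpha> + \<beta>) \<Longrightarrow> P \<alpha> \<and> P \<beta>"
    and Y: "\<And>\<alpha>. 0 < mi_abs \<alpha> \<Longrightarrow> lin_comb_same_deg (Lie_closure (graded_family Z)) (Y \<alpha>) \<alpha>"
    and Z: "\<And>\<alpha>. 0 < mi_abs \<alpha> \<Longrightarrow> smooth_germ (Z \<alpha>)"
    and "(V, d) \<in> Lie_closure {(Y \<alpha>, mdeg e \<alpha>) | \<alpha>. 0 < mi_abs \<alpha> \<and> P \<alpha>}"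
  shows "lin_comb_same_deg (Lie_closure {(Z \<alpha>, mdeg e \<alpha>) | \<alpha>. 0 < mi_abs \<alpha> \<and> P \<alpha>}) V d"
proof (rule Lie_closure_lin_comb[OF _ _ assms(4)])
  fix V' d' assume "(V', d') \<in> {(Y \<alpha>, mdeg e \<alpha>) | \<alpha>. 0 < mi_abs \<alpha> \<and> P \<alpha>}"
  then obtain \<alpha> where \<alpha>: "V' = Y \<alpha>" "d' = mdeg e \<alpha>" "0 < mi_abs \<alpha>" "P \<alpha>" by blast
  show "lin_comb_same_deg (Lie_closure {(Z \<alpha>, mdeg e \<alpha>) | \<alpha>. 0 < mi_abs \<alpha> \<and> P \<alpha>}) V' d'"
    unfolding \<alpha>(1,2)
    by (rule lin_comb_same_deg_mono[OF Y[OF \<alpha>(3)]])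
       (use Lie_closure_graded_family_mdeg[of P, OF P] \<alpha>(4) in blast)
qed (use Z in auto)

theorem theorem7p8:
  fixes e :: "'N::finite \<Rightarrow> real^'v::finite"
    and \<gamma> :: "real^'N \<Rightarrow> real^'n::finite \<Rightarrow> real^'n"
    and W :: "real^'N \<Rightarrow> 'n vf"
    and X Xh :: "('N \<Rightarrow> nat) \<Rightarrow> 'n vf"
    and U :: "((real^'N) \<times> (real^'n)) set"
  assumes e_nonneg: "\<And>i \<mu>. e i $ \<mu> \<ge> 0"
    and e_nonzero: "\<And>i. e i \<noteq> 0"
    and e_cover: "\<And>\<mu>. \<exists>i. e i $ \<mu> \<noteq> 0"
    and U_open: "open U" and U_0: "(0, 0) \<in> U"
    and \<gamma>_smooth: "smooth_on U (\<lambda>p. \<gamma> (fst p) (snd p))"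
    and \<gamma>_0: "\<And>x. (0, x) \<in> U \<Longrightarrow> \<gamma> 0 x = x"
    and W_def: "\<forall>\<^sub>F (t, y) in nhds (0, 0).
                  ((\<lambda>\<epsilon>::real. \<gamma> (\<epsilon> *\<^sub>R t) y) has_vector_derivative W t (\<gamma> t y)) (at 1)"
    and X_taylor: "\<And>M. \<forall>\<^sub>F x in nhds 0. \<exists>C. \<forall>\<^sub>F t in nhds 0.
                  norm (W t x - trunc_series X M t x) \<le> C * norm t ^ M"
    and Xh_smooth: "\<And>\<alpha>. \<exists>V. open V \<and> 0 \<in> V \<and> smooth_on V (Xh \<alpha>)"
    and Xh_exp: "\<And>M. \<forall>\<^sub>F x in nhds 0. \<exists>C. \<forall>\<^sub>F t in nhds 0.
                  \<exists>z. flow1 (trunc_series Xh M t) x z \<and> norm (\<gamma> t x - z) \<le> C * norm t ^ M"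
  shows "(\<forall>(Z, d) \<in> Lie_closure (pureSet e X \<union> nonpureSet e X).
            lin_comb_same_deg (Lie_closure (pureSet e Xh \<union> nonpureSet e Xh)) Z d)
       \<and> (\<forall>(Z, d) \<in> Lie_closure (pureSet e X).
            lin_comb_same_deg (Lie_closure (pureSet e Xh)) Z d)
       \<and> (\<forall>(Z, d) \<in> Lie_closure (pureSet e Xh \<union> nonpureSet e Xh).
            lin_comb_same_deg (Lie_closure (pureSet e X \<union> nonpureSet e X)) Z d)
       \<and> (\<forall>(Z, d) \<in> Lie_closure (pureSet e Xh).
            lin_comb_same_deg (Lie_closure (pureSet e X)) Z d)"
proof -
  have Xh: "smooth_germ (Xh \<alpha>)" for \<alpha> using Xh_smooth unfolding smooth_germ_def .
  have formula: "\<forall>\<^sub>F x in nhds 0. X \<alpha> x =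
      (\<Sum>l\<in>{l. set l \<subseteq> {\<alpha>. 0 < mi_abs \<alpha> \<and> mi_abs \<alpha> < M} \<and> length l < M \<and> sum_list l = \<alpha>}. (1 / fact (length l)) *\<^sub>R lie_word Xh l x)"
    if "0 < mi_abs \<alpha>" "mi_abs \<alpha> < M" for \<alpha> M
    by (rule taylor_coefficient_formula[OF U_open U_0 \<gamma>_smooth \<gamma>_0 W_def X_taylor Xh Xh_exp that])
  note equiv = graded_families_equivalent[where X = X and Xh = Xh, OF Xh formula]
  \<comment> \<open>The conjunct \<open>True\<close> is the trivial choice of \<open>P\<close>; the
    other choice is \<open>pure e\<close>.\<close>
  have all: "pureSet e Z \<union> nonpureSet e Z = {(Z \<alpha>, mdeg e \<alpha>) | \<alpha>. 0 < mi_abs \<alpha> \<and> True}" for Z :: "('N \<Rightarrow> nat) \<Rightarrow> 'n vf"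
    unfolding pureSet_def nonpureSet_def by blast
  have pure: "pure e \<alpha> \<and> pure e \<beta>" if "0 < mi_abs \<alpha>" "0 < mi_abs \<beta>" "pure e (\<alpha> + \<beta>)" for \<alpha> \<beta>
    using pure_add[where e = e and \<beta> = \<beta>, OF e_nonneg e_nonzero that(1)] that(3)
      pure_add[where e = e and \<beta> = \<alpha>, OF e_nonneg e_nonzero that(2)]
    unfolding add.commute[of \<beta>] by blast
  have "lin_comb_same_deg (Lie_closure (pureSet e Xh \<union> nonpureSet e Xh)) Z d"
    if "(Z, d) \<in> Lie_closure (pureSet e X \<union> nonpureSet e X)" for Z d
    using that unfolding all by (rule Lie_closure_mdeg_lin_comb[rotated 3]) (use equiv(1) Xh in auto)
  moreover have "lin_comb_same_deg (Lie_closure (pureSet e Xh)) Z d"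
    if "(Z, d) \<in> Lie_closure (pureSet e X)" for Z d
    using that unfolding pureSet_def
    by (rule Lie_closure_mdeg_lin_comb[rotated 3]) (use equiv(1) Xh pure in auto)
  moreover have "lin_comb_same_deg (Lie_closure (pureSet e X \<union> nonpureSet e X)) Z d"
    if "(Z, d) \<in> Lie_closure (pureSet e Xh \<union> nonpureSet e Xh)" for Z d
    using that unfolding all by (rule Lie_closure_mdeg_lin_comb[rotated 3]) (use equiv(2,3) in auto)
  moreover have "lin_comb_same_deg (Lie_closure (pureSet e X)) Z d"
    if "(Z, d) \<in> Lie_closure (pureSet e Xh)" for Z d
    using that unfolding pureSet_def
    by (rule Lie_closure_mdeg_lin_comb[rotated 3]) (use equiv(2,3) pure in auto)
  ultimately show ?thesis by auto
qed

end
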